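(* Let $n\ge1$, $0<\sigma<1$, and let $$1\le p<\begin{cases}1+\frac{4}{n-1} & n\le2,\\[2pt] 1+\frac{4n}{n^2+n-4} & n\ge3.\end{cases}$$ Let $\overline{\mathcal{C}}^{\sigma,*}:=\overline{\mathcal{C}^\sigma\cap\{t>1\}}$, and let $V\in C^1(\overline{\mathcal{C}}^{\sigma,*})$ satisfy $C^{-1}\le V\le C$ for some constant $C>1$, and $|\nabla V|=o(t^{-1})$ as $t\nearrow\infty$ (uniformly in $x$). Let $\phi$ be a (real-valued) $C^2$-solution on $\overline{\mathcal{C}}^{\sigma,*}$ of $$\Box\phi+V|\phi|^{p-1}\phi=0.$$ If $$\int_{\partial\mathcal{C}^\sigma\cap\{t>1\}}\left(|\nabla\phi|^2+|\phi|^{p+1}\right)<\infty,$$ then $$\int_{\mathcal{C}^\sigma\cap\{t>1\}}t^{-1}|\phi|^{p+1}<\infty.$$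
   Context: $\Box:=-\partial_t^2+\Delta_x$ is the wave operator on $\mathbb{R}^{n+1}=\mathbb{R}_t\times\mathbb{R}^n_x$. For a $C^1$ function $\phi$, $|\nabla\phi|^2:=(\partial_t\phi)^2+\sum_{i=1}^n(\partial_{x^i}\phi)^2$. For $n=1$, $\frac{4}{n-1}$ is read as $+\infty$. For $0<\sigma<1$, $\mathcal{C}^\sigma:=\{(t,x)\in\mathbb{R}\times\mathbb{R}^n\mid |x|<\sigma t\}$ is the interior of a future time cone, with boundary $\partial\mathcal{C}^\sigma=\{|x|=\sigma t\}$. Integrals over subsets of $\mathcal{C}^\sigma$ are with respect to Lebesgue measure on $\mathbb{R}^{n+1}$; integrals over subsets of $\partial\mathcal{C}^\sigma$ are with respect to the hypersurface measure induced by the Minkowski metric (which is a constant multiple, depending on $\sigma$, of the Euclidean surface measure). *)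

theory Defs
  imports "HOL-Analysis.Analysis"
begin

text \<open>Spacetime \<open>\<real>\<^sub>t \<times> \<real>\<^sup>n\<close>; the dimension \<open>n \<ge> 1\<close> is \<open>CARD('n)\<close>.\<close>

type_synonym 'n spacetime = "real \<times> (real ^ 'n)"


subsection \<open>Derivatives on a set\<close>

text \<open>
  Derivatives are taken within the set on which the function is given, so that the boundary
  of a closed domain is covered and values outside the domain play no role.  On a convex set with
  nonempty interior such derivatives are unique; in the interior they are the usual ones.
\<close>

definition dir_deriv :: "'a set \<Rightarrow> 'a \<Rightarrow> ('a \<Rightarrow> real) \<Rightarrow> 'a::euclidean_space \<Rightarrow> real" where
  "dir_deriv S e f z = frechet_derivative f (at z within S) e"

text \<open>\<open>C_k_on k S f\<close>: \<open>f\<close> is of class \<open>C\<^sup>k\<close> on \<open>S\<close>, up to those boundary points that belong to \<open>S\<close>.\<close>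

primrec C_k_on :: "nat \<Rightarrow> 'a set \<Rightarrow> ('a::euclidean_space \<Rightarrow> real) \<Rightarrow> bool" where
  "C_k_on 0 S f \<longleftrightarrow> continuous_on S f"
| "C_k_on (Suc k) S f \<longleftrightarrow>
     f differentiable_on S \<and> (\<forall>e\<in>Basis. C_k_on k S (dir_deriv S e f))"

definition dt :: "'n spacetime set \<Rightarrow> ('n::finite spacetime \<Rightarrow> real) \<Rightarrow> 'n spacetime \<Rightarrow> real" where
  "dt S = dir_deriv S (1, 0)"

definition dx :: "'n spacetime set \<Rightarrow> 'n \<Rightarrow> ('n::finite spacetime \<Rightarrow> real) \<Rightarrow> 'n spacetime \<Rightarrow> real" where
  "dx S i = dir_deriv S (0, axis i 1)"

definition grad_sq :: "'n spacetime set \<Rightarrow> ('n::finite spacetime \<Rightarrow> real) \<Rightarrow> 'n spacetime \<Rightarrow> real" where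
  "grad_sq S f z = (dt S f z)\<^sup>2 + (\<Sum>i\<in>UNIV. (dx S i f z)\<^sup>2)"

definition wave_op :: "'n spacetime set \<Rightarrow> ('n::finite spacetime \<Rightarrow> real) \<Rightarrow> 'n spacetime \<Rightarrow> real" where
  "wave_op S f z = - dt S (dt S f) z + (\<Sum>i\<in>UNIV. dx S i (dx S i f) z)"


subsection \<open>Cones\<close>

definition time_cone :: "real \<Rightarrow> ('n::finite) spacetime set" where
  "time_cone \<sigma> = {(t, x). norm x < \<sigma> * t}"

definition cone_boundary :: "real \<Rightarrow> ('n::finite) spacetime set" where
  "cone_boundary \<sigma> = {(t, x). norm x = \<sigma> * t}"

definition late :: "('n::finite) spacetime set" where
  "late = {(t, x). t > 1}"

definition truncated_cone :: "real \<Rightarrow> ('n::finite) spacetime set" where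
  "truncated_cone \<sigma> = closure (time_cone \<sigma> \<inter> late)"


subsection \<open>Hypersurface measure induced by the Minkowski metric\<close>

definition minkowski :: "('n::finite) spacetime \<Rightarrow> 'n spacetime \<Rightarrow> real" where
  "minkowski u v = - (fst u * fst v) + snd u \<bullet> snd v"

definition induced_metric :: "(real ^ 'n \<Rightarrow> 'n spacetime) \<Rightarrow> real ^ ('n::finite) \<Rightarrow> real ^ 'n ^ 'n" where
  "induced_metric \<Phi> x = (\<chi> i j. minkowski (frechet_derivative \<Phi> (at x) (axis i 1))
                                            (frechet_derivative \<Phi> (at x) (axis j 1)))"

text \<open>
  For an injective parametrization \<open>\<Phi>\<close> of a hypersurface this is the measure
  \<open>sqrt \<bar>det g\<bar> dx\<close>, with \<open>g\<close> the pullback of the Minkowski metric, transported to spacetime.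
\<close>

definition hypersurface_measure ::
    "(real ^ 'n \<Rightarrow> 'n spacetime) \<Rightarrow> (('n::finite) spacetime) measure" where
  "hypersurface_measure \<Phi> =
     distr (density lborel (\<lambda>x. ennreal (sqrt \<bar>det (induced_metric \<Phi> x)\<bar>))) borel \<Phi>"

text \<open>
  The cone boundary is the graph \<open>t = \<bar>x\<bar> / \<sigma>\<close>.  The parametrization fails to be differentiable
  only at \<open>x = 0\<close> (the vertex), which is a Lebesgue null set.
\<close>

definition cone_boundary_measure :: "real \<Rightarrow> (('n::finite) spacetime) measure" where
  "cone_boundary_measure \<sigma> = hypersurface_measure (\<lambda>x. (norm x / \<sigma>, x))"


lemma det_rank_one_update:
  fixes v :: "real ^ 'n"
  shows "det (\<chi> i j. (if i = j then 1 else 0) - c * (v $ i * v $ j)) = 1 - c * (v \<bullet> v)"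
    (is "det ?M = _")
proof (cases "v = 0")
  case True
  then have "?M = mat 1" by (simp add: mat_def vec_eq_iff)
  then show ?thesis using True by simp
next
  case False
  fix k :: 'n
  have "norm (v /\<^sub>R norm v) = 1" using False by simp
  from orthogonal_matrix_exists_basis[OF this, of k] obtain A where
    A: "orthogonal_matrix A" "A *v (axis k 1) = v /\<^sub>R norm v" by blast
  define D :: "real ^ 'n ^ 'n" where
    "D = (\<chi> i j. (if i = j then 1 else 0) - c * (norm v)\<^sup>2 * (axis k 1 $ i * axis k 1 $ j))"
  have col: "v $ i = norm v * A $ i $ k" for i
  proof -
    have "(A *v (axis k 1)) $ i = A $ i $ k"
      by (simp add: matrix_vector_mult_basis column_def)
    then show ?thesis using A(2) False by (simp add: field_simps)
  qed
  have orth: "(\<Sum>l\<in>UNIV. A $ i $ l * A $ j $ l) = (if i = j then 1 else 0)" for i j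
  proof -
    have "A ** transpose A = mat 1" using A(1) by (simp add: orthogonal_matrix_def)
    then have "(A ** transpose A) $ i $ j = mat 1 $ i $ j" by simp
    then show ?thesis by (simp add: matrix_matrix_mult_def transpose_def mat_def)
  qed
  have AD: "(A ** D) $ i $ l = A $ i $ l - c * (norm v)\<^sup>2 * (A $ i $ k * axis k 1 $ l)" for i l
  proof -
    have "(A ** D) $ i $ l = (\<Sum>m\<in>UNIV. (if m = l then A $ i $ m else 0)
            - (if m = k then c * (norm v)\<^sup>2 * (A $ i $ m * axis k 1 $ l) else 0))"
      unfolding matrix_matrix_mult_def D_def
      by (auto intro!: sum.cong simp: axis_def algebra_simps)
    then show ?thesis by (simp add: sum_subtractf)
  qed
  have "(A ** D ** transpose A) $ i $ j = ?M $ i $ j" for i j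
  proof -
    have "(A ** D ** transpose A) $ i $ j = (\<Sum>l\<in>UNIV. A $ i $ l * A $ j $ l
            - (if l = k then c * (norm v)\<^sup>2 * (A $ i $ k * A $ j $ l) else 0))"
      unfolding matrix_matrix_mult_def[of "A ** D"] transpose_def
      by (auto intro!: sum.cong simp: AD axis_def algebra_simps)
    also have "\<dots> = (if i = j then 1 else 0) - c * (norm v)\<^sup>2 * (A $ i $ k * A $ j $ k)"
      by (simp add: sum_subtractf orth)
    finally show ?thesis by (simp add: col power2_eq_square algebra_simps)
  qed
  then have "A ** D ** transpose A = ?M" by (simp add: vec_eq_iff)
  then have "det ?M = det (A ** D ** transpose A)" by (rule arg_cong[OF sym])
  also have "\<dots> = det D * (det A * det A)" by (simp only: det_mul det_transpose mult_ac)
  also have "det A * det A = 1" using det_orthogonal_matrix[OF A(1)] by auto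
  also have "det D = (\<Prod>i\<in>UNIV. D $ i $ i)" by (rule det_diagonal) (auto simp: D_def axis_def)
  also have "\<dots> = (\<Prod>i\<in>UNIV. if i = k then 1 - c * (norm v)\<^sup>2 else 1)"
    by (rule prod.cong) (auto simp: D_def axis_def)
  finally show ?thesis by (simp add: power2_norm_eq_inner)
qed

text \<open>
  Consequently the cone boundary measure is the image of \<open>sqrt (1 / \<sigma>\<^sup>2 - 1) dx\<close> under
  \<open>x \<mapsto> (\<bar>x\<bar> / \<sigma>, x)\<close>, i.e. a constant multiple of Euclidean surface measure.
\<close>

lemma det_induced_metric_cone:
  fixes x :: "real ^ 'n"
  assumes "x \<noteq> 0" "\<sigma> \<noteq> 0"
  shows "det (induced_metric (\<lambda>x. (norm x / \<sigma>, x)) x) = 1 - 1 / \<sigma>\<^sup>2"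
proof -
  have D: "((\<lambda>x. (norm x / \<sigma>, x)) has_derivative (\<lambda>h. (h \<bullet> sgn x / \<sigma>, h))) (at x)"
    by (intro has_derivative_Pair has_derivative_ident bounded_linear.has_derivative[OF bounded_linear_divide]
         has_derivative_norm assms)
  have "induced_metric (\<lambda>x. (norm x / \<sigma>, x)) x =
     (\<chi> i j. (if i = j then 1 else 0) - (1 / \<sigma>\<^sup>2) * (sgn x $ i * sgn x $ j))"
    unfolding induced_metric_def frechet_derivative_at[OF D, symmetric] minkowski_def
    by (simp add: vec_eq_iff inner_axis' inner_axis power2_eq_square) (simp add: axis_def)
  moreover have "sgn x \<bullet> sgn x = 1"
    using assms by (metis dot_square_norm norm_sgn one_power2)
  ultimately show ?thesis by (simp only: det_rank_one_update mult_1_right)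
qed


subsection \<open>The range of exponents\<close>

definition exponent_bound :: "nat \<Rightarrow> ereal" where
  "exponent_bound n =
     (if n = 1 then \<infinity>
      else if n = 2 then ereal (1 + 4 / (real n - 1))
      else ereal (1 + 4 * real n / ((real n)\<^sup>2 + real n - 4)))"

end

theory Submission
  imports Defs
begin

text \<open>
  For a point \<open>q\<close> outside the cone let \<open>S\<close> be the scaling field about \<open>q\<close> and \<open>v = m(S, S)\<close> its
  Minkowski square.  The part of the cone where \<open>v > 0\<close> is bounded, and the multiplier
  \<open>v\<^bsup>a\<^esup> (S \<phi> + c \<phi>)\<close> with \<open>c = (n - 1) / 2 + a\<close> produces the divergence
  \<open>2 a v\<^bsup>a - 1\<^esup> (S \<phi> + c \<phi>)\<^sup>2\<close> plus a multiple of \<open>v\<^bsup>a\<^esup> V \<bar>\<phi>\<bar>\<^bsup>p + 1\<^esup>\<close>, which is positive for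
  subconformal \<open>p\<close> and small \<open>a > 0\<close>.  Since the weight vanishes on the null cone of \<open>q\<close>, the only flux
  left is the one through the lateral boundary, so no information for \<open>t \<rightarrow> \<infinity>\<close> is needed.  The flux
  contains the singular term \<open>v\<^bsup>a - 1\<^esup> \<phi>\<^sup>2\<close>; letting \<open>q\<close> run through a timelike ray with the weight
  \<open>l\<^bsup>- 2 a - 2\<^esup> dl\<close> turns it into \<open>t\<^bsup>- 2\<^esup> \<phi>\<^sup>2\<close>, which the energy controls, and at the same time
  turns the bulk term into \<open>t\<^bsup>- 1\<^esup> \<bar>\<phi>\<bar>\<^bsup>p + 1\<^esup>\<close>.
\<close>

section \<open>Calculus and the divergence theorem above a graph\<close>

text \<open>The value c = (n - 1) / 2 + a is forced: it removes the kinetic term m(d\<phi>,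
  d\<phi>), which has no sign, from the divergence. What then multiplies the potential energy is (4
  - (n - 1) (p - 1)) / 2 - a (p - 1), so a subconformal p leaves room for a small positive a. The
  exponent a - 1 makes the weight singular on the null cone of q, where the current is not C^1. The
  divergence theorem is therefore applied to a regularised weight, and the extra divergence is
  removed by dominated convergence, which needs v^(a - 1) to be integrable. With q outside the cone,
  the spatial distance to q is at least a multiple of l on the region in question, so that v has
  simple zeros in t there. The ray of vertices is timelike so that t and l are comparable wherever v
  > 0. The power of l comes from scaling: v^a has size l^(2a), the integration over l adds one
  power, and the flux carries a further factor l, the size of S.\<close>

definition C1_on :: "'a::real_normed_vector set \<Rightarrow> ('a \<Rightarrow> 'b::real_normed_vector) \<Rightarrow> ('a \<Rightarrow> 'a \<Rightarrow> 'b) \<Rightarrow> bool"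
  where "C1_on S f f' \<longleftrightarrow>
    (\<forall>z\<in>S. (f has_derivative f' z) (at z within S)) \<and> (\<forall>e. continuous_on S (\<lambda>z. f' z e))"

lemma C1_onD:
  assumes "C1_on S f f'"
  shows "z \<in> S \<Longrightarrow> (f has_derivative f' z) (at z within S)" "continuous_on S (\<lambda>z. f' z e)"
  using assms by (auto simp: C1_on_def)

lemma C1_on_continuous: "C1_on S f f' \<Longrightarrow> continuous_on S f"
  unfolding C1_on_def continuous_on_eq_continuous_within
  by (meson has_derivative_continuous)

lemma C1_on_affine:
  assumes "bounded_linear f"
  shows "C1_on S (\<lambda>z. f z + c) (\<lambda>_ h. f h)"
  unfolding C1_on_def using assms
  by (auto intro!: derivative_eq_intros bounded_linear.has_derivative[OF assms])

lemma C1_on_add: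
  "C1_on S f f' \<Longrightarrow> C1_on S g g' \<Longrightarrow> C1_on S (\<lambda>z. f z + g z) (\<lambda>z h. f' z h + g' z h)"
  unfolding C1_on_def by (auto intro!: derivative_eq_intros continuous_intros)

lemma C1_on_diff:
  "C1_on S f f' \<Longrightarrow> C1_on S g g' \<Longrightarrow> C1_on S (\<lambda>z. f z - g z) (\<lambda>z h. f' z h - g' z h)"
  unfolding C1_on_def by (auto intro!: derivative_eq_intros continuous_intros)

lemma C1_on_bilinear:
  assumes "bounded_bilinear B" "C1_on S f f'" "C1_on S g g'"
  shows "C1_on S (\<lambda>z. B (f z) (g z)) (\<lambda>z h. B (f z) (g' z h) + B (f' z h) (g z))"
  unfolding C1_on_def
  using bounded_bilinear.FDERIV[OF assms(1) C1_onD(1)[OF assms(2)] C1_onD(1)[OF assms(3)]]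
    bounded_bilinear.continuous_on[OF assms(1) C1_on_continuous[OF assms(2)] C1_onD(2)[OF assms(3)]]
    bounded_bilinear.continuous_on[OF assms(1) C1_onD(2)[OF assms(2)] C1_on_continuous[OF assms(3)]]
  by (auto intro!: continuous_intros)

lemmas C1_on_scaleR = C1_on_bilinear[OF bounded_bilinear_scaleR]
lemmas C1_on_inner = C1_on_bilinear[OF bounded_bilinear_inner]
lemmas C1_on_mult = C1_on_bilinear[OF bounded_bilinear_mult]

lemma C1_on_linear:
  assumes "bounded_linear T" "C1_on S f f'"
  shows "C1_on S (\<lambda>z. T (f z)) (\<lambda>z h. T (f' z h))"
  unfolding C1_on_def
  using bounded_linear.has_derivative[OF assms(1) C1_onD(1)[OF assms(2)]]
    bounded_linear.continuous_on[OF assms(1) C1_onD(2)[OF assms(2)]] by auto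

lemma C1_on_compose_real:
  fixes g :: "real \<Rightarrow> real"
  assumes "\<And>y. (g has_real_derivative g' y) (at y)" "continuous_on UNIV g'" "C1_on S f f'"
  shows "C1_on S (\<lambda>z. g (f z)) (\<lambda>z h. g' (f z) * f' z h)"
  unfolding C1_on_def
proof (intro conjI ballI allI)
  fix z assume "z \<in> S"
  then show "((\<lambda>z. g (f z)) has_derivative (\<lambda>h. g' (f z) * f' z h)) (at z within S)"
    using has_derivative_compose[OF C1_onD(1)[OF assms(3)]
        assms(1)[of "f z", unfolded has_field_derivative_def]] by simp
next
  fix e show "continuous_on S (\<lambda>z. g' (f z) * f' z e)"
    using continuous_on_compose2[OF assms(2) C1_on_continuous[OF assms(3)]] C1_onD(2)[OF assms(3)]
    by (auto intro!: continuous_intros)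
qed

text \<open>Applied to the derivative of a vector field at a point, this is its divergence.\<close>

definition lin_trace :: "('a::euclidean_space \<Rightarrow> 'a) \<Rightarrow> real" where
  "lin_trace T = (\<Sum>b\<in>Basis. T b \<bullet> b)"

text \<open>Difference quotients of \<open>G\<close> integrate to zero by translation invariance.
  The Lipschitz bound dominates them on a fixed ball, so their a.e. limit \<open>G'\<close>
  integrates to zero too. An a.e. derivative is all that a graph with corners provides.\<close>

lemma integral_directional_derivative_zero:
  fixes G :: "'b::euclidean_space \<Rightarrow> real"
  assumes lip: "L-lipschitz_on UNIV G" and supp: "\<And>x. norm x > R \<Longrightarrow> G x = 0"
    and meas: "G' \<in> borel_measurable lborel"
    and deriv: "AE x in lborel. ((\<lambda>s. G (x + s *\<^sub>R b)) has_real_derivative G' x) (at 0)"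
  shows "integral\<^sup>L lborel G' = 0"
proof -
  define d :: "nat \<Rightarrow> real" where "d k = inverse (real (Suc k))" for k
  have d: "0 < d k" "d k \<le> 1" for k by (auto simp: d_def field_simps)
  define F where "F k x = (G (x + d k *\<^sub>R b) - G x) / d k" for k x
  have cont: "continuous_on UNIV G" using lip by (rule lipschitz_on_continuous_on)
  have [measurable]: "G \<in> borel_measurable borel"
    using cont by (rule borel_measurable_continuous_onI)
  have [measurable]: "G' \<in> borel_measurable borel" using meas by simp
  have G_ind: "G = (\<lambda>x. indicator (cball 0 R) x *\<^sub>R G x)"
    using supp by (auto simp: fun_eq_iff indicator_def)
  have G_int: "integrable lborel G"
    by (subst G_ind) (intro borel_integrable_compact continuous_on_subset[OF cont], auto)
  have shift: "integrable lborel (\<lambda>x. G (x + c))" "(\<integral>x. G (x + c) \<partial>lborel) = integral\<^sup>L lborel G" for c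
  proof -
    have "integrable (distr lborel borel ((+) c)) G" using G_int by (simp add: lborel_distr_plus)
    then show "integrable lborel (\<lambda>x. G (x + c))"
      by (subst (asm) integrable_distr_eq) (auto simp: add.commute)
    have "integral\<^sup>L lborel G = integral\<^sup>L (distr lborel borel ((+) c)) G" by (simp add: lborel_distr_plus)
    also have "\<dots> = (\<integral>x. G (x + c) \<partial>lborel)" by (subst integral_distr) (auto simp: add.commute)
    finally show "(\<integral>x. G (x + c) \<partial>lborel) = integral\<^sup>L lborel G" ..
  qed
  have F0: "integral\<^sup>L lborel (F k) = 0" for k
    unfolding F_def using shift[of "d k *\<^sub>R b"] G_int by simp
  have "(\<lambda>k. integral\<^sup>L lborel (F k)) \<longlonglongrightarrow> integral\<^sup>L lborel G'"
  \<comment> \<open>The steps \<open>d k\<close> are at most 1, so outside the ball enlarged by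
    \<open>norm b\<close> both points of the quotient lie off the support.\<close>
  proof (rule integral_dominated_convergence[where w = "\<lambda>x. indicator (cball 0 (R + norm b)) x *\<^sub>R (L * norm b)"])
    show "integrable lborel (\<lambda>x::'b. indicator (cball 0 (R + norm b)) x *\<^sub>R (L * norm b))"
      by (intro borel_integrable_compact) auto
    show "AE x in lborel. (\<lambda>k. F k x) \<longlonglongrightarrow> G' x"
      using deriv
    proof eventually_elim
      case (elim x)
      then have "((\<lambda>h. (G (x + h *\<^sub>R b) - G x) / h) \<longlongrightarrow> G' x) (at 0)"
        by (simp add: has_field_derivative_iff)
      moreover have "filterlim d (at 0) sequentially"
        unfolding filterlim_at d_def using LIMSEQ_inverse_real_of_nat by auto
      ultimately show ?case unfolding F_def by (rule filterlim_compose)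
    qed
    show "AE x in lborel. norm (F k x) \<le> indicator (cball 0 (R + norm b)) x *\<^sub>R (L * norm b)" for k
    proof (intro AE_I2)
      fix x
      have db: "norm (d k *\<^sub>R b) \<le> norm b" using d[of k] by (simp add: mult_left_le_one_le)
      have "\<bar>G (x + d k *\<^sub>R b) - G x\<bar> \<le> L * (d k * norm b)"
        using lipschitz_onD[OF lip, of "x + d k *\<^sub>R b" x] d[of k] by (auto simp: dist_norm)
      then have 1: "norm (F k x) \<le> L * norm b" using d[of k] by (simp add: F_def field_simps)
      show "norm (F k x) \<le> indicator (cball 0 (R + norm b)) x *\<^sub>R (L * norm b)"
      proof (cases "norm x \<le> R + norm b")
        case False
        then have "norm x > R" "norm (x + d k *\<^sub>R b) > R"
          using db norm_triangle_ineq2[of x "- (d k *\<^sub>R b)"] norm_ge_zero[of b]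
          unfolding minus_minus diff_minus_eq_add norm_minus_cancel by linarith+
        then show ?thesis using lip by (simp add: F_def supp lipschitz_on_def)
      qed (use 1 in auto)
    qed
    show "F k \<in> borel_measurable lborel" for k unfolding F_def[abs_def] by measurable
  qed (use meas in auto)
  then show ?thesis using F0 by (simp add: LIMSEQ_const_iff)
qed

lemma nn_integral_lborel_fst_snd:
  fixes f :: "'a::euclidean_space \<times> 'b::euclidean_space \<Rightarrow> ennreal"
  assumes "f \<in> borel_measurable borel"
  shows "integral\<^sup>N lborel f = (\<integral>\<^sup>+x. \<integral>\<^sup>+s. f (s, x) \<partial>lborel \<partial>lborel)"
    and "integral\<^sup>N lborel f = (\<integral>\<^sup>+s. \<integral>\<^sup>+x. f (s, x) \<partial>lborel \<partial>lborel)"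
  using lborel_pair.nn_integral_snd[of f] lborel.nn_integral_fst[of f lborel] assms
  by (simp_all add: lborel_prod)

text \<open>On every line of constant \<open>x\<close> the shear is a translation, so Tonelli
  reduces the claim to one dimension.\<close>

lemma distr_shear:
  fixes h :: "'b::euclidean_space \<Rightarrow> real"
  assumes [measurable]: "h \<in> borel_measurable borel"
  shows "distr lborel borel (\<lambda>z. (fst z + h (snd z), snd z)) = (lborel :: (real \<times> 'b) measure)"
proof (rule measure_eqI)
  fix A :: "(real \<times> 'b) set" assume "A \<in> sets (distr lborel borel (\<lambda>z. (fst z + h (snd z), snd z)))"
  then have [measurable]: "A \<in> sets borel" by simp
  have [measurable]: "(\<lambda>z::real\<times>'b. (fst z + h (snd z), snd z)) \<in> borel_measurable borel"
    unfolding borel_prod[symmetric] by measurable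
  have "emeasure (distr lborel borel (\<lambda>z. (fst z + h (snd z), snd z))) A =
     (\<integral>\<^sup>+z. indicator A (fst z + h (snd z), snd z) \<partial>(lborel :: (real\<times>'b) measure))"
    by (subst nn_integral_indicator[symmetric], simp, subst nn_integral_distr) auto
  also have "\<dots> = (\<integral>\<^sup>+x. \<integral>\<^sup>+s. indicator A (s + h x, x) \<partial>lborel \<partial>lborel)"
    by (subst nn_integral_lborel_fst_snd(1)) auto
  also have "\<dots> = (\<integral>\<^sup>+x. \<integral>\<^sup>+s. indicator A (s, x) \<partial>lborel \<partial>lborel)"
  proof (rule nn_integral_cong)
    fix x
    have [measurable]: "(\<lambda>s. (s, x)) \<in> measurable borel (borel :: (real\<times>'b) measure)"
      unfolding borel_prod[symmetric] by measurable
    show "(\<integral>\<^sup>+s. indicator A (s + h x, x) \<partial>lborel) = (\<integral>\<^sup>+s. indicator A (s, x) \<partial>lborel)"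
      using nn_integral_real_affine[of "\<lambda>s. indicator A (s, x)" 1 "h x"] by (simp add: add.commute)
  qed
  also have "\<dots> = (\<integral>\<^sup>+z. indicator A z \<partial>(lborel :: (real\<times>'b) measure))"
    by (subst nn_integral_lborel_fst_snd(1)) auto
  finally show "emeasure (distr lborel borel (\<lambda>z. (fst z + h (snd z), snd z))) A = emeasure lborel A"
    by simp
qed auto


text \<open>\<open>C1_on\<close> controls the derivative one direction at a time; this turns bounds
  on the basis vectors into a bound on the operator.\<close>

lemma norm_le_sum_Basis:
  assumes "bounded_linear T"
  shows "norm (T x) \<le> norm x * (\<Sum>b\<in>Basis. norm (T b))"
proof -
  have "norm (T x) = norm (\<Sum>b\<in>Basis. (x \<bullet> b) *\<^sub>R T b)"
    using linear_sum[OF bounded_linear.linear[OF assms], of "\<lambda>b. (x \<bullet> b) *\<^sub>R b" Basis]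
    by (simp add: euclidean_representation linear_scale[OF bounded_linear.linear[OF assms]])
  also have "\<dots> \<le> (\<Sum>b\<in>Basis. norm x * norm (T b))"
    by (rule norm_sum[THEN order_trans]) (auto intro!: sum_mono mult_right_mono simp: Basis_le_norm)
  finally show ?thesis by (simp add: sum_distrib_left)
qed

text \<open>Flattening the graph by \<open>(s, x) \<mapsto> (s + h x, x)\<close>, the derivatives along the graph integrate to zero
  over the slices of constant \<open>s\<close>, and what remains of the divergence is a derivative in \<open>s\<close>.\<close>

theorem divergence_theorem_epigraph:
  fixes P :: "real \<times> 'b::euclidean_space \<Rightarrow> real \<times> 'b" and h :: "'b \<Rightarrow> real"
  defines "C \<equiv> {z. h (snd z) \<le> fst z}" and "\<Omega> \<equiv> {z. h (snd z) < fst z}"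
  assumes h: "L-lipschitz_on UNIV h" and convex: "convex C"
    and g: "g \<in> borel_measurable borel" "\<And>x. norm (g x) \<le> L"
    and dh: "AE x in lborel. (h has_derivative (\<lambda>y. g x \<bullet> y)) (at x)"
    and P: "C1_on C P P'"
    and supp: "\<And>z. z \<in> C \<Longrightarrow> norm z > R \<Longrightarrow> P z = 0"
      "\<And>z e. z \<in> C \<Longrightarrow> norm z > R \<Longrightarrow> P' z e = 0"
  shows "integrable lborel (\<lambda>z. indicator \<Omega> z *\<^sub>R lin_trace (P' z))"
    and "(\<integral>z. indicator \<Omega> z *\<^sub>R lin_trace (P' z) \<partial>lborel) = (\<integral>x. P (h x, x) \<bullet> (- 1, g x) \<partial>lborel)"
proof -
  have ch: "continuous_on UNIV h" using h by (rule lipschitz_on_continuous_on)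
  have [measurable]: "h \<in> borel_measurable borel" using ch by (rule borel_measurable_continuous_onI)
  note [measurable] = g(1)
  have L0: "L \<ge> 0" using h by (simp add: lipschitz_on_def)
  have ch': "continuous_on UNIV (\<lambda>z::real\<times>'b. h (snd z))"
    by (intro continuous_on_compose2[OF ch] continuous_intros) auto
  have cC: "closed C" unfolding C_def by (intro closed_Collect_le continuous_intros ch')
  have oO: "open \<Omega>" unfolding \<Omega>_def by (intro open_Collect_less continuous_intros ch')
  have OC: "\<Omega> \<subseteq> C" by (auto simp: C_def \<Omega>_def)
  have DO: "(P has_derivative P' z) (at z)" if "z \<in> \<Omega>" for z
    using C1_onD(1)[OF P, of z] that OC oO
    by (metis at_within_open has_derivative_subset subsetD)
  have lin: "bounded_linear (P' z)" if "z \<in> C" for z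
    using C1_onD(1)[OF P that] by (rule has_derivative_bounded_linear)
  have "\<forall>e. \<exists>B. \<forall>z\<in>C \<inter> cball 0 R. norm (P' z e) \<le> B"
  proof
    fix e
    have "compact (C \<inter> cball 0 R)" using cC by (simp add: closed_Int_compact)
    then have "compact ((\<lambda>z. P' z e) ` (C \<inter> cball 0 R))"
      by (intro compact_continuous_image continuous_on_subset[OF C1_onD(2)[OF P]]) auto
    then show "\<exists>B. \<forall>z\<in>C \<inter> cball 0 R. norm (P' z e) \<le> B"
      using compact_imp_bounded[of "(\<lambda>z. P' z e) ` (C \<inter> cball 0 R)"] by (auto simp: bounded_iff)
  qed
  then obtain Be where Be: "\<And>e z. z \<in> C \<Longrightarrow> norm z \<le> R \<Longrightarrow> norm (P' z e) \<le> Be e"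
    by (metis IntI mem_cball_0)
  define M where "M = (\<Sum>b\<in>Basis. \<bar>Be b\<bar>)"
  have M0: "M \<ge> 0" by (auto simp: M_def intro!: sum_nonneg)
  have M: "norm (P' z e) \<le> M * norm e" if "z \<in> C" for z e
  proof (cases "norm z \<le> R")
    case True
    have "norm (P' z e) \<le> norm e * (\<Sum>b\<in>Basis. norm (P' z b))"
      by (rule norm_le_sum_Basis[OF lin[OF that]])
    also have "\<dots> \<le> norm e * M" unfolding M_def
      using Be[OF that True] by (intro mult_left_mono sum_mono) (auto intro: order_trans[OF _ abs_ge_self])
    finally show ?thesis by (simp add: mult.commute)
  qed (use supp that M0 in auto)
  \<comment> \<open>Convexity of the region enters here: the mean value inequality along segments
    turns the derivative bound into a global Lipschitz bound, which makes \<open>P\<close> Lipschitz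
    on each flattened slice.\<close>
  have Plip: "norm (P z - P w) \<le> M * norm (z - w)" if "z \<in> C" "w \<in> C" for z w
    by (rule differentiable_bound[OF convex C1_onD(1)[OF P] _ that])
       (auto intro!: onorm_bound M0 M)
  define \<Psi> where "\<Psi> z = (fst z + h (snd z), snd z)" for z :: "real \<times> 'b"
  have [measurable]: "\<Psi> \<in> borel_measurable borel"
    unfolding \<Psi>_def borel_prod[symmetric] by measurable
  have \<Psi>O: "\<Psi> (s, x) \<in> \<Omega> \<longleftrightarrow> s > 0" and \<Psi>C: "\<Psi> (s, x) \<in> C \<longleftrightarrow> s \<ge> 0" for s x
    by (auto simp: \<Psi>_def \<Omega>_def C_def)
  have shear: "integrable lborel f \<Longrightarrow> integrable lborel (\<lambda>z. f (\<Psi> z))"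
    "integrable lborel f \<Longrightarrow> integral\<^sup>L lborel f = (\<integral>z. f (\<Psi> z) \<partial>lborel)" for f :: "real \<times> 'b \<Rightarrow> real"
  proof -
    assume f: "integrable lborel f"
    then have [measurable]: "f \<in> borel_measurable borel" by auto
    have d: "distr lborel borel \<Psi> = lborel"
      using distr_shear[of h] by (simp add: \<Psi>_def[abs_def])
    from f have "integrable (distr lborel borel \<Psi>) f" by (simp add: d)
    then show "integrable lborel (\<lambda>z. f (\<Psi> z))" by (subst (asm) integrable_distr_eq) auto
    have "integral\<^sup>L lborel f = integral\<^sup>L (distr lborel borel \<Psi>) f" by (simp add: d)
    then show "integral\<^sup>L lborel f = (\<integral>z. f (\<Psi> z) \<partial>lborel)" by (subst (asm) integral_distr) auto
  qed
  have P'meas[measurable]: "(\<lambda>z. indicator \<Omega> z *\<^sub>R P' z e) \<in> borel_measurable borel" for e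
    by (intro borel_measurable_continuous_on_indicator continuous_on_subset[OF C1_onD(2)[OF P] OC])
       (use oO in auto)
  have bdd_int: "integrable lborel f"
    if [measurable]: "f \<in> borel_measurable borel" and f: "\<And>z. \<bar>f z\<bar> \<le> B" "\<And>z. norm z > R \<Longrightarrow> f z = 0"
    for f :: "real \<times> 'b \<Rightarrow> real" and B
  proof (rule Bochner_Integration.integrable_bound)
    show "integrable lborel (\<lambda>z::real\<times>'b. indicator (cball 0 R) z *\<^sub>R B)"
      by (intro borel_integrable_compact) auto
    show "AE z in lborel. norm (f z) \<le> norm (indicator (cball 0 R) z *\<^sub>R B)"
    proof (intro AE_I2)
      fix z show "norm (f z) \<le> norm (indicator (cball 0 R) z *\<^sub>R B)"
        using f[of z] by (cases "norm z \<le> R") (auto simp: indicator_def)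
    qed
  qed simp
  define \<tau> where "\<tau> = (1::real, 0::'b)"
  \<comment> \<open>By the chain rule, \<open>F b\<close> at \<open>\<Psi> (s, x)\<close> is the
    derivative in direction \<open>b\<close> of the component \<open>b\<close> of
    \<open>P (\<Psi> (s, x))\<close> as a function of \<open>x\<close>. What is left of the
    divergence is \<open>W\<close>, the \<open>\<tau>\<close>-derivative of \<open>P\<close> paired
    with the vector \<open>(1, - g)\<close> normal to the graph.\<close>
  define F where "F b z = (indicator \<Omega> z *\<^sub>R P' z (0, b)) \<bullet> (0, b)
    + (g (snd z) \<bullet> b) * ((indicator \<Omega> z *\<^sub>R P' z \<tau>) \<bullet> (0, b))" for b z
  define W where "W z = (indicator \<Omega> z *\<^sub>R P' z \<tau>) \<bullet> (1, - g (snd z))" for z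
  have [measurable]: "(\<lambda>z::real\<times>'b. g (snd z)) \<in> borel_measurable borel"
    "(\<lambda>z::real\<times>'b. (1::real, - g (snd z))) \<in> borel_measurable borel"
    "(\<lambda>x. (1::real, - g x)) \<in> borel_measurable borel"
    unfolding borel_prod[symmetric] by measurable
  have \<tau>1: "norm \<tau> = 1" by (simp add: \<tau>_def norm_Pair)
  have P'b: "norm (indicator \<Omega> z *\<^sub>R P' z e) \<le> M * norm e" for z e
    using M[of z e] OC M0 by (auto simp: indicator_def)
  have P's: "indicator \<Omega> z *\<^sub>R P' z e = 0" if "norm z > R" for z e
    using supp(2)[of z e] that OC by (auto simp: indicator_def)
  have F_int: "integrable lborel (F b)" if b: "b \<in> Basis" for b
  proof (rule bdd_int)
    show "F b \<in> borel_measurable borel" unfolding F_def by measurable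
    fix z :: "real \<times> 'b"
    have nb: "norm (0::real, b) = 1" "norm b = 1" using b by (auto simp: norm_Pair)
    have "\<bar>(indicator \<Omega> z *\<^sub>R P' z (0, b)) \<bullet> (0, b)\<bar> \<le> M"
      using Cauchy_Schwarz_ineq2[of "indicator \<Omega> z *\<^sub>R P' z (0, b)" "(0, b)"] P'b[of z "(0,b)"] nb by simp
    moreover have "\<bar>(g (snd z) \<bullet> b) * ((indicator \<Omega> z *\<^sub>R P' z \<tau>) \<bullet> (0, b))\<bar> \<le> L * M"
      unfolding abs_mult
      using Cauchy_Schwarz_ineq2[of "indicator \<Omega> z *\<^sub>R P' z \<tau>" "(0, b)"] P'b[of z \<tau>] nb \<tau>1
        Cauchy_Schwarz_ineq2[of "g (snd z)" b] g(2)[of "snd z"] L0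
      by (intro mult_mono) auto
    ultimately show "\<bar>F b z\<bar> \<le> M + L * M" unfolding F_def by linarith
    show "F b z = 0" if "norm z > R" unfolding F_def by (simp only: P's[OF that]) simp
  qed
  have W_int: "integrable lborel W"
  proof (rule bdd_int)
    show "W \<in> borel_measurable borel" unfolding W_def by measurable
    fix z :: "real \<times> 'b"
    have "norm (1::real, - g (snd z)) \<le> 1 + L"
      using norm_Pair_le[of "1::real" "- g (snd z)"] g(2)[of "snd z"] by simp
    then show "\<bar>W z\<bar> \<le> M * (1 + L)" unfolding W_def
      using P'b[of z \<tau>] \<tau>1 M0
      by (intro order_trans[OF Cauchy_Schwarz_ineq2] mult_mono) auto
    show "W z = 0" if "norm z > R" unfolding W_def by (simp only: P's[OF that]) simp
  qed
  have split: "indicator \<Omega> z *\<^sub>R lin_trace (P' z) = (\<Sum>b\<in>Basis. F b z) + W z" for z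
  proof -
    have tr: "lin_trace (P' z) = P' z \<tau> \<bullet> \<tau> + (\<Sum>b\<in>Basis. P' z (0, b) \<bullet> (0, b))"
      unfolding lin_trace_def Basis_prod_def \<tau>_def
      by (subst sum.union_disjoint) (auto simp: sum.reindex inj_on_def)
    have "(\<Sum>b\<in>Basis. (g (snd z) \<bullet> b) * (P' z \<tau> \<bullet> (0, b))) = P' z \<tau> \<bullet> (0, g (snd z))"
      using euclidean_inner[of "g (snd z)" "snd (P' z \<tau>)"]
      by (simp add: inner_prod_def inner_commute)
    then show ?thesis unfolding F_def W_def tr
      by (cases "z \<in> \<Omega>") (auto simp: sum.distrib inner_prod_def \<tau>_def)
  qed
  show "integrable lborel (\<lambda>z. indicator \<Omega> z *\<^sub>R lin_trace (P' z))"
    unfolding split using F_int W_int by auto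
  have F0: "integral\<^sup>L lborel (F b) = 0" if b: "b \<in> Basis" for b
  proof -
    have "integral\<^sup>L lborel (F b) = (\<integral>z. F b (\<Psi> z) \<partial>lborel)" by (rule shear(2)[OF F_int[OF b]])
    also have "\<dots> = (\<integral>s. \<integral>x. F b (\<Psi> (s, x)) \<partial>lborel \<partial>lborel)"
      using lborel_pair.integral_fst'[of "\<lambda>z. F b (\<Psi> z)"] shear(1)[OF F_int[OF b]]
      by (simp add: lborel_prod)
    also have "\<dots> = (\<integral>s. 0 \<partial>(lborel::real measure))"
    proof (rule Bochner_Integration.integral_cong[OF refl])
      fix s :: real
      show "(\<integral>x. F b (\<Psi> (s, x)) \<partial>lborel) = 0"
      proof (cases "s > 0")
        case False then show ?thesis by (simp add: F_def \<Psi>O)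
      next
        case s: True
        define G where "G x = P (\<Psi> (s, x)) \<bullet> (0, b)" for x
        have [measurable]: "(\<lambda>x. (s, x)) \<in> measurable borel (borel :: (real\<times>'b) measure)"
          unfolding borel_prod[symmetric] by measurable
        have [measurable]: "F b \<in> borel_measurable borel" using F_int[OF b] by auto
        show ?thesis
        proof (rule integral_directional_derivative_zero[where G = G and R = R and b = b])
          show "(M * (1 + L))-lipschitz_on UNIV G"
          proof (rule lipschitz_onI)
            fix x y
            have "norm (\<Psi> (s, x) - \<Psi> (s, y)) \<le> norm (h x - h y) + norm (x - y)"
              using norm_Pair_le[of "h x - h y" "x - y"] by (simp add: \<Psi>_def)
            also have "\<dots> \<le> (1 + L) * norm (x - y)"
              using lipschitz_onD[OF h, of x y] by (simp add: dist_norm algebra_simps)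
            finally have 1: "norm (\<Psi> (s, x) - \<Psi> (s, y)) \<le> (1 + L) * norm (x - y)" .
            have "dist (G x) (G y) \<le> norm (P (\<Psi> (s, x)) - P (\<Psi> (s, y)))"
              using Cauchy_Schwarz_ineq2[of "P (\<Psi> (s, x)) - P (\<Psi> (s, y))" "(0, b)"] b
              by (simp add: G_def dist_norm inner_diff_left[symmetric] norm_Pair)
            also have "\<dots> \<le> M * norm (\<Psi> (s, x) - \<Psi> (s, y))"
              using s by (intro Plip) (auto simp: \<Psi>C)
            also have "\<dots> \<le> M * ((1 + L) * norm (x - y))" using 1 M0 by (intro mult_left_mono)
            finally show "dist (G x) (G y) \<le> M * (1 + L) * dist x y" by (simp add: dist_norm)
          qed (use M0 L0 in auto)
          show "G x = 0" if "norm x > R" for x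
          proof -
            have "norm (\<Psi> (s, x)) \<ge> norm x" by (simp add: \<Psi>_def norm_snd_le)
            then show ?thesis using that supp(1)[of "\<Psi> (s, x)"] s by (simp add: G_def \<Psi>C)
          qed
          show "AE x in lborel. ((\<lambda>\<sigma>. G (x + \<sigma> *\<^sub>R b)) has_real_derivative F b (\<Psi> (s, x))) (at 0)"
            using dh
          proof eventually_elim
            case (elim x)
            have in_O: "\<Psi> (s, x) \<in> \<Omega>" using s by (simp add: \<Psi>O)
            have lx: "((\<lambda>\<sigma>. x + \<sigma> *\<^sub>R b) has_derivative (\<lambda>\<sigma>. \<sigma> *\<^sub>R b)) (at 0)"
              by (auto intro!: derivative_eq_intros)
            have "((\<lambda>\<sigma>. h (x + \<sigma> *\<^sub>R b)) has_derivative (\<lambda>\<sigma>. g x \<bullet> (\<sigma> *\<^sub>R b))) (at 0)"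
              using has_derivative_compose[OF lx, of h "\<lambda>y. g x \<bullet> y"] elim by simp
            then have "((\<lambda>\<sigma>. \<Psi> (s, x + \<sigma> *\<^sub>R b)) has_derivative (\<lambda>\<sigma>. (g x \<bullet> (\<sigma> *\<^sub>R b), \<sigma> *\<^sub>R b))) (at 0)"
              unfolding \<Psi>_def by (auto intro!: derivative_eq_intros)
            from has_derivative_compose[OF this, of P "P' (\<Psi> (s, x))"]
            have "((\<lambda>\<sigma>. P (\<Psi> (s, x + \<sigma> *\<^sub>R b))) has_derivative
                (\<lambda>\<sigma>. P' (\<Psi> (s, x)) (g x \<bullet> (\<sigma> *\<^sub>R b), \<sigma> *\<^sub>R b))) (at 0)"
              using DO[OF in_O] by simp
            from has_derivative_inner_left[OF this, of "(0, b)"]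
            have D: "((\<lambda>\<sigma>. G (x + \<sigma> *\<^sub>R b)) has_derivative
                (\<lambda>\<sigma>. P' (\<Psi> (s, x)) (g x \<bullet> (\<sigma> *\<^sub>R b), \<sigma> *\<^sub>R b) \<bullet> (0, b))) (at 0)"
              by (simp add: G_def)
            have li: "linear (P' (\<Psi> (s, x)))" using lin in_O OC bounded_linear.linear by blast
            have "P' (\<Psi> (s, x)) (g x \<bullet> (\<sigma> *\<^sub>R b), \<sigma> *\<^sub>R b) \<bullet> (0, b) = F b (\<Psi> (s, x)) * \<sigma>" for \<sigma>
            proof -
              have "(g x \<bullet> (\<sigma> *\<^sub>R b), \<sigma> *\<^sub>R b) = \<sigma> *\<^sub>R ((g x \<bullet> b) *\<^sub>R \<tau> + (0, b))"
                by (simp add: \<tau>_def)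
              then show ?thesis using in_O
                by (simp only: linear_scale[OF li] linear_add[OF li])
                   (simp add: F_def \<Psi>_def inner_prod_def algebra_simps)
            qed
            with D show ?case by (simp add: has_field_derivative_def)
          qed
        qed measurable
      qed
    qed
    finally show ?thesis by simp
  qed
  have "integral\<^sup>L lborel W = (\<integral>z. W (\<Psi> z) \<partial>lborel)" by (rule shear(2)[OF W_int])
  also have "\<dots> = (\<integral>x. \<integral>s. W (\<Psi> (s, x)) \<partial>lborel \<partial>lborel)"
    using lborel_pair.integral_snd[of "\<lambda>s x. W (\<Psi> (s, x))"] shear(1)[OF W_int]
    by (simp add: lborel_prod split_beta')
  also have "\<dots> = (\<integral>x. P (h x, x) \<bullet> (- 1, g x) \<partial>lborel)"
  proof (rule Bochner_Integration.integral_cong[OF refl])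
    fix x
    \<comment> \<open>At height \<open>T\<close> and above, the vertical line over \<open>x\<close>
      has left the ball of radius \<open>R\<close>, so \<open>P\<close> vanishes and the upper end
      of the integral contributes nothing.\<close>
    define T where "T = \<bar>R\<bar> + \<bar>h x\<bar> + 1"
    have far: "norm (\<Psi> (s, x)) > R" if "s \<ge> T" for s
    proof -
      have "norm (\<Psi> (s, x)) \<ge> \<bar>s + h x\<bar>" using norm_fst_le[of "s + h x" x] by (simp add: \<Psi>_def)
      then show ?thesis using that unfolding T_def by linarith
    qed
    define w where "w = (1::real, - g x)"
    have seg: "(\<lambda>s. \<Psi> (s, x)) ` {0..T} \<subseteq> C" by (auto simp: \<Psi>C)
    have "(\<integral>s. W (\<Psi> (s, x)) \<partial>lborel) = (\<integral>s. indicator {0..T} s *\<^sub>R (P' (\<Psi> (s, x)) \<tau> \<bullet> w) \<partial>lborel)"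
    proof (rule integral_cong_AE)
      have [measurable]: "(\<lambda>s. (s, x)) \<in> measurable borel (borel :: (real\<times>'b) measure)"
        unfolding borel_prod[symmetric] by measurable
      have [measurable]: "W \<in> borel_measurable borel" using W_int by auto
      show "(\<lambda>s. W (\<Psi> (s, x))) \<in> borel_measurable lborel" by simp
      have "continuous_on {0..T} (\<lambda>s. P' (\<Psi> (s, x)) \<tau> \<bullet> w)"
        by (intro continuous_intros continuous_on_compose2[OF C1_onD(2)[OF P] _ seg])
           (auto simp: \<Psi>_def intro!: continuous_intros)
      then show "(\<lambda>s. indicator {0..T} s *\<^sub>R (P' (\<Psi> (s, x)) \<tau> \<bullet> w)) \<in> borel_measurable lborel"
        using borel_measurable_continuous_on_indicator[of "{0..T}" "\<lambda>s. P' (\<Psi> (s, x)) \<tau> \<bullet> w"] by simp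
      \<comment> \<open>The point s = 0 is excluded because it belongs to the closed interval, while
        \<open>\<Psi> (0, x)\<close> lies on the graph and hence outside the open set
        \<open>\<Omega>\<close>.\<close>
      show "AE s in lborel. W (\<Psi> (s, x)) = indicator {0..T} s *\<^sub>R (P' (\<Psi> (s, x)) \<tau> \<bullet> w)"
        using AE_lborel_singleton[of 0]
      proof eventually_elim
        case (elim s)
        show ?case
        proof (cases "s \<le> T")
          case True then show ?thesis using elim
            by (auto simp: W_def \<Psi>O indicator_def w_def) (auto simp: \<Psi>_def)
        next
          case False
          then have "s > 0" "norm (\<Psi> (s, x)) > R" using far[of s] by (auto simp: T_def)
          then show ?thesis using False supp(2)[of "\<Psi> (s, x)" \<tau>] by (auto simp: W_def \<Psi>C)
        qed
      qed
    qed
    also have "\<dots> = P (\<Psi> (T, x)) \<bullet> w - P (\<Psi> (0, x)) \<bullet> w"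
    proof (rule integral_FTC_Icc)
      show "0 \<le> T" by (simp add: T_def)
      show "continuous_on {0..T} (\<lambda>s. P' (\<Psi> (s, x)) \<tau> \<bullet> w)"
        by (intro continuous_intros continuous_on_compose2[OF C1_onD(2)[OF P] _ seg])
           (auto simp: \<Psi>_def intro!: continuous_intros)
      fix s :: real assume s: "0 \<le> s" "s \<le> T"
      have "((\<lambda>s. \<Psi> (s, x)) has_derivative (\<lambda>\<sigma>. \<sigma> *\<^sub>R \<tau>)) (at s within {0..T})"
        unfolding \<Psi>_def \<tau>_def by (auto intro!: derivative_eq_intros)
      moreover have "(P has_derivative P' (\<Psi> (s, x))) (at (\<Psi> (s, x)) within (\<lambda>s. \<Psi> (s, x)) ` {0..T})"
        using C1_onD(1)[OF P, of "\<Psi> (s, x)"] s seg by (auto simp: \<Psi>C intro: has_derivative_subset)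
      ultimately have "((\<lambda>s. P (\<Psi> (s, x))) has_derivative (\<lambda>\<sigma>. P' (\<Psi> (s, x)) (\<sigma> *\<^sub>R \<tau>))) (at s within {0..T})"
        by (rule has_derivative_in_compose)
      from has_derivative_inner_left[OF this, of w]
      show "((\<lambda>s. P (\<Psi> (s, x)) \<bullet> w) has_vector_derivative P' (\<Psi> (s, x)) \<tau> \<bullet> w) (at s within {0..T})"
        using lin[of "\<Psi> (s, x)"] s
        by (simp add: has_vector_derivative_def \<Psi>C linear_scale[OF bounded_linear.linear])
    qed
    also have "P (\<Psi> (T, x)) = 0"
      using far[of T] by (intro supp) (auto simp: \<Psi>C T_def)
    also have "0 \<bullet> w - P (\<Psi> (0, x)) \<bullet> w = P (h x, x) \<bullet> (- 1, g x)"
      by (simp add: \<Psi>_def w_def inner_prod_def)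
    finally show "(\<integral>s. W (\<Psi> (s, x)) \<partial>lborel) = P (h x, x) \<bullet> (- 1, g x)" .
  qed
  finally show "(\<integral>z. indicator \<Omega> z *\<^sub>R lin_trace (P' z) \<partial>lborel) = (\<integral>x. P (h x, x) \<bullet> (- 1, g x) \<partial>lborel)"
    unfolding split using F_int W_int F0 by simp
qed

section \<open>Symmetry of second derivatives\<close>

text \<open>The mean value theorem is applied first along \<open>d\<close> to the difference in
  direction \<open>e\<close>, then along \<open>e\<close> to the component of \<open>D\<close> along
  \<open>d\<close>. The second difference is symmetric in \<open>d\<close> and \<open>e\<close>,
  which is the source of the symmetry of the second derivative.\<close>

lemma second_difference_mvt:
  fixes \<phi> :: "'a::euclidean_space \<Rightarrow> real"
  assumes U: "ball x r \<subseteq> U" and h: "0 < h" "h * (norm d + norm e) < r"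
    and \<phi>: "\<And>z. z \<in> U \<Longrightarrow> (\<phi> has_derivative (\<lambda>h. D z \<bullet> h)) (at z)"
    and D: "\<And>z. z \<in> U \<Longrightarrow> (D has_derivative H z) (at z)"
  shows "\<exists>y. norm (y - x) \<le> h * (norm d + norm e) \<and>
    \<phi> (x + h *\<^sub>R d + h *\<^sub>R e) - \<phi> (x + h *\<^sub>R d) - \<phi> (x + h *\<^sub>R e) + \<phi> x = h\<^sup>2 * (H y e \<bullet> d)"
proof -
  have close: "norm (s *\<^sub>R d + t *\<^sub>R e) \<le> h * (norm d + norm e)" if "0 \<le> s" "s \<le> h" "0 \<le> t" "t \<le> h" for s t
    using that by (intro order_trans[OF norm_triangle_ineq]) (auto simp: distrib_left intro!: add_mono mult_right_mono)
  have inU: "x + s *\<^sub>R d + t *\<^sub>R e \<in> U" if "0 \<le> s" "s \<le> h" "0 \<le> t" "t \<le> h" for s t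
  proof -
    have "dist (x + s *\<^sub>R d + t *\<^sub>R e) x < r"
      using close[OF that] h(2) by (simp add: dist_norm add.assoc)
    then have "x + s *\<^sub>R d + t *\<^sub>R e \<in> ball x r" by (simp add: dist_commute)
    then show ?thesis using U by auto
  qed
  define g where "g s = \<phi> (x + s *\<^sub>R d + h *\<^sub>R e) - \<phi> (x + s *\<^sub>R d)" for s
  have "\<exists>s>0. s < h \<and> g h - g 0 = (h - 0) * (D (x + s *\<^sub>R d + h *\<^sub>R e) \<bullet> d - D (x + s *\<^sub>R d) \<bullet> d)"
  proof (rule MVT2[OF h(1)])
    fix s assume s: "0 \<le> s" "s \<le> h"
    have l: "((\<lambda>s. x + s *\<^sub>R d + t *\<^sub>R e) has_derivative (\<lambda>\<sigma>. \<sigma> *\<^sub>R d)) (at s)" for t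
      by (auto intro!: derivative_eq_intros)
    have l': "((\<lambda>s. x + s *\<^sub>R d) has_derivative (\<lambda>\<sigma>. \<sigma> *\<^sub>R d)) (at s)"
      by (auto intro!: derivative_eq_intros)
    have "((\<lambda>s. \<phi> (x + s *\<^sub>R d + h *\<^sub>R e) - \<phi> (x + s *\<^sub>R d)) has_derivative
        (\<lambda>\<sigma>. D (x + s *\<^sub>R d + h *\<^sub>R e) \<bullet> (\<sigma> *\<^sub>R d) - D (x + s *\<^sub>R d) \<bullet> (\<sigma> *\<^sub>R d))) (at s)"
      using s h(1) inU[of s h] inU[of s 0]
      by (intro has_derivative_diff has_derivative_compose[OF l \<phi>] has_derivative_compose[OF l' \<phi>]) auto
    moreover have "D (x + s *\<^sub>R d + h *\<^sub>R e) \<bullet> (\<sigma> *\<^sub>R d) - D (x + s *\<^sub>R d) \<bullet> (\<sigma> *\<^sub>R d)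
        = (D (x + s *\<^sub>R d + h *\<^sub>R e) \<bullet> d - D (x + s *\<^sub>R d) \<bullet> d) * \<sigma>" for \<sigma>
      by (simp only: inner_scaleR_right) (simp add: right_diff_distrib mult.commute)
    ultimately show "DERIV g s :> D (x + s *\<^sub>R d + h *\<^sub>R e) \<bullet> d - D (x + s *\<^sub>R d) \<bullet> d"
      unfolding has_field_derivative_def g_def by (simp only:)
  qed
  then obtain s where s: "0 < s" "s < h"
    "g h - g 0 = h * (D (x + s *\<^sub>R d + h *\<^sub>R e) \<bullet> d - D (x + s *\<^sub>R d) \<bullet> d)"
    unfolding diff_0_right by blast
  have "\<exists>t>0. t < h \<and> D (x + s *\<^sub>R d + h *\<^sub>R e) \<bullet> d - D (x + s *\<^sub>R d + 0 *\<^sub>R e) \<bullet> d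
      = (h - 0) * (H (x + s *\<^sub>R d + t *\<^sub>R e) e \<bullet> d)"
  proof (rule MVT2[OF h(1)])
    fix t assume t: "0 \<le> t" "t \<le> h"
    have l: "((\<lambda>t. x + s *\<^sub>R d + t *\<^sub>R e) has_derivative (\<lambda>\<sigma>. \<sigma> *\<^sub>R e)) (at t)"
      by (auto intro!: derivative_eq_intros)
    have HU: "(D has_derivative H (x + s *\<^sub>R d + t *\<^sub>R e)) (at (x + s *\<^sub>R d + t *\<^sub>R e))"
      using s t inU by (intro D) auto
    have "((\<lambda>t. D (x + s *\<^sub>R d + t *\<^sub>R e) \<bullet> d) has_derivative
        (\<lambda>\<sigma>. H (x + s *\<^sub>R d + t *\<^sub>R e) (\<sigma> *\<^sub>R e) \<bullet> d)) (at t)"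
      by (rule has_derivative_inner_left[OF has_derivative_compose[OF l HU]])
    moreover have "H (x + s *\<^sub>R d + t *\<^sub>R e) (\<sigma> *\<^sub>R e) \<bullet> d
        = (H (x + s *\<^sub>R d + t *\<^sub>R e) e \<bullet> d) * \<sigma>" for \<sigma>
      by (simp add: linear_scale[OF has_derivative_linear[OF HU]])
    ultimately show "DERIV (\<lambda>t. D (x + s *\<^sub>R d + t *\<^sub>R e) \<bullet> d) t :> H (x + s *\<^sub>R d + t *\<^sub>R e) e \<bullet> d"
      unfolding has_field_derivative_def by (simp only:)
  qed
  then obtain t where t: "0 < t" "t < h" "D (x + s *\<^sub>R d + h *\<^sub>R e) \<bullet> d - D (x + s *\<^sub>R d) \<bullet> d
      = h * (H (x + s *\<^sub>R d + t *\<^sub>R e) e \<bullet> d)"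
    unfolding scaleR_zero_left add_0_right diff_0_right by blast
  show ?thesis
  proof (intro exI conjI)
    show "norm (x + s *\<^sub>R d + t *\<^sub>R e - x) \<le> h * (norm d + norm e)"
      using s t close[of s t] by (simp add: add.assoc)
    show "\<phi> (x + h *\<^sub>R d + h *\<^sub>R e) - \<phi> (x + h *\<^sub>R d) - \<phi> (x + h *\<^sub>R e) + \<phi> x
        = h\<^sup>2 * (H (x + s *\<^sub>R d + t *\<^sub>R e) e \<bullet> d)"
      using s(3)[unfolded t(3)] unfolding g_def power2_eq_square mult.assoc by simp
  qed
qed

text \<open>Both orders of \<open>d\<close> and \<open>e\<close> give the same second difference,
  hence equal values of the Hessian form at two intermediate points. These points tend to
  \<open>x\<close> as the step shrinks, and \<open>H\<close> is continuous.\<close>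

lemma symmetric_second_derivative_open:
  fixes \<phi> :: "'a::euclidean_space \<Rightarrow> real"
  assumes U: "open U" "x \<in> U"
    and \<phi>: "\<And>z. z \<in> U \<Longrightarrow> (\<phi> has_derivative (\<lambda>h. D z \<bullet> h)) (at z)"
    and D: "\<And>z. z \<in> U \<Longrightarrow> (D has_derivative H z) (at z)"
    and cont: "\<And>e. continuous_on U (\<lambda>z. H z e)"
  shows "H x d \<bullet> e = H x e \<bullet> d"
proof -
  obtain r where r: "r > 0" "ball x r \<subseteq> U" using U openE by blast
  \<comment> \<open>The \<open>+ 1\<close> keeps the denominator positive when \<open>d\<close> and
    \<open>e\<close> vanish and makes the bound by \<open>r\<close> strict.\<close>
  define \<delta> where "\<delta> = r / (norm d + norm e + 1)"
  define h where "h k = \<delta> * inverse (real (Suc k))" for k :: nat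
  have den: "norm d + norm e + 1 > 0" by (simp add: add_nonneg_pos)
  have \<delta>: "\<delta> > 0" "\<delta> * (norm d + norm e) < r"
    using r(1) den by (simp_all add: \<delta>_def divide_less_eq)
  have h0: "h k > 0" for k using \<delta> by (simp add: h_def)
  have h1: "h k * (norm d + norm e) < r" for k
  proof -
    have "h k \<le> \<delta>" using \<delta>(1) by (simp add: h_def divide_simps)
    then have "h k * (norm d + norm e) \<le> \<delta> * (norm d + norm e)" by (intro mult_right_mono) auto
    then show ?thesis using \<delta>(2) by linarith
  qed
  have "h \<longlonglongrightarrow> 0" unfolding h_def
    by (rule tendsto_mult_right_zero[OF LIMSEQ_inverse_real_of_nat])
  then have hl: "(\<lambda>k. h k * (norm d + norm e)) \<longlonglongrightarrow> 0"
    by (rule tendsto_mult_left_zero)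
  let ?\<Delta> = "\<lambda>k. \<phi> (x + h k *\<^sub>R d + h k *\<^sub>R e) - \<phi> (x + h k *\<^sub>R d) - \<phi> (x + h k *\<^sub>R e) + \<phi> x"
  have "\<exists>y. norm (y - x) \<le> h k * (norm d + norm e) \<and> ?\<Delta> k = (h k)\<^sup>2 * (H y e \<bullet> d)" for k
    by (rule second_difference_mvt[OF r(2) h0 h1 \<phi> D])
  then obtain y where y: "\<And>k. norm (y k - x) \<le> h k * (norm d + norm e)"
    "\<And>k. ?\<Delta> k = (h k)\<^sup>2 * (H (y k) e \<bullet> d)" by metis
  let ?\<Delta>' = "\<lambda>k. \<phi> (x + h k *\<^sub>R e + h k *\<^sub>R d) - \<phi> (x + h k *\<^sub>R e) - \<phi> (x + h k *\<^sub>R d) + \<phi> x"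
  have h1': "h k * (norm e + norm d) < r" for k using h1[of k] by (simp only: add.commute)
  have "\<exists>y. norm (y - x) \<le> h k * (norm e + norm d) \<and> ?\<Delta>' k = (h k)\<^sup>2 * (H y d \<bullet> e)" for k
    by (rule second_difference_mvt[OF r(2) h0 h1' \<phi> D])
  then obtain w where w: "\<And>k. norm (w k - x) \<le> h k * (norm e + norm d)"
    "\<And>k. ?\<Delta>' k = (h k)\<^sup>2 * (H (w k) d \<bullet> e)" by metis
  have eq: "H (y k) e \<bullet> d = H (w k) d \<bullet> e" for k
  proof -
    have "x + h k *\<^sub>R e + h k *\<^sub>R d = x + h k *\<^sub>R d + h k *\<^sub>R e" by simp
    then have "?\<Delta> k = ?\<Delta>' k" by (simp only:)
    then have "(h k)\<^sup>2 * (H (y k) e \<bullet> d) = (h k)\<^sup>2 * (H (w k) d \<bullet> e)"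
      unfolding y(2) w(2) .
    then show ?thesis using h0[of k] by simp
  qed
  have lim: "(\<lambda>k. H (u k) a \<bullet> b) \<longlonglongrightarrow> H x a \<bullet> b"
    if u: "\<And>k. norm (u k - x) \<le> h k * (norm d + norm e)" for u a b
  proof -
    have "u \<longlonglongrightarrow> x"
      by (rule Lim_null[THEN iffD2], rule Lim_null_comparison[OF _ hl]) (use u in auto)
    moreover have "isCont (\<lambda>z. H z a) x" using cont U by (simp add: continuous_on_eq_continuous_at)
    ultimately show ?thesis by (intro tendsto_inner tendsto_const) (rule isCont_tendsto_compose)
  qed
  have "(\<lambda>k. H (y k) e \<bullet> d) \<longlonglongrightarrow> H x d \<bullet> e"
    unfolding eq using lim[of w d e] w(1) by (simp add: add.commute)
  from LIMSEQ_unique[OF this lim[of y e d, OF y(1)]] show ?thesis .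
qed

text \<open>Boundary points are reached by continuity: the antisymmetric part of \<open>H\<close> is
  continuous on \<open>K\<close> and vanishes on the interior, which is dense in
  \<open>K\<close>.\<close>

lemma symmetric_second_derivative:
  fixes \<phi> :: "'a::euclidean_space \<Rightarrow> real"
  assumes \<phi>: "C1_on K \<phi> (\<lambda>z h. D z \<bullet> h)" and D: "C1_on K D H"
    and K: "K \<subseteq> closure (interior K)" "x \<in> K"
  shows "H x d \<bullet> e = H x e \<bullet> d"
proof -
  let ?f = "\<lambda>z. H z d \<bullet> e - H z e \<bullet> d"
  have int: "?f z = 0" if "z \<in> interior K" for z
  proof -
    have "H z d \<bullet> e = H z e \<bullet> d"
    proof (rule symmetric_second_derivative_open[of "interior K" z \<phi> D])
      fix w assume w: "w \<in> interior K"
      then have "at w within K = at w" "w \<in> K" using interior_subset by (auto intro: at_within_interior)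
      then show "(\<phi> has_derivative (\<lambda>h. D w \<bullet> h)) (at w)" "(D has_derivative H w) (at w)"
        using C1_onD(1)[OF \<phi>, of w] C1_onD(1)[OF D, of w] by auto
    qed (use that in \<open>auto intro!: continuous_on_subset[OF C1_onD(2)[OF D]] interior_subset\<close>)
    then show ?thesis by simp
  qed
  have "x \<in> closure (interior K)" using K by auto
  then obtain s where s: "\<And>k. s k \<in> interior K" "s \<longlonglongrightarrow> x"
    unfolding closure_sequential by auto
  have "continuous_on K ?f" by (intro continuous_intros C1_onD(2)[OF D])
  then have "(\<lambda>k. ?f (s k)) \<longlonglongrightarrow> ?f x"
    using s(1) interior_subset[of K]
    by (intro continuous_on_tendsto_compose[OF _ s(2) K(2)]) (auto simp: subset_iff)
  then show ?thesis using int[OF s(1)] by (simp add: LIMSEQ_const_iff)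
qed

section \<open>The multiplier identity\<close>

lemma C1_on_cong: "C1_on S f f' \<Longrightarrow> (\<And>z h. z \<in> S \<Longrightarrow> f' z h = g' z h) \<Longrightarrow> C1_on S f g'"
  unfolding C1_on_def
  by (metis (no_types, lifting) continuous_on_cong ext)

text \<open>Derivatives of scalar fields are kept in the form \<open>w z \<bullet> h\<close>.
  Multiplying a vector field by such a scalar then adds a rank-one map to the derivative, whose
  trace is given by \<open>trace_rank_one\<close>.\<close>

lemma C1_on_scaleR_grad:
  fixes f :: "'a::euclidean_space \<Rightarrow> real" and Y :: "'a \<Rightarrow> 'b::euclidean_space"
  assumes "C1_on S f (\<lambda>z h. w z \<bullet> h)" "C1_on S Y Y'"
  shows "C1_on S (\<lambda>z. f z *\<^sub>R Y z) (\<lambda>z h. f z *\<^sub>R Y' z h + (w z \<bullet> h) *\<^sub>R Y z)"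
  using C1_on_scaleR[OF assms] .

lemma C1_on_mult_grad:
  fixes f g :: "'a::euclidean_space \<Rightarrow> real"
  assumes "C1_on S f (\<lambda>z h. w z \<bullet> h)" "C1_on S g (\<lambda>z h. u z \<bullet> h)"
  shows "C1_on S (\<lambda>z. f z * g z) (\<lambda>z h. (f z *\<^sub>R u z + g z *\<^sub>R w z) \<bullet> h)"
  by (rule C1_on_cong[OF C1_on_mult[OF assms]]) (simp add: inner_add_left)

lemma C1_on_compose_grad:
  fixes f :: "'a::euclidean_space \<Rightarrow> real"
  assumes "\<And>y. (g has_real_derivative g' y) (at y)" "continuous_on UNIV g'" "C1_on S f (\<lambda>z h. w z \<bullet> h)"
  shows "C1_on S (\<lambda>z. g (f z)) (\<lambda>z h. (g' (f z) *\<^sub>R w z) \<bullet> h)"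
  by (rule C1_on_cong[OF C1_on_compose_real[OF assms]]) simp

lemma trace_add: "lin_trace (\<lambda>h. A h + B h) = lin_trace A + lin_trace B"
  and trace_diff: "lin_trace (\<lambda>h. A h - B h) = lin_trace A - lin_trace B"
  and trace_scale: "lin_trace (\<lambda>h. r *\<^sub>R A h) = r * lin_trace A"
  by (simp_all add: lin_trace_def inner_add_left inner_diff_left sum.distrib sum_subtractf sum_distrib_left)

lemma trace_id: "lin_trace (\<lambda>h::'a::euclidean_space. h) = DIM('a)"
  by (simp add: lin_trace_def)

lemma trace_rank_one: "lin_trace (\<lambda>h. (w \<bullet> h) *\<^sub>R Y) = w \<bullet> Y"
  using euclidean_inner[of w Y] by (simp add: lin_trace_def)

text \<open>The matrix of the Minkowski metric: \<open>x \<bullet> reflect y\<close> is the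
  Minkowski product, and \<open>reflect\<close> turns the Euclidean gradient into the Minkowski
  gradient.\<close>

definition reflect :: "real \<times> 'b::euclidean_space \<Rightarrow> real \<times> 'b" where
  "reflect z = (- fst z, snd z)"

lemma bounded_linear_reflect: "bounded_linear reflect"
  unfolding reflect_def
  by (intro bounded_linear_Pair bounded_linear_minus bounded_linear_fst bounded_linear_snd)

lemma reflect_simps:
  "reflect (x + y) = reflect x + reflect y" "reflect (x - y) = reflect x - reflect y"
  "reflect (r *\<^sub>R x) = r *\<^sub>R reflect x" "reflect (reflect x) = x"
  by (simp_all add: reflect_def)

lemma reflect_inner: "reflect x \<bullet> y = x \<bullet> reflect y"
  by (simp add: reflect_def inner_prod_def)

lemma norm_reflect: "norm (reflect x) = norm x"
  by (simp add: reflect_def norm_prod_def)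

text \<open>The multiplier is \<open>\<alpha>(v) (S \<phi> + c \<phi>)\<close> with \<open>S\<close> the scaling field about \<open>q\<close>, \<open>v\<close> the Minkowski square
  of \<open>S\<close> and \<open>\<alpha>(v) = v \<beta>(v)\<close>.  For \<open>\<beta>(v) = v\<^bsup>a - 1\<^esup>\<close> the defect \<open>v \<beta>'(v) - (a - 1) \<beta>(v)\<close> vanishes; the
  \<open>\<phi>\<^sup>2 S\<close> term of the current completes the square.\<close>

lemma current_divergence:
  fixes K :: "(real \<times> 'b::euclidean_space) set" and \<phi> V :: "real \<times> 'b \<Rightarrow> real"
    and \<beta> \<beta>' N N' :: "real \<Rightarrow> real"
    and D DV :: "real \<times> 'b \<Rightarrow> real \<times> 'b" and q :: "real \<times> 'b" and a c p :: real
  defines "S \<equiv> \<lambda>z. z - q" and "v \<equiv> \<lambda>z. (z - q) \<bullet> reflect (z - q)"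
  defines "P \<equiv> \<lambda>z. (v z * \<beta> (v z)) *\<^sub>R ((D z \<bullet> S z) *\<^sub>R reflect (D z)
      + (V z * N (\<phi> z) - (D z \<bullet> reflect (D z)) / 2) *\<^sub>R S z + (c * \<phi> z) *\<^sub>R reflect (D z))
      + (a * c * \<beta> (v z) * (\<phi> z)\<^sup>2) *\<^sub>R S z"
  assumes \<phi>: "C1_on K \<phi> (\<lambda>z h. D z \<bullet> h)" and D: "C1_on K D H" and V: "C1_on K V (\<lambda>z h. DV z \<bullet> h)"
    and sym: "\<And>z d e. z \<in> K \<Longrightarrow> H z d \<bullet> e = H z e \<bullet> d"
    and \<beta>: "\<And>y. (\<beta> has_real_derivative \<beta>' y) (at y)" "continuous_on UNIV \<beta>'"
    and N: "\<And>u. (N has_real_derivative N' u) (at u)" "continuous_on UNIV N'" "\<And>u. N' u * u = (p + 1) * N u"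
    and wave: "\<And>z. z \<in> K \<Longrightarrow> lin_trace (\<lambda>h. reflect (H z h)) + V z * N' (\<phi> z) = 0"
    and c: "c = (real DIM('b) - 1) / 2 + a"
  obtains P' where "C1_on K P P'"
    and "\<And>z e. z \<in> K \<Longrightarrow> \<beta> (v z) = 0 \<Longrightarrow> \<beta>' (v z) = 0 \<Longrightarrow> P' z e = 0"
    and "\<And>z. z \<in> K \<Longrightarrow> lin_trace (P' z) =
      2 * a * \<beta> (v z) * (D z \<bullet> S z + c * \<phi> z)\<^sup>2
      + v z * \<beta> (v z) * (real DIM('b) + 1 + 2 * a - c * (p + 1)) * (V z * N (\<phi> z))
      + v z * \<beta> (v z) * (DV z \<bullet> S z) * N (\<phi> z)
      + 2 * (v z * \<beta>' (v z) - (a - 1) * \<beta> (v z)) * ((D z \<bullet> S z)\<^sup>2 - v z * (D z \<bullet> reflect (D z)) / 2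
          + v z * V z * N (\<phi> z) + c * \<phi> z * (D z \<bullet> S z) + a * c * (\<phi> z)\<^sup>2)"
proof -
  have cS': "C1_on K (\<lambda>z. z - q) (\<lambda>_ h. h)"
    using C1_on_affine[OF bounded_linear_ident, of K "- q"] by simp
  then have cS: "C1_on K S (\<lambda>_ h. h)" unfolding S_def .
  have cJD: "C1_on K (\<lambda>z. reflect (D z)) (\<lambda>z h. reflect (H z h))"
    by (rule C1_on_linear[OF bounded_linear_reflect D])
  have cv: "C1_on K v (\<lambda>z h. (2 *\<^sub>R reflect (S z)) \<bullet> h)"
    unfolding v_def S_def
    by (rule C1_on_cong[OF C1_on_inner[OF cS' C1_on_linear[OF bounded_linear_reflect cS']]])
       (simp add: reflect_inner inner_commute)
  have c\<beta>: "C1_on K (\<lambda>z. \<beta> (v z)) (\<lambda>z h. (\<beta>' (v z) *\<^sub>R 2 *\<^sub>R reflect (S z)) \<bullet> h)"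
    by (rule C1_on_compose_grad[OF \<beta> cv])
  have cN: "C1_on K (\<lambda>z. N (\<phi> z)) (\<lambda>z h. (N' (\<phi> z) *\<^sub>R D z) \<bullet> h)"
    by (rule C1_on_compose_grad[OF N(1,2) \<phi>])
  have cDS: "C1_on K (\<lambda>z. D z \<bullet> S z) (\<lambda>z h. (H z (S z) + D z) \<bullet> h)"
    by (rule C1_on_cong[OF C1_on_inner[OF D cS]]) (simp add: inner_add_left sym[of _ _ "S _"])
  have cDD: "C1_on K (\<lambda>z. (D z \<bullet> reflect (D z)) / 2) (\<lambda>z h. H z (reflect (D z)) \<bullet> h)"
  proof (rule C1_on_cong[OF C1_on_linear[OF bounded_linear_divide[of 2] C1_on_inner[OF D cJD]]])
    fix z h assume "z \<in> K"
    then have "H z h \<bullet> reflect (D z) = H z (reflect (D z)) \<bullet> h" by (rule sym)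
    moreover have "D z \<bullet> reflect (H z h) = H z h \<bullet> reflect (D z)"
      by (metis reflect_inner inner_commute)
    ultimately show "(D z \<bullet> reflect (H z h) + H z h \<bullet> reflect (D z)) / 2 = H z (reflect (D z)) \<bullet> h"
      by simp
  qed
  have c\<phi>2: "C1_on K (\<lambda>z. (\<phi> z)\<^sup>2) (\<lambda>z h. ((2 * \<phi> z) *\<^sub>R D z) \<bullet> h)"
    by (rule C1_on_cong[OF C1_on_mult_grad[OF \<phi> \<phi>], folded power2_eq_square]) (simp add: inner_add_left)
  have cc: "C1_on K (\<lambda>z. c * \<phi> z) (\<lambda>z h. (c *\<^sub>R D z) \<bullet> h)"
    by (rule C1_on_cong[OF C1_on_linear[OF bounded_linear_mult_right \<phi>]]) simp
  have cac: "C1_on K (\<lambda>z. a * c * \<beta> (v z)) (\<lambda>z h. ((a * c) *\<^sub>R \<beta>' (v z) *\<^sub>R 2 *\<^sub>R reflect (S z)) \<bullet> h)"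
    by (rule C1_on_cong[OF C1_on_linear[OF bounded_linear_mult_right c\<beta>]]) simp
  have cVN: "C1_on K (\<lambda>z. V z * N (\<phi> z) - (D z \<bullet> reflect (D z)) / 2)
      (\<lambda>z h. (V z *\<^sub>R N' (\<phi> z) *\<^sub>R D z + N (\<phi> z) *\<^sub>R DV z - H z (reflect (D z))) \<bullet> h)"
    by (rule C1_on_cong[OF C1_on_diff[OF C1_on_mult_grad[OF V cN] cDD]]) (simp only: inner_diff_left)
  \<comment> \<open>The derivative of \<open>P\<close> is not written down by hand; combining the
    rules in the shape of \<open>P\<close> produces it.\<close>
  note cP = C1_on_add[OF C1_on_scaleR_grad[OF C1_on_mult_grad[OF cv c\<beta>]
      C1_on_add[OF C1_on_add[OF C1_on_scaleR_grad[OF cDS cJD] C1_on_scaleR_grad[OF cVN cS]]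
        C1_on_scaleR_grad[OF cc cJD]]]
      C1_on_scaleR_grad[OF C1_on_mult_grad[OF cac c\<phi>2] cS]]
  show ?thesis
  proof (rule that[OF cP[folded P_def]], goal_cases)
    case (1 z e)
    then show ?case by simp
  next
    case (2 z)
    note z = 2
    define B where "B = lin_trace (\<lambda>h. reflect (H z h))"
    have B: "B = - V z * N' (\<phi> z)" using wave[OF z] by (simp add: B_def)
    have vS: "reflect (S z) \<bullet> S z = v z" by (simp add: v_def S_def inner_commute)
    have SD: "reflect (S z) \<bullet> reflect (D z) = D z \<bullet> S z" by (simp add: reflect_inner reflect_simps inner_commute)
    have HSD: "H z (S z) \<bullet> reflect (D z) = H z (reflect (D z)) \<bullet> S z" by (rule sym[OF z])
    have N3: "N' (\<phi> z) * \<phi> z = (p + 1) * N (\<phi> z)" by (rule N(3))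
    \<comment> \<open>This is the divergence with all scalars at \<open>z\<close> abstracted.
      \<open>HS\<close> enters with both signs, once from differentiating
      \<open>D z \<bullet> S z\<close> along \<open>reflect (D z)\<close> and once from half of
      \<open>D z \<bullet> reflect (D z)\<close> along \<open>S z\<close>. The symmetry of the
      Hessian identifies the two, so they cancel.\<close>
    have alg: "(vz * b) * (DS * - (Vz * n') + (HS + DD) + ((Vz * n - DD / 2) * (m + 1) + (Vz * (n' * DS) + n * DVS - HS)) + ((c * f) * - (Vz * n') + c * DD))
       + (vz * (b' * (2 * (DS * DS + (Vz * n - DD / 2) * vz + (c * f) * DS))) + b * (2 * (DS * DS + (Vz * n - DD / 2) * vz + (c * f) * DS)))
       + ((a * c * b * f\<^sup>2) * (m + 1) + ((a * c * b) * (2 * f * DS) + f\<^sup>2 * ((a * c) * (b' * (2 * vz)))))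
      = 2 * a * b * (DS + c * f)\<^sup>2
      + vz * b * (m + 1 + 2 * a - c * (p + 1)) * (Vz * n)
      + vz * b * DVS * n
      + 2 * (vz * b' - (a - 1) * b) * (DS\<^sup>2 - vz * DD / 2 + vz * Vz * n + c * f * DS + a * c * f\<^sup>2)"
      if "n' * f = (p + 1) * n" "m = 2 * (c - a) + 1" for vz b b' DS Vz n n' HS DD m DVS f :: real
    proof -
      have "(vz * b * c * Vz) * (n' * f) = (vz * b * c * Vz) * ((p + 1) * n)" by (simp only: that(1))
      then show ?thesis unfolding that(2) by (simp add: algebra_simps power2_eq_square)
    qed
    \<comment> \<open>With this \<open>c\<close> the coefficient of
      \<open>D z \<bullet> reflect (D z)\<close> vanishes, up to the defect of the weight.\<close>
    have m: "real DIM('b) = 2 * (c - a) + 1" unfolding c by (simp add: field_simps)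
    show ?case
      apply (subst alg[OF N3 m, symmetric, where HS = "H z (reflect (D z)) \<bullet> S z"])
      apply (simp only: trace_add trace_scale trace_rank_one trace_id)
      apply (simp only: inner_add_left inner_diff_left
          inner_scaleR_left inner_add_right inner_scaleR_right SD vS HSD B_def[symmetric] B DIM_prod)
      apply (simp add: algebra_simps)
      done
  qed
qed

section \<open>Weights and the geometry of the cone\<close>

text \<open>The extension by zero makes the weights vanish inside the null cone of the vertex
  without case distinctions. Since \<open>0 powr b = 0\<close>, the value at 0 is 0 for negative
  exponents as well.\<close>

definition pos_powr :: "real \<Rightarrow> real \<Rightarrow> real" where
  "pos_powr b y = max 0 y powr b"

lemma pos_powr_nonneg [simp]: "pos_powr b y \<ge> 0"
  and pos_powr_nonpos [simp]: "y \<le> 0 \<Longrightarrow> pos_powr b y = 0"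
  and pos_powr_pos: "y > 0 \<Longrightarrow> pos_powr b y = y powr b"
  by (auto simp: pos_powr_def max_def)

lemma borel_measurable_pos_powr [measurable]: "pos_powr b \<in> borel_measurable borel"
  unfolding pos_powr_def[abs_def] by measurable

lemma continuous_pos_powr: "b > 0 \<Longrightarrow> continuous_on UNIV (pos_powr b)"
  unfolding pos_powr_def[abs_def] by (intro continuous_on_powr' continuous_intros) auto

text \<open>Only y = 0 needs an argument: there the difference quotient is bounded by
  \<open>pos_powr (b - 1)\<close>, which tends to 0 because b > 1.\<close>

lemma pos_powr_has_derivative:
  assumes b: "b > 1"
  shows "(pos_powr b has_real_derivative b * pos_powr (b - 1) y) (at y)"
proof (cases y "0::real" rule: linorder_cases)
  case less
  have "((\<lambda>_. 0) has_real_derivative b * pos_powr (b - 1) y) (at y)" using less by simp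
  then show ?thesis
    by (rule has_field_derivative_transform_within_open[of _ _ _ "{..<0}"]) (use less in auto)
next
  case greater
  have "((\<lambda>y. y powr b) has_real_derivative b * y powr (b - 1)) (at y)"
    using greater by (auto intro!: derivative_eq_intros)
  then have "((\<lambda>y. y powr b) has_real_derivative b * pos_powr (b - 1) y) (at y)"
    using greater by (simp add: pos_powr_pos)
  then show ?thesis
    by (rule has_field_derivative_transform_within_open[of _ _ _ "{0<..}"]) (use greater in \<open>auto simp: pos_powr_pos\<close>)
next
  case equal
  have "((\<lambda>h. pos_powr b h / h) \<longlongrightarrow> 0) (at 0)"
  proof (rule Lim_null_comparison)
    have "isCont (pos_powr (b - 1)) 0"
      using continuous_pos_powr[of "b - 1"] b by (simp add: continuous_on_eq_continuous_at)
    then show "(pos_powr (b - 1) \<longlongrightarrow> 0) (at 0)" by (simp add: isCont_def)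
    show "\<forall>\<^sub>F h in at 0. norm (pos_powr b h / h) \<le> pos_powr (b - 1) h"
    proof (intro always_eventually allI)
      fix h :: real show "norm (pos_powr b h / h) \<le> pos_powr (b - 1) h"
        by (cases "h > 0") (auto simp: pos_powr_pos powr_diff)
    qed
  qed
  then show ?thesis using equal by (simp add: has_field_derivative_iff)
qed

text \<open>A \<open>C\<^sup>1\<close> approximation of \<open>y\<^bsup>a - 1\<^esup>\<close> on \<open>y > 0\<close>, from below as \<open>\<epsilon> \<rightarrow> 0\<close>.\<close>

definition reg_weight :: "real \<Rightarrow> real \<Rightarrow> real \<Rightarrow> real" where
  "reg_weight a \<epsilon> y = pos_powr (a + 1) y / (y\<^sup>2 + \<epsilon>)"

definition reg_weight' :: "real \<Rightarrow> real \<Rightarrow> real \<Rightarrow> real" where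
  "reg_weight' a \<epsilon> y = (a + 1) * pos_powr a y / (y\<^sup>2 + \<epsilon>) - 2 * y * pos_powr (a + 1) y / (y\<^sup>2 + \<epsilon>)\<^sup>2"

context
  fixes a \<epsilon> :: real assumes a: "0 < a" and \<epsilon>: "0 < \<epsilon>"
begin

lemma reg_den: "y\<^sup>2 + \<epsilon> > 0"
  using \<epsilon> by (simp add: add_nonneg_pos)

text \<open>The exponent \<open>a + 1 > 1\<close> of the numerator makes the weight C^1 across y =
  0; the denominator stays positive and restores the exponent \<open>a - 1\<close> as \<epsilon>
  tends to 0.\<close>

lemma reg_weight_has_derivative: "(reg_weight a \<epsilon> has_real_derivative reg_weight' a \<epsilon> y) (at y)"
proof -
  have "((\<lambda>y. pos_powr (a + 1) y / (y\<^sup>2 + \<epsilon>)) has_real_derivative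
    (((a + 1) * pos_powr (a + 1 - 1) y) * (y\<^sup>2 + \<epsilon>) - pos_powr (a + 1) y * (2 * y)) / ((y\<^sup>2 + \<epsilon>) * (y\<^sup>2 + \<epsilon>))) (at y)"
    using a reg_den[of y] by (intro DERIV_divide pos_powr_has_derivative) (auto intro!: derivative_eq_intros)
  also have "(((a + 1) * pos_powr (a + 1 - 1) y) * (y\<^sup>2 + \<epsilon>) - pos_powr (a + 1) y * (2 * y)) / ((y\<^sup>2 + \<epsilon>) * (y\<^sup>2 + \<epsilon>))
     = reg_weight' a \<epsilon> y"
    using reg_den[of y] by (simp add: reg_weight'_def diff_divide_distrib power2_eq_square mult_ac)
  finally show ?thesis by (simp add: reg_weight_def[abs_def])
qed

lemma continuous_reg_weight': "continuous_on UNIV (reg_weight' a \<epsilon>)"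
  unfolding reg_weight'_def[abs_def]
  using a reg_den by (intro continuous_intros continuous_pos_powr) (auto simp: less_imp_neq[THEN not_sym])

lemma reg_weight_nonneg: "reg_weight a \<epsilon> y \<ge> 0"
  unfolding reg_weight_def using reg_den[of y] by (intro divide_nonneg_pos) auto

lemma reg_weight_nonpos: "y \<le> 0 \<Longrightarrow> reg_weight a \<epsilon> y = 0" "y \<le> 0 \<Longrightarrow> reg_weight' a \<epsilon> y = 0"
  by (simp_all add: reg_weight_def reg_weight'_def)

lemma reg_weight_le: "reg_weight a \<epsilon> y \<le> pos_powr (a - 1) y"
proof (cases "y > 0")
  case True
  have "y powr (a + 1) = y powr (a - 1) * y\<^sup>2"
    using True by (simp add: powr_add powr_diff power2_eq_square)
  then have "y powr (a + 1) / (y\<^sup>2 + \<epsilon>) \<le> y powr (a - 1)"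
    using True \<epsilon> reg_den[of y] by (simp add: divide_le_eq distrib_left)
  then show ?thesis using True by (simp add: reg_weight_def pos_powr_pos)
qed (simp add: reg_weight_nonpos)

lemma mult_pos_powr: "y * pos_powr (b - 1) y = pos_powr b y"
  by (cases "y > 0") (auto simp: pos_powr_pos powr_diff)

lemma mult_reg_weight_le: "y * reg_weight a \<epsilon> y \<le> pos_powr a y"
  using mult_left_mono[OF reg_weight_le, of y y] mult_pos_powr[of y a] reg_weight_nonpos(1)[of y]
  by (cases "y > 0") auto

lemma mult_reg_weight_nonneg: "y * reg_weight a \<epsilon> y \<ge> 0"
  using reg_weight_nonneg[of y] reg_weight_nonpos(1)[of y] by (cases "y > 0") auto

text \<open>For the exact power \<open>a - 1\<close> the left side would be zero. The factor
  \<epsilon> / (y^2 + \<epsilon>) lies between 0 and 1 and tends to 0 for y > 0, so the error of the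
  regularisation is dominated by a multiple of \<open>pos_powr (a - 1)\<close> and disappears in the
  limit.\<close>

lemma reg_weight_defect:
  "y * reg_weight' a \<epsilon> y - (a - 1) * reg_weight a \<epsilon> y = 2 * reg_weight a \<epsilon> y * (\<epsilon> / (y\<^sup>2 + \<epsilon>))"
proof -
  have 1: "y * reg_weight' a \<epsilon> y = (a + 1) * reg_weight a \<epsilon> y - 2 * (y\<^sup>2 / (y\<^sup>2 + \<epsilon>)) * reg_weight a \<epsilon> y"
    using mult_pos_powr[of y "a + 1"]
    by (simp add: reg_weight'_def reg_weight_def right_diff_distrib power2_eq_square mult_ac)
  have 2: "\<epsilon> / (y\<^sup>2 + \<epsilon>) = 1 - y\<^sup>2 / (y\<^sup>2 + \<epsilon>)" using reg_den[of y] by (simp add: field_simps)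
  show ?thesis unfolding 1 2 by (simp add: algebra_simps)
qed

end

lemma reg_weight_limit:
  assumes "0 < a" "y > 0"
  shows "((\<lambda>\<epsilon>. y * reg_weight a \<epsilon> y) \<longlongrightarrow> pos_powr a y) (at 0)"
    and "((\<lambda>\<epsilon>. reg_weight a \<epsilon> y * (\<epsilon> / (y\<^sup>2 + \<epsilon>))) \<longlongrightarrow> 0) (at 0)"
proof -
  have "((\<lambda>\<epsilon>. y * (pos_powr (a + 1) y / (y\<^sup>2 + \<epsilon>))) \<longlongrightarrow> y * (pos_powr (a + 1) y / (y\<^sup>2 + 0))) (at 0)"
    using assms by (intro tendsto_intros) auto
  also have "y * (pos_powr (a + 1) y / (y\<^sup>2 + 0)) = pos_powr a y"
    using assms by (simp add: pos_powr_pos powr_add power2_eq_square)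
  finally show "((\<lambda>\<epsilon>. y * reg_weight a \<epsilon> y) \<longlongrightarrow> pos_powr a y) (at 0)" by (simp add: reg_weight_def)
  have "((\<lambda>\<epsilon>. (pos_powr (a + 1) y / (y\<^sup>2 + \<epsilon>)) * (\<epsilon> / (y\<^sup>2 + \<epsilon>))) \<longlongrightarrow>
      (pos_powr (a + 1) y / (y\<^sup>2 + 0)) * (0 / (y\<^sup>2 + 0))) (at 0)"
    using assms by (intro tendsto_intros) auto
  then show "((\<lambda>\<epsilon>. reg_weight a \<epsilon> y * (\<epsilon> / (y\<^sup>2 + \<epsilon>))) \<longlongrightarrow> 0) (at 0)" by (simp add: reg_weight_def)
qed

text \<open>The quadratic is A (w + |s - m|) (w - |s - m|), with roots m - w and m + w. The product
  A (w + |s - m|) is at least A w, and a - 1 <= 0, so the power is at most (A w)^(a - 1) times the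
  distance to the nearer root raised to a - 1. The latter is integrable because a > 0.\<close>

lemma nn_integral_quadratic_pos_powr:
  assumes a: "0 < a" "a \<le> 1" and A: "A > 0" and M: "M > 0"
  defines "w \<equiv> sqrt (M / A)"
  shows "(\<integral>\<^sup>+s. ennreal (pos_powr (a - 1) (M - A * (s - m)\<^sup>2)) \<partial>lborel)
    \<le> ennreal (2 * (A * w) powr (a - 1) * w powr a / a)"
proof -
  have w: "w > 0" "M = A * w\<^sup>2" using A M by (auto simp: w_def)
  define g where "g x = indicator {0..w} x * x powr (a - 1)" for x :: real
  have [measurable]: "g \<in> borel_measurable borel" unfolding g_def[abs_def] by measurable
  have g0: "g x \<ge> 0" for x by (simp add: g_def)
  have "((\<lambda>x. x powr (a - 1)) has_integral (w powr (a - 1 + 1) / (a - 1 + 1))) {0..w}"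
    using a w by (intro has_integral_powr_from_0) auto
  then have g: "(\<integral>\<^sup>+x. ennreal (g x) \<partial>lborel) = ennreal (w powr a / a)"
  proof -
    assume I: "((\<lambda>x. x powr (a - 1)) has_integral (w powr (a - 1 + 1) / (a - 1 + 1))) {0..w}"
    have "g = (\<lambda>x. if x \<in> {0..w} then x powr (a - 1) else 0)" by (auto simp: g_def)
    with has_integral_restrict_UNIV[THEN iffD2, OF I] have "(g has_integral w powr a / a) UNIV" by simp
    then show ?thesis using nn_integral_has_integral_lborel[of g] g0 by simp
  qed
  have g1: "(\<integral>\<^sup>+s. ennreal (g (m + w - s)) \<partial>lborel) = ennreal (w powr a / a)"
    using nn_integral_real_affine[of "\<lambda>x. ennreal (g x)" "-1" "m + w"] g by simp
  have g2: "(\<integral>\<^sup>+s. ennreal (g (s - (m - w))) \<partial>lborel) = ennreal (w powr a / a)"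
    using nn_integral_real_affine[of "\<lambda>x. ennreal (g x)" 1 "- (m - w)"] g by (simp add: algebra_simps)
  have le: "pos_powr (a - 1) (M - A * (s - m)\<^sup>2) \<le> (A * w) powr (a - 1) * (g (m + w - s) + g (s - (m - w)))" for s
  proof (cases "M - A * (s - m)\<^sup>2 > 0")
    case True
    define d where "d = w - \<bar>s - m\<bar>"
    have eq: "M - A * (s - m)\<^sup>2 = A * (w + \<bar>s - m\<bar>) * d"
      unfolding w(2) d_def by (simp add: algebra_simps power2_eq_square)
    have "0 < A * (w + \<bar>s - m\<bar>)" using A w(1) by (intro mult_pos_pos) auto
    then have d: "d > 0" using True unfolding eq by (rule zero_less_mult_pos[rotated])
    have "d \<le> w" by (simp add: d_def)
    note d = d this
    have "A * w * d \<le> M - A * (s - m)\<^sup>2"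
      unfolding eq using A d by (intro mult_right_mono mult_left_mono) auto
    then have "(M - A * (s - m)\<^sup>2) powr (a - 1) \<le> (A * w * d) powr (a - 1)"
      using a A w d by (intro powr_mono2') auto
    also have "\<dots> = (A * w) powr (a - 1) * d powr (a - 1)"
      using A w d by (simp add: powr_mult)
    also have "d powr (a - 1) \<le> g (m + w - s) + g (s - (m - w))"
    proof (cases "s \<ge> m")
      case True
      then have "d powr (a - 1) = g (m + w - s)" using d by (auto simp: g_def d_def indicator_def algebra_simps)
      then show ?thesis using g0 by simp
    next
      case False
      then have "d powr (a - 1) = g (s - (m - w))" using d by (auto simp: g_def d_def indicator_def algebra_simps)
      then show ?thesis using g0 by simp
    qed
    finally show ?thesis using True by (simp add: pos_powr_pos mult_left_mono)
  qed (use g0 in auto)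
  have "(\<integral>\<^sup>+s. ennreal (pos_powr (a - 1) (M - A * (s - m)\<^sup>2)) \<partial>lborel)
     \<le> (\<integral>\<^sup>+s. ennreal ((A * w) powr (a - 1)) * (ennreal (g (m + w - s)) + ennreal (g (s - (m - w)))) \<partial>lborel)"
    by (intro nn_integral_mono) (use le g0 in \<open>auto simp flip: ennreal_plus ennreal_mult intro!: ennreal_leI\<close>)
  also have "\<dots> = ennreal ((A * w) powr (a - 1)) * (ennreal (w powr a / a) + ennreal (w powr a / a))"
    by (subst nn_integral_cmult, measurable, subst nn_integral_add) (auto simp: g1 g2)
  also have "\<dots> = ennreal (2 * (A * w) powr (a - 1) * w powr a / a)"
    using a by (simp flip: ennreal_plus ennreal_mult)
  finally show ?thesis .
qed


text \<open>
  The vertex \<open>(l, l \<kappa> e)\<close> lies outside the cone because \<open>\<sigma> < \<kappa>\<close>.  Hence the spatial distance to it is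
  bounded below where the weight is supported, and \<open>v\<^bsup>a - 1\<^esup>\<close> is integrable there.
\<close>

locale cone_vertex =
  fixes \<sigma> \<kappa> :: real and e :: "'b::euclidean_space"
  assumes \<sigma>: "0 < \<sigma>" and \<sigma>\<kappa>: "\<sigma> < \<kappa>" and \<kappa>: "\<kappa> < 1" and norm_e: "norm e = 1"
begin

definition vertex :: "real \<Rightarrow> real \<times> 'b" where
  "vertex l = (l, (l * \<kappa>) *\<^sub>R e)"

text \<open>Positive exactly at the points that are spacelike to the vertex.\<close>

definition msq :: "real \<Rightarrow> real \<times> 'b \<Rightarrow> real" where
  "msq l z = (z - vertex l) \<bullet> reflect (z - vertex l)"

lemma msq_eq: "msq l z = (norm (snd z - (l * \<kappa>) *\<^sub>R e))\<^sup>2 - (fst z - l)\<^sup>2"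
  by (simp add: msq_def vertex_def reflect_def inner_prod_def dot_square_norm)
     (simp add: power2_eq_square algebra_simps)

text \<open>As a function of \<open>l\<close> this is a parabola with leading coefficient \<kappa>^2
  - 1, negative because the ray of vertices is timelike; its value at an arbitrary reference
  \<open>r\<close> fixes the height. Integrals over \<open>l\<close> thereby take the form of
  \<open>nn_integral_quadratic_pos_powr\<close>.\<close>

lemma msq_quadratic:
  defines "A \<equiv> 1 - \<kappa>\<^sup>2"
  shows "msq l z = msq r z + A * (r - (fst z - \<kappa> * (snd z \<bullet> e)) / A)\<^sup>2 - A * (l - (fst z - \<kappa> * (snd z \<bullet> e)) / A)\<^sup>2"
proof -
  have "\<kappa>\<^sup>2 < 1" using \<sigma> \<sigma>\<kappa> \<kappa> by (simp add: abs_square_less_1)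
  then have A: "A \<noteq> 0" unfolding A_def by linarith
  have ee: "e \<bullet> e = 1" by (rule norm_eq_1[THEN iffD1, OF norm_e])
  define B where "B = fst z - \<kappa> * (snd z \<bullet> e)"
  have n: "(norm (snd z - c *\<^sub>R e))\<^sup>2 = (norm (snd z))\<^sup>2 - 2 * c * (snd z \<bullet> e) + c\<^sup>2" for c
  proof -
    have "(norm (snd z - c *\<^sub>R e))\<^sup>2 = snd z \<bullet> snd z - 2 * c * (snd z \<bullet> e) + c * c * (e \<bullet> e)"
      unfolding power2_norm_eq_inner by (simp add: inner_diff_left inner_diff_right inner_commute[of e "snd z"] right_diff_distrib)
    then show ?thesis unfolding dot_square_norm norm_e power2_eq_square[of c] by simp
  qed
  have m: "msq l z = (norm (snd z))\<^sup>2 - (fst z)\<^sup>2 + 2 * l * B - A * l\<^sup>2" for l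
    unfolding msq_eq n A_def B_def by (simp add: power2_eq_square algebra_simps)
  have sq: "A * (l - B / A)\<^sup>2 = A * l\<^sup>2 - 2 * l * B + B * (B / A)" for l
  proof -
    have "A * (l - B / A)\<^sup>2 = A * l\<^sup>2 - 2 * l * (A * (B / A)) + (A * (B / A)) * (B / A)"
      by (algebra)
    also have "A * (B / A) = B" using A by simp
    finally show ?thesis .
  qed
  have cancel: "x + 2 * r * B - A * r\<^sup>2 + (A * r\<^sup>2 - 2 * r * B + b) - (A * l\<^sup>2 - 2 * l * B + b) = x + 2 * l * B - A * l\<^sup>2"
    for x b by linarith
  show ?thesis unfolding m B_def[symmetric] sq cancel ..
qed

lemma radius_bounds:
  assumes z: "norm (snd z) \<le> \<sigma> * fst z" and l: "0 < l"
  shows "norm (snd z - (l * \<kappa>) *\<^sub>R e) \<le> \<sigma> * fst z + \<kappa> * l"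
    and "\<kappa> * l - \<sigma> * fst z \<le> norm (snd z - (l * \<kappa>) *\<^sub>R e)"
proof -
  have n: "norm ((l * \<kappa>) *\<^sub>R e) = \<kappa> * l" using l \<sigma> \<sigma>\<kappa> norm_e by simp
  show "norm (snd z - (l * \<kappa>) *\<^sub>R e) \<le> \<sigma> * fst z + \<kappa> * l"
    using norm_triangle_ineq4[of "snd z" "(l * \<kappa>) *\<^sub>R e"] z unfolding n by linarith
  show "\<kappa> * l - \<sigma> * fst z \<le> norm (snd z - (l * \<kappa>) *\<^sub>R e)"
    using norm_triangle_ineq2[of "(l * \<kappa>) *\<^sub>R e" "snd z"] z unfolding n norm_minus_commute[of "(l * \<kappa>) *\<^sub>R e"]
    by linarith
qed

lemma msq_pos_imp:
  assumes "msq l z > 0"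
  shows "\<bar>fst z - l\<bar> < norm (snd z - (l * \<kappa>) *\<^sub>R e)"
proof -
  have "\<bar>fst z - l\<bar>\<^sup>2 < (norm (snd z - (l * \<kappa>) *\<^sub>R e))\<^sup>2" using assms by (simp add: msq_eq)
  then show ?thesis by (rule power2_less_imp_less) simp
qed

text \<open>\<open>c1\<close> and \<open>c2\<close> are (1 - \<sigma>) / (1 + \<kappa>) and (1 +
  \<sigma>) / (1 - \<kappa>) with 1 + \<kappa> and 1 + \<sigma> replaced by 2; they bound
  \<open>l\<close> by multiples of \<open>t\<close> in \<open>support\<close>.\<close>

definition c1 :: real where "c1 = (1 - \<sigma>) / 2"
definition c2 :: real where "c2 = 2 / (1 - \<kappa>)"

lemma c12: "c1 > 0" "c2 > 0"
  using \<sigma> \<sigma>\<kappa> \<kappa> by (auto simp: c1_def c2_def)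

text \<open>For the spatial distance \<rho> to the vertex one has |t - l| < \<rho> <= \<sigma> t +
  \<kappa> l. Since \<sigma> and \<kappa> are below 1, \<open>t\<close> and \<open>l\<close> control
  each other and hence everything else. The last bound combines |t - l| < \<rho> with \<kappa> l -
  \<sigma> t <= \<rho> and is meaningful because \<sigma> < \<kappa>.\<close>

lemma support:
  assumes z: "norm (snd z) \<le> \<sigma> * fst z" and l: "0 < l" and v: "msq l z > 0"
  shows "c1 * fst z \<le> l" "l \<le> c2 * fst z" "fst z > 0"
    and "norm (z - vertex l) \<le> 2 * (1 / c1 + 1) * l"
    and "msq l z \<le> (1 + c2)\<^sup>2 * (fst z)\<^sup>2"
    and "msq l z \<le> (1 / c1 + 1)\<^sup>2 * l\<^sup>2"
    and "(\<kappa> - \<sigma>) / (1 + \<sigma>) * l \<le> norm (snd z - (l * \<kappa>) *\<^sub>R e)"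
proof -
  define \<rho> where "\<rho> = norm (snd z - (l * \<kappa>) *\<^sub>R e)"
  have \<rho>: "\<rho> \<le> \<sigma> * fst z + \<kappa> * l" "\<kappa> * l - \<sigma> * fst z \<le> \<rho>" "\<bar>fst z - l\<bar> < \<rho>"
    using radius_bounds[OF z l] msq_pos_imp[OF v] by (auto simp: \<rho>_def)
  have t0: "fst z \<ge> 0" using z \<sigma> norm_ge_zero[of "snd z"] by (metis order_trans zero_le_mult_iff not_le)
  have "(1 - \<kappa>) * l < (1 + \<sigma>) * fst z" using \<rho> by (simp add: algebra_simps)
  also have "\<dots> \<le> 2 * fst z" using t0 \<sigma>\<kappa> \<kappa> by (intro mult_right_mono) auto
  finally have 2: "(1 - \<kappa>) * l < 2 * fst z" .
  then show lc2: "l \<le> c2 * fst z" using \<kappa> by (simp add: c2_def field_simps)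
  have "0 < (1 - \<kappa>) * l" using \<kappa> l by simp
  then show "fst z > 0" using 2 by linarith
  have "(1 - \<sigma>) * fst z < (1 + \<kappa>) * l" using \<rho> by (simp add: algebra_simps)
  also have "\<dots> \<le> 2 * l" using l \<kappa> by (intro mult_right_mono) auto
  finally show lc1: "c1 * fst z \<le> l" by (simp add: c1_def)
  then have tl: "fst z \<le> l / c1" using c12 by (simp add: field_simps)
  have "\<sigma> * fst z \<le> 1 * fst z" "\<kappa> * l \<le> 1 * l" using t0 l \<sigma>\<kappa> \<kappa> by (intro mult_right_mono; simp)+
  then have \<rho>t: "\<rho> \<le> fst z + l" using \<rho> by linarith
  have "norm (z - vertex l) \<le> \<bar>fst z - l\<bar> + \<rho>"
    using norm_Pair_le[of "fst z - l" "snd z - (l * \<kappa>) *\<^sub>R e"]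
    by (simp add: vertex_def \<rho>_def minus_prod_def)
  also have "\<dots> \<le> 2 * (fst z + l)" using \<rho>(3) \<rho>t by simp
  also have "\<dots> \<le> 2 * (l / c1 + l)" using tl by simp
  finally show "norm (z - vertex l) \<le> 2 * (1 / c1 + 1) * l" by (simp add: algebra_simps)
  have \<rho>0: "\<rho> \<ge> 0" by (simp add: \<rho>_def)
  have m: "msq l z \<le> \<rho>\<^sup>2" by (simp add: msq_eq \<rho>_def)
  have "\<rho> \<le> (1 + c2) * fst z" using \<rho>t lc2 by (simp add: algebra_simps)
  from power_mono[OF this \<rho>0, of 2] m show "msq l z \<le> (1 + c2)\<^sup>2 * (fst z)\<^sup>2"
    by (simp add: power_mult_distrib)
  have "\<rho> \<le> (1 / c1 + 1) * l" using \<rho>t tl by (simp add: algebra_simps)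
  from power_mono[OF this \<rho>0, of 2] m show "msq l z \<le> (1 / c1 + 1)\<^sup>2 * l\<^sup>2"
    by (simp add: power_mult_distrib)
  have "\<sigma> * fst z \<le> \<sigma> * (l + \<rho>)" using \<rho> \<sigma> by (intro mult_left_mono) auto
  then have "(\<kappa> - \<sigma>) * l \<le> (1 + \<sigma>) * \<rho>" using \<rho>(2) by (simp add: algebra_simps)
  then show "(\<kappa> - \<sigma>) / (1 + \<sigma>) * l \<le> norm (snd z - (l * \<kappa>) *\<^sub>R e)"
    using \<sigma> by (simp add: \<rho>_def field_simps)
qed

text \<open>With d = (\<kappa> - \<sigma>) / 2 the spatial distance is at least 2 d t and the time
  difference at most d t, whence the constant 4 - 1 = 3. For vertices in this window the weight has
  its full size.\<close>

lemma msq_lower: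
  assumes z: "norm (snd z) \<le> \<sigma> * fst z" and l: "fst z \<le> l" "l \<le> (1 + (\<kappa> - \<sigma>) / 2) * fst z" and t: "fst z > 0"
  shows "3 * ((\<kappa> - \<sigma>) / 2)\<^sup>2 * (fst z)\<^sup>2 \<le> msq l z"
proof -
  define d where "d = (\<kappa> - \<sigma>) / 2"
  have d: "d > 0" using \<sigma>\<kappa> by (simp add: d_def)
  have l0: "l > 0" using l t by linarith
  have "\<kappa> * fst z \<le> \<kappa> * l" using l \<sigma> \<sigma>\<kappa> by (intro mult_left_mono) auto
  then have "2 * d * fst z \<le> norm (snd z - (l * \<kappa>) *\<^sub>R e)"
    using radius_bounds(2)[OF z l0] by (simp add: d_def algebra_simps)
  then have 1: "(2 * d * fst z)\<^sup>2 \<le> (norm (snd z - (l * \<kappa>) *\<^sub>R e))\<^sup>2"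
    using d t by (intro power_mono) auto
  have "(l - fst z)\<^sup>2 \<le> (d * fst z)\<^sup>2" using l[folded d_def] by (intro power_mono) (auto simp: algebra_simps)
  then have "(fst z - l)\<^sup>2 \<le> (d * fst z)\<^sup>2" by (simp add: power2_commute)
  with 1 show ?thesis unfolding msq_eq d_def[symmetric] by (simp add: power_mult_distrib)
qed

text \<open>Averaged over the position of the vertex, the singular weight becomes a power of \<open>t\<close>.\<close>

lemma nn_integral_msq_vertex:
  assumes a: "0 < a" "a \<le> 1"
  obtains C where "C > 0" "\<And>z. norm (snd z) \<le> \<sigma> * fst z \<Longrightarrow> fst z > 0 \<Longrightarrow>
    (\<integral>\<^sup>+l. ennreal (pos_powr (a - 1) (msq l z)) \<partial>lborel) \<le> ennreal (C * fst z powr (2 * a - 1))"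
proof -
  define A where "A = 1 - \<kappa>\<^sup>2"
  have "\<kappa>\<^sup>2 < 1" using \<sigma> \<sigma>\<kappa> \<kappa> by (simp add: abs_square_less_1)
  then have A: "A > 0" by (simp add: A_def)
  define d where "d = 3 * ((\<kappa> - \<sigma>) / 2)\<^sup>2"
  have d: "d > 0" using \<sigma>\<kappa> by (simp add: d_def)
  \<comment> \<open>\<open>C3\<close> bounds the maximum of the parabola in units of t^2: at l = 0
    its value is at most t^2, and its centre is at most 2 t / A.\<close>
  define C3 where "C3 = 4 + A * (2 / A)\<^sup>2"
  have C3: "C3 > 0" using A by (simp add: C3_def add_pos_nonneg)
  define w1 where "w1 = sqrt (d / A)"
  define w2 where "w2 = sqrt (C3 / A)"
  have w12: "w1 > 0" "w2 > 0" using A d C3 by (auto simp: w1_def w2_def)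
  define C where "C = 2 * (A * w1) powr (a - 1) * w2 powr a / a"
  show ?thesis
  proof (rule that)
    show "C > 0" using a A w12 by (simp add: C_def)
    fix z :: "real \<times> 'b" assume z: "norm (snd z) \<le> \<sigma> * fst z" "fst z > 0"
    define m where "m = (fst z - \<kappa> * (snd z \<bullet> e)) / A"
    \<comment> \<open>\<open>M\<close> is the maximum of the parabola over \<open>l\<close>. It lies
      between \<open>d\<close> and \<open>C3\<close> times t^2, so the distance \<open>w\<close>
      from centre to root is comparable to t, and \<open>nn_integral_quadratic_pos_powr\<close>
      yields t^(a - 1) t^a.\<close>
    define M where "M = msq (fst z) z + A * (fst z - m)\<^sup>2"
    have msq: "msq l z = M - A * (l - m)\<^sup>2" for l
      using msq_quadratic[of l z "fst z"] by (simp add: M_def m_def A_def)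
    have t: "fst z \<le> (1 + (\<kappa> - \<sigma>) / 2) * fst z" using z \<sigma>\<kappa> by simp
    have "d * (fst z)\<^sup>2 \<le> msq (fst z) z" using msq_lower[OF z(1) order_refl t z(2)] by (simp add: d_def)
    moreover have "A * (fst z - m)\<^sup>2 \<ge> 0" using A by simp
    ultimately have M1: "d * (fst z)\<^sup>2 \<le> M" unfolding M_def by linarith
    then have M0: "M > 0" using d z(2) by (smt (verit) mult_pos_pos zero_less_power)
    have "\<sigma> * fst z \<le> 1 * fst z" using z \<sigma>\<kappa> \<kappa> by (intro mult_right_mono) auto
    then have xt: "norm (snd z) \<le> fst z" using z by linarith
    have xe: "\<bar>\<kappa> * (snd z \<bullet> e)\<bar> \<le> fst z"
    proof -
      have "\<bar>\<kappa> * (snd z \<bullet> e)\<bar> \<le> 1 * norm (snd z)"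
        using \<sigma> \<sigma>\<kappa> \<kappa> Cauchy_Schwarz_ineq2[of "snd z" e] norm_e unfolding abs_mult by (intro mult_mono) auto
      with xt show ?thesis by linarith
    qed
    have "norm (snd z - (fst z * \<kappa>) *\<^sub>R e) \<le> \<sigma> * fst z + \<kappa> * fst z" by (rule radius_bounds[OF z])
    also have "\<dots> \<le> 2 * fst z" using mult_right_mono[of "\<sigma> + \<kappa>" 2 "fst z"] z \<sigma>\<kappa> \<kappa> by (simp add: algebra_simps)
    finally have "(norm (snd z - (fst z * \<kappa>) *\<^sub>R e))\<^sup>2 \<le> (2 * fst z)\<^sup>2" by (intro power_mono) auto
    then have "msq (fst z) z \<le> 4 * (fst z)\<^sup>2" by (simp add: msq_eq power_mult_distrib)
    moreover have "0 \<le> m" "m \<le> 2 / A * fst z"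
      using xe A z by (auto simp: m_def divide_le_eq field_simps)
    then have "A * m\<^sup>2 \<le> A * (2 / A * fst z)\<^sup>2"
      using A by (intro mult_left_mono power_mono) auto
    moreover have "M = msq 0 z + A * m\<^sup>2" using msq[of 0] by simp
    moreover have "msq 0 z \<le> (norm (snd z))\<^sup>2" by (simp add: msq_eq)
    moreover have "(norm (snd z))\<^sup>2 \<le> (fst z)\<^sup>2" using xt by (intro power_mono) auto
    moreover have "(fst z)\<^sup>2 \<le> 4 * (fst z)\<^sup>2" by simp
    moreover have "C3 * (fst z)\<^sup>2 = 4 * (fst z)\<^sup>2 + A * (2 / A * fst z)\<^sup>2"
      unfolding C3_def power_mult_distrib by (simp add: algebra_simps)
    ultimately have M2: "M \<le> C3 * (fst z)\<^sup>2" by linarith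
    define w where "w = sqrt (M / A)"
    have "sqrt (d / A * (fst z)\<^sup>2) \<le> w" unfolding w_def using M1 A by (intro real_sqrt_le_mono) (simp add: field_simps)
    then have wl: "w1 * fst z \<le> w" using z unfolding real_sqrt_mult w1_def by simp
    have "w \<le> sqrt (C3 / A * (fst z)\<^sup>2)" unfolding w_def using M2 A by (intro real_sqrt_le_mono) (simp add: field_simps)
    then have wu: "w \<le> w2 * fst z" using z unfolding real_sqrt_mult w2_def by simp
    have w0: "w > 0" using A M0 by (simp add: w_def)
    have "(\<integral>\<^sup>+l. ennreal (pos_powr (a - 1) (msq l z)) \<partial>lborel) \<le> ennreal (2 * (A * w) powr (a - 1) * w powr a / a)"
      unfolding msq w_def by (rule nn_integral_quadratic_pos_powr[OF a A M0])
    also have "\<dots> \<le> ennreal (C * fst z powr (2 * a - 1))"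
    proof (rule ennreal_leI)
      have "(A * w) powr (a - 1) \<le> (A * w1 * fst z) powr (a - 1)"
        using a A w12 z wl by (intro powr_mono2') (auto simp: mult.assoc)
      moreover have "w powr a \<le> (w2 * fst z) powr a" using a w0 wu by (intro powr_mono2) auto
      ultimately have "2 * (A * w) powr (a - 1) * w powr a / a \<le> 2 * (A * w1 * fst z) powr (a - 1) * (w2 * fst z) powr a / a"
        using a by (intro divide_right_mono mult_mono) auto
      also have "\<dots> = C * (fst z powr (a - 1) * fst z powr a)"
        using A w12 z by (simp add: C_def powr_mult)
      also have "fst z powr (a - 1) * fst z powr a = fst z powr (2 * a - 1)" by (simp flip: powr_add)
      finally show "2 * (A * w) powr (a - 1) * w powr a / a \<le> C * fst z powr (2 * a - 1)" .
    qed
    finally show "(\<integral>\<^sup>+l. ennreal (pos_powr (a - 1) (msq l z)) \<partial>lborel) \<le> ennreal (C * fst z powr (2 * a - 1))" .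
  qed
qed

end

section \<open>The potential of the nonlinearity\<close>

definition potential :: "real \<Rightarrow> real \<Rightarrow> real" where
  "potential p u = (pos_powr (p + 1) u + pos_powr (p + 1) (- u)) / (p + 1)"

definition potential' :: "real \<Rightarrow> real \<Rightarrow> real" where
  "potential' p u = pos_powr p u - pos_powr p (- u)"

lemma potential_eq: "potential p u = \<bar>u\<bar> powr (p + 1) / (p + 1)"
  unfolding potential_def pos_powr_def by (cases "u \<ge> 0") (auto simp: max_def)

lemma potential'_eq: "potential' p u = \<bar>u\<bar> powr (p - 1) * u"
proof (cases "u = 0")
  case False
  then have "\<bar>u\<bar> powr (p - 1) * \<bar>u\<bar> = \<bar>u\<bar> powr p" by (simp add: powr_diff)
  with False show ?thesis unfolding potential'_def pos_powr_def by (cases "u \<ge> 0") (auto simp: max_def)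
qed (simp add: potential'_def)

context
  fixes p :: real assumes p: "1 \<le> p"
begin

text \<open>In terms of the two half-line powers, differentiability at u = 0 is inherited from
  \<open>pos_powr_has_derivative\<close>, since p + 1 > 1.\<close>

lemma potential_has_derivative: "(potential p has_real_derivative potential' p u) (at u)"
proof -
  have "((\<lambda>u. pos_powr (p + 1) (- u)) has_real_derivative ((p + 1) * pos_powr (p + 1 - 1) (- u)) * (- 1)) (at u)"
    using p by (intro DERIV_chain'[OF _ pos_powr_has_derivative]) (auto intro!: derivative_eq_intros)
  then have "((\<lambda>u. (pos_powr (p + 1) u + pos_powr (p + 1) (- u)) / (p + 1)) has_real_derivative
      ((p + 1) * pos_powr (p + 1 - 1) u + ((p + 1) * pos_powr (p + 1 - 1) (- u)) * (- 1)) / (p + 1)) (at u)"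
    using p by (intro DERIV_cdivide DERIV_add pos_powr_has_derivative) auto
  moreover have "((p + 1) * pos_powr (p + 1 - 1) u + ((p + 1) * pos_powr (p + 1 - 1) (- u)) * (- 1)) / (p + 1) = potential' p u"
    using p by (simp add: potential'_def field_simps)
  ultimately show ?thesis by (simp add: potential_def[abs_def])
qed

lemma continuous_potential': "continuous_on UNIV (potential' p)"
  unfolding potential'_def[abs_def] using p
  by (intro continuous_intros continuous_pos_powr continuous_on_compose2[OF continuous_pos_powr]) auto

lemma potential'_mult: "potential' p u * u = (p + 1) * potential p u"
proof -
  have "\<bar>u\<bar> powr (p - 1) * (u * u) = \<bar>u\<bar> powr (p + 1)"
  proof (cases "u = 0")
    case False
    then have "\<bar>u\<bar> powr (p - 1) * (\<bar>u\<bar> * \<bar>u\<bar>) = \<bar>u\<bar> powr (p + 1)" by (simp add: powr_diff powr_add del: abs_mult_self_eq)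
    then show ?thesis by simp
  qed (use p in simp)
  then show ?thesis using p by (simp add: potential'_eq potential_eq mult.assoc)
qed

lemma potential_nonneg: "potential p u \<ge> 0"
  and potential_le: "potential p u \<le> \<bar>u\<bar> powr (p + 1)"
proof -
  show "potential p u \<ge> 0" using p by (simp add: potential_eq)
  have "\<bar>u\<bar> powr (p + 1) * 1 \<le> \<bar>u\<bar> powr (p + 1) * (p + 1)" using p by (intro mult_left_mono) auto
  then show "potential p u \<le> \<bar>u\<bar> powr (p + 1)" using p by (simp add: potential_eq divide_le_eq)
qed

end

section \<open>The truncated cone as the epigraph of a Lipschitz function\<close>

definition cone_height :: "real \<Rightarrow> 'b::euclidean_space \<Rightarrow> real" where
  "cone_height \<sigma> x = max 1 (norm x / \<sigma>)"

text \<open>As an epigraph, the region has base disc and lateral boundary in a single graph, so one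
  application of \<open>divergence_theorem_epigraph\<close> covers both and the edge between them
  needs no treatment of its own.\<close>

definition late_cone :: "real \<Rightarrow> (real \<times> 'b::euclidean_space) set" where
  "late_cone \<sigma> = {z. cone_height \<sigma> (snd z) \<le> fst z}"

definition open_late_cone :: "real \<Rightarrow> (real \<times> 'b::euclidean_space) set" where
  "open_late_cone \<sigma> = {z. cone_height \<sigma> (snd z) < fst z}"

text \<open>The gradient of \<open>cone_height\<close>, zero over the base disc; the edge
  \<open>norm x = \<sigma>\<close> is a null set.\<close>

definition cone_normal :: "real \<Rightarrow> 'b::euclidean_space \<Rightarrow> 'b" where
  "cone_normal \<sigma> x = (if norm x > \<sigma> then sgn x /\<^sub>R \<sigma> else 0)"

context
  fixes \<sigma> :: real assumes \<sigma>: "0 < \<sigma>"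
begin

lemma late_cone_iff: "z \<in> late_cone \<sigma> \<longleftrightarrow> 1 \<le> fst z \<and> norm (snd z) \<le> \<sigma> * fst z"
  using \<sigma> by (auto simp: late_cone_def cone_height_def field_simps)

lemma open_late_cone_iff: "z \<in> open_late_cone \<sigma> \<longleftrightarrow> 1 < fst z \<and> norm (snd z) < \<sigma> * fst z"
  using \<sigma> by (auto simp: open_late_cone_def cone_height_def field_simps)

lemma cone_height_lipschitz: "(1 / \<sigma>)-lipschitz_on UNIV (cone_height \<sigma> :: 'b::euclidean_space \<Rightarrow> real)"
proof (rule lipschitz_onI)
  fix x y :: 'b
  have "\<bar>norm x / \<sigma> - norm y / \<sigma>\<bar> \<le> norm (x - y) / \<sigma>"
    using \<sigma> norm_triangle_ineq3[of x y] by (simp add: diff_divide_distrib[symmetric] divide_right_mono)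
  then show "dist (cone_height \<sigma> x) (cone_height \<sigma> y) \<le> 1 / \<sigma> * dist x y"
  proof -
    assume *: "\<bar>norm x / \<sigma> - norm y / \<sigma>\<bar> \<le> norm (x - y) / \<sigma>"
    have "\<bar>max 1 a - max 1 b\<bar> \<le> \<bar>a - b\<bar>" for a b :: real by arith
    from order_trans[OF this *] show ?thesis by (simp add: cone_height_def dist_norm)
  qed
qed (use \<sigma> in auto)

lemma continuous_cone_height: "continuous_on UNIV (\<lambda>z :: real \<times> 'b::euclidean_space. cone_height \<sigma> (snd z))"
  unfolding cone_height_def using \<sigma> by (intro continuous_intros) auto

lemma open_open_late_cone: "open (open_late_cone \<sigma> :: (real \<times> 'b::euclidean_space) set)"
  unfolding open_late_cone_def by (intro open_Collect_less continuous_cone_height continuous_intros)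

lemma closed_late_cone: "closed (late_cone \<sigma> :: (real \<times> 'b::euclidean_space) set)"
  unfolding late_cone_def by (intro closed_Collect_le continuous_cone_height continuous_intros)

lemma open_late_cone_subset: "open_late_cone \<sigma> \<subseteq> late_cone \<sigma>"
  by (auto simp: open_late_cone_def late_cone_def)

lemma convex_late_cone: "convex (late_cone \<sigma> :: (real \<times> 'b::euclidean_space) set)"
proof (rule convexI)
  fix z w :: "real \<times> 'b" and u v :: real
  assume z: "z \<in> late_cone \<sigma>" and w: "w \<in> late_cone \<sigma>" and u: "0 \<le> u" "0 \<le> v" "u + v = 1"
  have "u * 1 + v * 1 \<le> u * fst z + v * fst w"
    using z w u unfolding late_cone_iff by (intro add_mono mult_left_mono) auto
  moreover have "norm (u *\<^sub>R snd z + v *\<^sub>R snd w) \<le> u * norm (snd z) + v * norm (snd w)"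
    using u norm_triangle_ineq[of "u *\<^sub>R snd z" "v *\<^sub>R snd w"] by simp
  moreover have "u * norm (snd z) + v * norm (snd w) \<le> u * (\<sigma> * fst z) + v * (\<sigma> * fst w)"
    using z w u unfolding late_cone_iff by (intro add_mono mult_left_mono) auto
  ultimately show "u *\<^sub>R z + v *\<^sub>R w \<in> late_cone \<sigma>"
    using u unfolding late_cone_iff by (auto simp: algebra_simps)
qed

text \<open>Every point of the closed region is the limit of its own upward time translates, which
  lie in the open region.\<close>

lemma late_cone_subset_closure: "late_cone \<sigma> \<subseteq> closure (open_late_cone \<sigma> :: (real \<times> 'b::euclidean_space) set)"
proof
  fix z :: "real \<times> 'b" assume z: "z \<in> late_cone \<sigma>"
  have "(\<lambda>k. z + inverse (real (Suc k)) *\<^sub>R (1, 0)) \<longlonglongrightarrow> z + 0 *\<^sub>R (1, 0)"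
    by (intro tendsto_intros LIMSEQ_inverse_real_of_nat)
  then have "(\<lambda>k. z + inverse (real (Suc k)) *\<^sub>R (1, 0)) \<longlonglongrightarrow> z"
    unfolding scaleR_zero_left add_0_right .
  moreover have "z + inverse (real (Suc k)) *\<^sub>R (1, 0) \<in> open_late_cone \<sigma>" for k
  proof -
    have "\<sigma> * inverse (real (Suc k)) > 0" "inverse (real (Suc k)) > 0" using \<sigma> by simp_all
    then show ?thesis using z unfolding late_cone_iff open_late_cone_iff
      by (simp add: distrib_left del: of_nat_Suc inverse_positive_iff_positive zero_less_mult_iff)
  qed
  ultimately show "z \<in> closure (open_late_cone \<sigma>)"
    unfolding closure_sequential by (intro exI conjI allI)
qed

lemma cone_normal_bound: "norm (cone_normal \<sigma> x) \<le> 1 / \<sigma>"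
  using \<sigma> by (simp add: cone_normal_def norm_sgn divide_simps)

lemma cone_normal_measurable: "cone_normal \<sigma> \<in> borel_measurable borel"
  unfolding cone_normal_def[abs_def] sgn_div_norm by measurable

text \<open>The height fails to be differentiable only on the edge sphere of radius \<sigma>; the
  kink of the norm at 0 is hidden under the flat part of the maximum.\<close>

lemma cone_height_derivative:
  "AE x in lborel. (cone_height \<sigma> has_derivative (\<lambda>y. cone_normal \<sigma> x \<bullet> y)) (at (x :: 'b::euclidean_space))"
proof -
  have "sphere (0::'b) \<sigma> \<in> null_sets lborel"
    using negligible_sphere[of "0::'b" \<sigma>]
    by (simp add: negligible_iff_null_sets null_sets_completion_iff)
  then have "AE x in lborel. x \<notin> sphere (0::'b) \<sigma>" by (rule AE_not_in)
  then show ?thesis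
  proof eventually_elim
    case (elim x)
    show ?case
    proof (cases "norm x > \<sigma>")
      case True
      then have x0: "x \<noteq> 0" using \<sigma> by auto
      have "((\<lambda>x. norm x / \<sigma>) has_derivative (\<lambda>y. (y \<bullet> sgn x) / \<sigma>)) (at x)"
        by (rule bounded_linear.has_derivative[OF bounded_linear_divide has_derivative_norm[OF x0]])
      then have "((\<lambda>x. norm x / \<sigma>) has_derivative (\<lambda>y. cone_normal \<sigma> x \<bullet> y)) (at x)"
        using True by (simp add: cone_normal_def inner_commute divide_inverse mult.commute)
      moreover have "open {x::'b. norm x > \<sigma>}" by (intro open_Collect_less continuous_intros)
      ultimately show ?thesis
        by (rule has_derivative_transform_within_open) (use True \<sigma> in \<open>auto simp: cone_height_def max_def field_simps\<close>)
    next
      case False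
      with elim have lt: "norm x < \<sigma>" by auto
      have "((\<lambda>_. 1) has_derivative (\<lambda>y. cone_normal \<sigma> x \<bullet> y)) (at x)"
        using False by (simp add: cone_normal_def)
      moreover have "open {x::'b. norm x < \<sigma>}" by (intro open_Collect_less continuous_intros)
      ultimately show ?thesis
        by (rule has_derivative_transform_within_open) (use lt \<sigma> in \<open>auto simp: cone_height_def max_def field_simps\<close>)
    qed
  qed
qed

lemma integrable_late_cone:
  fixes f :: "real \<times> 'b::euclidean_space \<Rightarrow> real"
  assumes f: "continuous_on (late_cone \<sigma>) f" and supp: "\<And>z. z \<in> late_cone \<sigma> \<Longrightarrow> norm z > R \<Longrightarrow> f z = 0"
  shows "integrable lborel (\<lambda>z. indicator (open_late_cone \<sigma>) z *\<^sub>R f z)"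
proof -
  let ?K = "late_cone \<sigma> \<inter> cball 0 R :: (real \<times> 'b) set"
  have "integrable lborel (\<lambda>z. indicator ?K z *\<^sub>R f z)"
    using closed_late_cone by (intro borel_integrable_compact continuous_on_subset[OF f]) (auto simp: closed_Int_compact)
  then have "integrable lborel (\<lambda>z. indicator (open_late_cone \<sigma>) z *\<^sub>R indicator ?K z *\<^sub>R f z)"
    by (rule integrable_mult_indicator[rotated]) (use open_open_late_cone in \<open>auto intro: borel_open\<close>)
  also have "(\<lambda>z. indicator (open_late_cone \<sigma>) z *\<^sub>R indicator ?K z *\<^sub>R f z) = (\<lambda>z. indicator (open_late_cone \<sigma>) z *\<^sub>R f z)"
  proof
    fix z :: "real \<times> 'b"
    show "indicator (open_late_cone \<sigma>) z *\<^sub>R indicator ?K z *\<^sub>R f z = indicator (open_late_cone \<sigma>) z *\<^sub>R f z"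
      using supp[of z] open_late_cone_subset by (cases "norm z > R") (auto simp: indicator_def)
  qed
  finally show ?thesis .
qed

end

text \<open>If \<open>f\<close> is not integrable, its Bochner integral is 0 by convention and the
  bound persists. This allows the boundary flux to be estimated without first proving it
  integrable.\<close>

lemma ennreal_integral_le_nn_integral: "ennreal (integral\<^sup>L M f) \<le> (\<integral>\<^sup>+x. ennreal (f x) \<partial>M)"
proof (cases "integrable M f")
  case True
  have "integral\<^sup>L M f \<le> enn2real (\<integral>\<^sup>+x. ennreal (f x) \<partial>M)"
    by (simp add: real_lebesgue_integral_def[OF True])
  moreover have "(\<integral>\<^sup>+x. ennreal (f x) \<partial>M) < top"
    using True by (simp add: real_integrable_def top.not_eq_extremum)
  ultimately show ?thesis
    using ennreal_leI[of "integral\<^sup>L M f" "enn2real (\<integral>\<^sup>+x. ennreal (f x) \<partial>M)"] by simp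
qed (simp add: not_integrable_integral_eq)

section \<open>The estimate for one vertex\<close>

text \<open>Negative reals are truncated to 0 by \<open>ennreal\<close>, so additivity becomes an
  inequality; the integrated divergence has no known sign.\<close>

lemma ennreal_add_le: "ennreal (x + y) \<le> ennreal x + ennreal y"
proof (cases "0 \<le> x \<and> 0 \<le> y")
  case False
  then have "x + y \<le> x \<or> x + y \<le> y" by linarith
  then show ?thesis
    by (metis add_increasing add_increasing2 ennreal_leI zero_le)
qed (simp add: ennreal_plus)

text \<open>The quantity in \<open>gap\<close> is the coefficient of the potential energy in
  \<open>current_divergence\<close>. With n = \<open>DIM('b)\<close> it equals (4 - (n - 1) (p - 1))
  / 2 - a (p - 1).\<close>

locale subconformal_wave = cone_vertex \<sigma> \<kappa> e
  for \<sigma> \<kappa> :: real and e :: "'b::euclidean_space" +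
  fixes p a c CV :: real and V \<phi> :: "real \<times> 'b \<Rightarrow> real"
    and D DV :: "real \<times> 'b \<Rightarrow> real \<times> 'b" and H :: "real \<times> 'b \<Rightarrow> real \<times> 'b \<Rightarrow> real \<times> 'b"
  assumes p: "1 \<le> p" and a: "0 < a" "a \<le> 1"
    and c: "c = (real DIM('b) - 1) / 2 + a"
    and gap: "0 < real DIM('b) + 1 + 2 * a - c * (p + 1)"
    and \<phi>: "C1_on (late_cone \<sigma>) \<phi> (\<lambda>z h. D z \<bullet> h)" and D: "C1_on (late_cone \<sigma>) D H"
    and V: "C1_on (late_cone \<sigma>) V (\<lambda>z h. DV z \<bullet> h)"
    and CV: "CV > 0" "\<And>z. z \<in> late_cone \<sigma> \<Longrightarrow> inverse CV \<le> V z" "\<And>z. z \<in> late_cone \<sigma> \<Longrightarrow> V z \<le> CV"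
    and decay: "\<And>\<epsilon>. \<epsilon> > 0 \<Longrightarrow> \<exists>T. \<forall>z\<in>late_cone \<sigma>. T \<le> fst z \<longrightarrow> norm (DV z) \<le> \<epsilon> * inverse (fst z)"
    and wave: "\<And>z. z \<in> late_cone \<sigma> \<Longrightarrow>
      lin_trace (\<lambda>h. reflect (H z h)) + V z * (\<bar>\<phi> z\<bar> powr (p - 1) * \<phi> z) = 0"
begin

abbreviation K :: "(real \<times> 'b) set" where "K \<equiv> late_cone \<sigma>"
abbreviation \<Omega> :: "(real \<times> 'b) set" where "\<Omega> \<equiv> open_late_cone \<sigma>"

text \<open>The field \<open>P\<close> of \<open>current_divergence\<close> for the weight
  \<open>reg_weight a \<epsilon>\<close>. The first two summands in the bracket are the
  energy-momentum tensor applied to the scaling field, the third comes from the zeroth order part of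
  the multiplier.\<close>

definition current :: "real \<Rightarrow> real \<Rightarrow> real \<times> 'b \<Rightarrow> real \<times> 'b" where
  "current l \<epsilon> z = (msq l z * reg_weight a \<epsilon> (msq l z)) *\<^sub>R ((D z \<bullet> (z - vertex l)) *\<^sub>R reflect (D z)
      + (V z * potential p (\<phi> z) - (D z \<bullet> reflect (D z)) / 2) *\<^sub>R (z - vertex l) + (c * \<phi> z) *\<^sub>R reflect (D z))
      + (a * c * reg_weight a \<epsilon> (msq l z) * (\<phi> z)\<^sup>2) *\<^sub>R (z - vertex l)"

definition energy :: "real \<times> 'b \<Rightarrow> real" where
  "energy z = (norm (D z))\<^sup>2 + \<bar>\<phi> z\<bar> powr (p + 1)"

text \<open>Up to a constant and a factor \<open>l\<close>, a bound for the current that is uniform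
  in \<epsilon>.\<close>

definition flux_density :: "real \<Rightarrow> real \<times> 'b \<Rightarrow> real" where
  "flux_density l z = pos_powr a (msq l z) * energy z + pos_powr (a - 1) (msq l z) * (\<phi> z)\<^sup>2"

text \<open>The expression that the defect of the weight multiplies in
  \<open>current_divergence\<close>; its continuity makes it bounded on compact sets.\<close>

definition defect_form :: "real \<Rightarrow> real \<times> 'b \<Rightarrow> real" where
  "defect_form l z = (D z \<bullet> (z - vertex l))\<^sup>2 - msq l z * (D z \<bullet> reflect (D z)) / 2
     + msq l z * V z * potential p (\<phi> z) + c * \<phi> z * (D z \<bullet> (z - vertex l)) + a * c * (\<phi> z)\<^sup>2"

lemma in_cone: "z \<in> K \<Longrightarrow> norm (snd z) \<le> \<sigma> * fst z" "z \<in> K \<Longrightarrow> 1 \<le> fst z"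
  by (simp_all add: late_cone_iff[OF \<sigma>])

lemma c_nonneg: "c \<ge> 0"
proof -
  have "real DIM('b) \<ge> 1" using DIM_positive[where 'a='b] by linarith
  then show ?thesis using a unfolding c by simp
qed

lemma cont_msq: "continuous_on S (msq l)"
  unfolding msq_def[abs_def]
  by (intro continuous_intros bounded_linear.continuous_on[OF bounded_linear_reflect])

lemma cont_data: "continuous_on K \<phi>" "continuous_on K D" "continuous_on K V"
  "continuous_on K (\<lambda>z. reflect (D z))" "continuous_on K (\<lambda>z. potential p (\<phi> z))"
  "continuous_on K (\<lambda>z. \<bar>\<phi> z\<bar> powr (p + 1))"
proof -
  show 1: "continuous_on K \<phi>" "continuous_on K D" "continuous_on K V"
    using \<phi> D V by (auto intro: C1_on_continuous)
  show "continuous_on K (\<lambda>z. reflect (D z))"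
    by (rule bounded_linear.continuous_on[OF bounded_linear_reflect 1(2)])
  show 2: "continuous_on K (\<lambda>z. \<bar>\<phi> z\<bar> powr (p + 1))"
    using p by (intro continuous_on_powr' continuous_intros 1) auto
  then show "continuous_on K (\<lambda>z. potential p (\<phi> z))"
    unfolding potential_eq using p by (intro continuous_on_divide[OF _ continuous_on_const]) auto
qed

lemma symmetric_H: "z \<in> K \<Longrightarrow> H z d \<bullet> w = H z w \<bullet> d"
proof (rule symmetric_second_derivative[OF \<phi> D])
  have "\<Omega> \<subseteq> interior K"
    using open_open_late_cone[OF \<sigma>] open_late_cone_subset[OF \<sigma>] by (intro interior_maximal) auto
  then show "K \<subseteq> closure (interior K)"
    using late_cone_subset_closure[OF \<sigma>] closure_mono by blast
qed

text \<open>On the support of the weight, \<open>z - vertex l\<close> has size l and v is at most a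
  multiple of l^2. The cross term of \<phi> and \<open>D\<close> is split into l |D|^2 + \<phi>^2 /
  l; in the second part the factor v of the weight v \<beta> is traded for l^2, which leaves l
  \<beta> \<phi>^2.\<close>

lemma current_bound:
  obtains C where "C > 0" "\<And>l \<epsilon> z. 0 < l \<Longrightarrow> 0 < \<epsilon> \<Longrightarrow> z \<in> K \<Longrightarrow> norm (current l \<epsilon> z) \<le> C * l * flux_density l z"
proof -
  define B where "B = 1 / c1 + 1"
  have B: "B > 0" using c12 by (simp add: B_def add_pos_pos)
  define C where "C = (3 * B + c) + 2 * CV * B + (c * B\<^sup>2 + a * c * (2 * B)) + 1"
  have "3 * B + c \<ge> 0" "2 * CV * B \<ge> 0" "c * B\<^sup>2 + a * c * (2 * B) \<ge> 0" using B c_nonneg a CV by auto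
  then have C: "C > 0" "3 * B + c \<le> C" "2 * CV * B \<le> C" "c * B\<^sup>2 + a * c * (2 * B) \<le> C"
    unfolding C_def by linarith+
  have "norm (current l \<epsilon> z) \<le> C * l * flux_density l z" if l: "0 < l" and \<epsilon>: "0 < \<epsilon>" and z: "z \<in> K" for l \<epsilon> z
  proof (cases "msq l z > 0")
    case False
    then have "reg_weight a \<epsilon> (msq l z) = 0" by (intro reg_weight_nonpos[OF a(1) \<epsilon>]) auto
    then show ?thesis using C l by (simp add: current_def flux_density_def energy_def)
  next
    case v0: True
    define v where "v = msq l z"
    define \<beta> where "\<beta> = reg_weight a \<epsilon> v"
    define \<alpha> where "\<alpha> = v * \<beta>"
    define S where "S = z - vertex l"
    define \<delta> where "\<delta> = norm (D z)"
    define u where "u = \<bar>\<phi> z\<bar>"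
    define w where "w = u powr (p + 1)"
    have S: "norm S \<le> 2 * B * l" and vl: "v \<le> B\<^sup>2 * l\<^sup>2"
      using support[OF in_cone(1)[OF z] l v0] by (auto simp: S_def B_def v_def)
    have \<beta>: "0 \<le> \<beta>" "\<beta> \<le> pos_powr (a - 1) v"
      using reg_weight_nonneg[OF a(1) \<epsilon>] reg_weight_le[OF a(1) \<epsilon>] by (auto simp: \<beta>_def)
    have \<alpha>: "0 \<le> \<alpha>" "\<alpha> \<le> pos_powr a v"
      using mult_reg_weight_nonneg[OF a(1) \<epsilon>] mult_reg_weight_le[OF a(1) \<epsilon>] by (auto simp: \<alpha>_def \<beta>_def)
    have \<delta>0: "\<delta> \<ge> 0" "u \<ge> 0" "w \<ge> 0" by (auto simp: \<delta>_def u_def w_def)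
    have DS: "\<bar>D z \<bullet> S\<bar> \<le> \<delta> * (2 * B * l)"
      using Cauchy_Schwarz_ineq2[of "D z" S] S mult_left_mono[OF S, of \<delta>] \<delta>0 by (simp add: \<delta>_def)
    have DJD: "\<bar>D z \<bullet> reflect (D z)\<bar> \<le> \<delta>\<^sup>2"
      using Cauchy_Schwarz_ineq2[of "D z" "reflect (D z)"] by (simp add: \<delta>_def norm_reflect power2_eq_square)
    have VN: "\<bar>V z * potential p (\<phi> z)\<bar> \<le> CV * w"
    proof -
      have "\<bar>V z\<bar> \<le> CV" using CV(1) CV(2)[OF z] CV(3)[OF z] by (smt (verit) inverse_positive_iff_positive)
      then show ?thesis using potential_nonneg[OF p, of "\<phi> z"] potential_le[OF p, of "\<phi> z"]
        unfolding abs_mult w_def u_def by (intro mult_mono) auto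
    qed
    have 1: "norm ((D z \<bullet> S) *\<^sub>R reflect (D z)) \<le> 2 * B * l * \<delta>\<^sup>2"
      using mult_right_mono[OF DS \<delta>0(1)] by (simp add: norm_reflect \<delta>_def[symmetric] power2_eq_square mult_ac)
    have 2: "norm ((V z * potential p (\<phi> z) - (D z \<bullet> reflect (D z)) / 2) *\<^sub>R S) \<le> (CV * w + \<delta>\<^sup>2 / 2) * (2 * B * l)"
      unfolding norm_scaleR using VN DJD CV \<delta>0 S by (intro mult_mono) (auto simp: abs_le_iff)
    have 3: "norm ((c * \<phi> z) *\<^sub>R reflect (D z)) \<le> c * (l * \<delta>\<^sup>2 + u\<^sup>2 / l)"
    proof -
      have "0 \<le> (l * \<delta> - u)\<^sup>2 + (l * \<delta>)\<^sup>2 + u\<^sup>2" by simp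
      then have "2 * (u * \<delta>) * l \<le> 2 * ((l * \<delta>\<^sup>2) * l + u\<^sup>2)" by (simp add: power2_eq_square algebra_simps)
      then have "u * \<delta> \<le> l * \<delta>\<^sup>2 + u\<^sup>2 / l" using l by (simp add: field_simps)
      then show ?thesis using c_nonneg mult_left_mono[of "u * \<delta>" "l * \<delta>\<^sup>2 + u\<^sup>2 / l" c]
        by (simp add: norm_reflect \<delta>_def u_def abs_mult mult.assoc)
    qed
    have 4: "norm ((a * c * \<beta> * (\<phi> z)\<^sup>2) *\<^sub>R S) \<le> a * c * \<beta> * u\<^sup>2 * (2 * B * l)"
      using S a c_nonneg \<beta> unfolding norm_scaleR u_def by (intro mult_mono) (auto simp: abs_mult)
    have 5: "\<alpha> * (c * (u\<^sup>2 / l)) \<le> c * B\<^sup>2 * (l * (\<beta> * u\<^sup>2))"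
    proof -
      have "\<alpha> \<le> B\<^sup>2 * l\<^sup>2 * \<beta>" unfolding \<alpha>_def using vl \<beta> by (intro mult_right_mono) auto
      then have "\<alpha> * (c * (u\<^sup>2 / l)) \<le> (B\<^sup>2 * l\<^sup>2 * \<beta>) * (c * (u\<^sup>2 / l))"
        using c_nonneg l by (intro mult_right_mono) auto
      also have "\<dots> = c * B\<^sup>2 * (l * (\<beta> * u\<^sup>2))" using l by (simp add: field_simps power2_eq_square)
      finally show ?thesis .
    qed
    have "norm (current l \<epsilon> z) \<le> \<alpha> * (2 * B * l * \<delta>\<^sup>2 + (CV * w + \<delta>\<^sup>2 / 2) * (2 * B * l) + c * (l * \<delta>\<^sup>2 + u\<^sup>2 / l))
        + a * c * \<beta> * u\<^sup>2 * (2 * B * l)"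
      unfolding current_def v_def[symmetric] \<beta>_def[symmetric] \<alpha>_def[symmetric] S_def[symmetric]
      using \<alpha>(1) 1 2 3 4
      by (intro order_trans[OF norm_triangle_ineq] add_mono)
         (auto simp: norm_scaleR intro!: mult_left_mono order_trans[OF norm_triangle_ineq] add_mono)
    also have "\<dots> \<le> (3 * B + c) * (l * (\<alpha> * \<delta>\<^sup>2)) + 2 * CV * B * (l * (\<alpha> * w)) + (c * B\<^sup>2 + a * c * (2 * B)) * (l * (\<beta> * u\<^sup>2))"
      using 5 by (simp add: algebra_simps)
    also have "\<dots> \<le> C * (l * (\<alpha> * \<delta>\<^sup>2)) + C * (l * (\<alpha> * w)) + C * (l * (\<beta> * u\<^sup>2))"
      using l \<alpha> \<beta> \<delta>0 C by (intro add_mono mult_right_mono) auto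
    also have "\<dots> \<le> C * (l * (pos_powr a v * \<delta>\<^sup>2)) + C * (l * (pos_powr a v * w)) + C * (l * (pos_powr (a - 1) v * u\<^sup>2))"
      using l \<alpha> \<beta> \<delta>0 C by (intro add_mono mult_left_mono mult_right_mono) auto
    also have "\<dots> = C * l * flux_density l z"
      by (simp add: flux_density_def energy_def v_def \<delta>_def u_def w_def algebra_simps)
    finally show ?thesis .
  qed
  with C(1) show ?thesis using that by blast
qed

text \<open>This is the majorant for the defect term as \<epsilon> tends to 0. For fixed
  \<open>x\<close> the weight is a power of a quadratic in t with roots l - \<rho> and l + \<rho>.
  Where it does not vanish, \<rho> lies between r > 0 and R, so the integrals over t are uniformly
  bounded and \<open>x\<close> stays in a ball.\<close>

lemma integrable_singular_weight:
  assumes l: "l > 0"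
  shows "integrable lborel (\<lambda>z. indicator \<Omega> z *\<^sub>R pos_powr (a - 1) (msq l z))"
proof -
  have [measurable]: "msq l \<in> borel_measurable borel"
    using cont_msq by (rule borel_measurable_continuous_onI)
  have [measurable]: "\<Omega> \<in> sets borel" using open_open_late_cone[OF \<sigma>] by (rule borel_open)
  define \<rho> where "\<rho> x = norm (x - (l * \<kappa>) *\<^sub>R e)" for x
  define r where "r = (\<kappa> - \<sigma>) / (1 + \<sigma>) * l"
  have r: "r > 0" using l \<sigma> \<sigma>\<kappa> by (simp add: r_def)
  define R where "R = 2 * (1 / c1 + 1) * l + 1"
  have R: "R > 0" using l c12 by (simp add: R_def add_pos_pos)
  define C where "C = 2 * r powr (a - 1) * R powr a / a"
  define f where "f z = indicator {z. r \<le> \<rho> (snd z) \<and> \<rho> (snd z) \<le> R} z * pos_powr (a - 1) ((\<rho> (snd z))\<^sup>2 - (fst z - l)\<^sup>2)"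
    for z :: "real \<times> 'b"
  have [measurable]: "\<rho> \<in> borel_measurable borel" unfolding \<rho>_def by measurable
  have fm[measurable]: "f \<in> borel_measurable borel"
    unfolding f_def borel_prod[symmetric] by measurable
  have le: "indicator \<Omega> z *\<^sub>R pos_powr (a - 1) (msq l z) \<le> f z" for z
  proof (cases "z \<in> \<Omega> \<and> msq l z > 0")
    case True
    then have z: "norm (snd z) \<le> \<sigma> * fst z" "msq l z > 0"
      using in_cone(1) open_late_cone_subset[OF \<sigma>] by auto
    have "norm (snd (z - vertex l)) \<le> norm (z - vertex l)" by (metis norm_snd_le prod.collapse)
    then have "\<rho> (snd z) \<le> R" using support(4)[OF z(1) l z(2)] by (simp add: \<rho>_def R_def vertex_def)
    moreover have "r \<le> \<rho> (snd z)" using support(7)[OF z(1) l z(2)] by (simp add: \<rho>_def r_def)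
    ultimately show ?thesis using True by (simp add: f_def msq_eq \<rho>_def)
  qed (auto simp: f_def)
  have "(\<integral>\<^sup>+z. ennreal (f z) \<partial>lborel) = (\<integral>\<^sup>+x. \<integral>\<^sup>+t. ennreal (f (t, x)) \<partial>lborel \<partial>lborel)"
    by (rule nn_integral_lborel_fst_snd(1)) simp
  also have "\<dots> \<le> (\<integral>\<^sup>+x. ennreal C * indicator (cball ((l * \<kappa>) *\<^sub>R e) R) x \<partial>lborel)"
  proof (rule nn_integral_mono)
    fix x
    show "(\<integral>\<^sup>+t. ennreal (f (t, x)) \<partial>lborel) \<le> ennreal C * indicator (cball ((l * \<kappa>) *\<^sub>R e) R) x"
    proof (cases "r \<le> \<rho> x \<and> \<rho> x \<le> R")
      case True
      then have \<rho>: "\<rho> x > 0" using r by linarith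
      have "(\<integral>\<^sup>+t. ennreal (f (t, x)) \<partial>lborel) = (\<integral>\<^sup>+t. ennreal (pos_powr (a - 1) ((\<rho> x)\<^sup>2 - 1 * (t - l)\<^sup>2)) \<partial>lborel)"
        using True by (simp add: f_def)
      also have "\<dots> \<le> ennreal (2 * (1 * sqrt ((\<rho> x)\<^sup>2 / 1)) powr (a - 1) * sqrt ((\<rho> x)\<^sup>2 / 1) powr a / a)"
        using \<rho> by (intro nn_integral_quadratic_pos_powr[OF a]) auto
      also have "\<dots> \<le> ennreal C"
      proof (rule ennreal_leI)
        have "(\<rho> x) powr (a - 1) \<le> r powr (a - 1)" using True r a by (intro powr_mono2') auto
        moreover have "(\<rho> x) powr a \<le> R powr a" using True \<rho> a by (intro powr_mono2) auto
        ultimately show "2 * (1 * sqrt ((\<rho> x)\<^sup>2 / 1)) powr (a - 1) * sqrt ((\<rho> x)\<^sup>2 / 1) powr a / a \<le> C"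
          unfolding C_def using a \<rho> by (simp add: divide_right_mono mult_mono)
      qed
      finally show ?thesis using True by (simp add: \<rho>_def dist_norm norm_minus_commute)
    qed (auto simp: f_def)
  qed
  also have "\<dots> = ennreal C * emeasure lborel (cball ((l * \<kappa>) *\<^sub>R e) R)"
    by (subst nn_integral_cmult) (auto intro!: borel_measurable_indicator borel_closed)
  also have "\<dots> < \<infinity>" 
    using emeasure_lborel_cball_finite[of "(l * \<kappa>) *\<^sub>R e" R] by (simp add: ennreal_mult_less_top)
  finally have fin: "(\<integral>\<^sup>+z. ennreal (f z) \<partial>lborel) < \<infinity>" .
  have "(\<integral>\<^sup>+z. ennreal (norm (indicator \<Omega> z *\<^sub>R pos_powr (a - 1) (msq l z))) \<partial>lborel) \<le> (\<integral>\<^sup>+z. ennreal (f z) \<partial>lborel)"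
    by (intro nn_integral_mono ennreal_leI) (use le in simp)
  then show ?thesis using fin by (intro integrableI_bounded) (auto simp: less_top[symmetric] top_unique)
qed


section \<open>Traces on the lateral boundary\<close>

definition lateral :: "(real \<times> 'b \<Rightarrow> real) \<Rightarrow> 'b \<Rightarrow> real" where
  "lateral f x = indicator {x. norm x > \<sigma>} x * f (norm x / \<sigma>, x)"

lemma borel_measurable_lateral:
  assumes "continuous_on K f"
  shows "lateral f \<in> borel_measurable borel"
proof -
  have "open {x::'b. norm x > \<sigma>}" by (intro open_Collect_less continuous_intros)
  moreover have "continuous_on {x::'b. norm x > \<sigma>} (\<lambda>x. f (norm x / \<sigma>, x))"
    using \<sigma> by (intro continuous_on_compose2[OF assms] continuous_intros)
      (auto simp: late_cone_iff[OF \<sigma>] field_simps)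
  ultimately show ?thesis
    using borel_measurable_continuous_on_indicator[of "{x. norm x > \<sigma>}" "\<lambda>x. f (norm x / \<sigma>, x)"]
    by (simp add: lateral_def[abs_def] borel_open)
qed

lemma lateral_flux_density:
  "lateral (flux_density l) x = pos_powr a (msq l (norm x / \<sigma>, x)) * lateral energy x
     + pos_powr (a - 1) (msq l (norm x / \<sigma>, x)) * lateral (\<lambda>z. (\<phi> z)\<^sup>2) x"
  by (simp add: lateral_def flux_density_def algebra_simps)

lemma borel_measurable_lateral_data [measurable]:
  "lateral energy \<in> borel_measurable borel" "lateral (\<lambda>z. (\<phi> z)\<^sup>2) \<in> borel_measurable borel"
  unfolding energy_def[abs_def]
  by (intro borel_measurable_lateral continuous_intros cont_data)+

lemma lateral_nonneg: "lateral energy x \<ge> 0" "lateral (\<lambda>z. (\<phi> z)\<^sup>2) x \<ge> 0" "lateral (flux_density l) x \<ge> 0"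
  by (simp_all add: lateral_def energy_def flux_density_def)

text \<open>The divergence identity is integrated over the open region for fixed \<epsilon>, and
  then \<epsilon> tends to 0. The vertex is so late that the weight vanishes on the base disc, which
  leaves only the lateral flux. The right side may be infinite for a particular \<open>l\<close>; it
  is controlled only on average over \<open>l\<close>.\<close>

lemma vertex_estimate:
  obtains C L where "C > 0" "L > 0" "\<And>l. L \<le> l \<Longrightarrow>
    (\<integral>\<^sup>+z. ennreal (indicator \<Omega> z * (pos_powr a (msq l z) * \<bar>\<phi> z\<bar> powr (p + 1))) \<partial>lborel)
    \<le> (\<integral>\<^sup>+x. ennreal (C * l * lateral (flux_density l) x) \<partial>lborel)"
proof -
  obtain C1 where C1: "C1 > 0"
    "\<And>l \<epsilon> z. 0 < l \<Longrightarrow> 0 < \<epsilon> \<Longrightarrow> z \<in> K \<Longrightarrow> norm (current l \<epsilon> z) \<le> C1 * l * flux_density l z"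
    using current_bound by blast
  define \<Gamma> where "\<Gamma> = real DIM('b) + 1 + 2 * a - c * (p + 1)"
  have \<Gamma>: "\<Gamma> > 0" using gap by (simp add: \<Gamma>_def)
  define B where "B = 2 * (1 / c1 + 1)"
  have B: "B > 0" using c12 by (simp add: B_def add_pos_pos)
  \<comment> \<open>Half of the lower bound for \<open>\<Gamma> * V z\<close>; the other half
    absorbs the term with \<open>DV\<close>.\<close>
  define \<gamma> where "\<gamma> = \<Gamma> * inverse CV / 2"
  have \<gamma>: "\<gamma> > 0" using \<Gamma> CV by (simp add: \<gamma>_def)
  have "\<gamma> / (B * c2) > 0" using \<gamma> B c12 by simp
  \<comment> \<open>On the support \<open>norm (z - vertex l) \<le> B * l\<close> and
    \<open>l \<le> c2 * fst z\<close>, so this decay bounds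
    \<open>\<bar>DV z \<bullet> (z - vertex l)\<bar>\<close> by \<open>\<gamma>\<close>.\<close>
  then obtain T where T: "\<And>z. z \<in> K \<Longrightarrow> T \<le> fst z \<Longrightarrow> norm (DV z) \<le> \<gamma> / (B * c2) * inverse (fst z)"
    using decay by blast
  \<comment> \<open>Since \<open>l \<le> c2 * fst z\<close> on the support, \<open>l \<ge> L\<close>
    forces \<open>fst z \<ge> max T 1 + 1\<close>. Hence the decay of \<open>DV\<close> applies
    there, and the support stays away from t = 1.\<close>
  define L where "L = c2 * (max T 1 + 1)"
  have L: "L > 0" using c12 by (simp add: L_def)
  define C where "C = (p + 1) / \<gamma> * (C1 * (1 + 1 / \<sigma>))"
  have C: "C > 0" using p \<gamma> C1 \<sigma> by (simp add: C_def add_pos_pos)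
  show ?thesis
  proof (rule that[OF C L])
    fix l assume "L \<le> l"
    then have lL: "c2 * (max T 1 + 1) \<le> l" and l: "l > 0" using L by (auto simp: L_def)
    have tsupp: "fst z \<ge> max T 1 + 1" if "z \<in> K" "msq l z > 0" for z
    proof -
      have "c2 * (max T 1 + 1) \<le> c2 * fst z"
        using support(2)[OF in_cone(1)[OF that(1)] l that(2)] lL by linarith
      then show ?thesis using c12 by simp
    qed
    define R where "R = norm (vertex l) + B * l"
    have Rsupp: "msq l z \<le> 0" if "z \<in> K" "norm z > R" for z
    proof (rule ccontr)
      assume "\<not> msq l z \<le> 0"
      then have "norm (z - vertex l) \<le> B * l"
        using support(4)[OF in_cone(1)[OF that(1)] l] by (simp add: B_def)
      then show False using that(2) norm_triangle_sub[of z "vertex l"] by (simp add: R_def)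
    qed
    have V_lower: "\<gamma> \<le> \<Gamma> * V z + DV z \<bullet> (z - vertex l)" if z: "z \<in> K" "msq l z > 0" for z
    proof -
      have t: "fst z > 0" "l \<le> c2 * fst z" "norm (z - vertex l) \<le> B * l"
        using support[OF in_cone(1)[OF z(1)] l z(2)] by (auto simp: B_def)
      have "\<bar>DV z \<bullet> (z - vertex l)\<bar> \<le> norm (DV z) * norm (z - vertex l)" by (rule Cauchy_Schwarz_ineq2)
      also have "\<dots> \<le> (\<gamma> / (B * c2) * inverse (fst z)) * (B * (c2 * fst z))"
      proof (intro mult_mono T[OF z(1)])
        show "T \<le> fst z" using tsupp[OF z] by simp
        show "norm (z - vertex l) \<le> B * (c2 * fst z)"
          using t(3) mult_left_mono[OF t(2), of B] B by linarith
      qed (use \<gamma> B c12 t in auto)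
      also have "\<dots> = \<gamma>" using t B c12 by (simp add: field_simps)
      finally have 1: "\<bar>DV z \<bullet> (z - vertex l)\<bar> \<le> \<gamma>" .
      have "2 * \<gamma> \<le> \<Gamma> * V z" using mult_left_mono[OF CV(2)[OF z(1)], of \<Gamma>] \<Gamma> by (simp add: \<gamma>_def)
      with 1 show ?thesis by linarith
    qed
    define F where "F z = \<gamma> * (pos_powr a (msq l z) * potential p (\<phi> z))" for z
    define Fe where "Fe \<epsilon> z = \<gamma> * (msq l z * reg_weight a \<epsilon> (msq l z) * potential p (\<phi> z))" for \<epsilon> z
    \<comment> \<open>The factor 4 is 2 from \<open>current_divergence\<close> times 2 from
      \<open>reg_weight_defect\<close>.\<close>
    define G where "G \<epsilon> z = 4 * (reg_weight a \<epsilon> (msq l z) * (\<epsilon> / ((msq l z)\<^sup>2 + \<epsilon>))) * \<bar>defect_form l z\<bar>" for \<epsilon> z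
    have cont_pp: "continuous_on S (\<lambda>z. pos_powr b (msq l z))" if "b > 0" for S b
      by (rule continuous_on_compose2[OF continuous_pos_powr[OF that] cont_msq]) auto
    have cont_rw: "continuous_on S (\<lambda>z. reg_weight a \<epsilon> (msq l z))" if "\<epsilon> > 0" for S \<epsilon>
    proof (rule continuous_on_compose2[OF _ cont_msq])
      show "continuous_on UNIV (reg_weight a \<epsilon>)"
        using reg_weight_has_derivative[OF a(1) that] DERIV_isCont by (blast intro: continuous_at_imp_continuous_on)
    qed auto
    have cont_Q: "continuous_on K (defect_form l)"
      unfolding defect_form_def[abs_def] by (intro continuous_intros cont_data cont_msq) auto
    have F_int: "integrable lborel (\<lambda>z. indicator \<Omega> z *\<^sub>R F z)"
      unfolding F_def using a Rsupp
      by (intro integrable_late_cone[OF \<sigma>, where R = R] continuous_intros cont_data cont_pp) auto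
    have Fe_int: "integrable lborel (\<lambda>z. indicator \<Omega> z *\<^sub>R Fe \<epsilon> z)" if "\<epsilon> > 0" for \<epsilon>
      unfolding Fe_def using Rsupp reg_weight_nonpos(1)[OF a(1) that]
      by (intro integrable_late_cone[OF \<sigma>, where R = R] continuous_intros cont_data cont_rw cont_msq that) auto
    have G_int: "integrable lborel (\<lambda>z. indicator \<Omega> z *\<^sub>R G \<epsilon> z)" if "\<epsilon> > 0" for \<epsilon>
      unfolding G_def using Rsupp reg_weight_nonpos(1)[OF a(1) that] reg_den[OF a(1) that]
      by (intro integrable_late_cone[OF \<sigma>, where R = R] continuous_intros cont_Q cont_rw cont_msq that)
         (auto simp: less_imp_neq[THEN not_sym])
    define J where "J = (\<integral>\<^sup>+x. ennreal (C1 * (1 + 1 / \<sigma>) * l * lateral (flux_density l) x) \<partial>lborel)"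
    have main: "ennreal (\<integral>z. indicator \<Omega> z *\<^sub>R Fe \<epsilon> z \<partial>lborel) \<le> J + ennreal (\<integral>z. indicator \<Omega> z *\<^sub>R G \<epsilon> z \<partial>lborel)"
      if \<epsilon>: "\<epsilon> > 0" for \<epsilon>
    proof -
      note rw = reg_weight_nonneg[OF a(1) \<epsilon>] reg_weight_nonpos[OF a(1) \<epsilon>] mult_reg_weight_nonneg[OF a(1) \<epsilon>]
      have wave': "lin_trace (\<lambda>h. reflect (H z h)) + V z * potential' p (\<phi> z) = 0" if "z \<in> K" for z
        using wave[OF that] by (simp add: potential'_eq)
      obtain P' where P': "C1_on K (current l \<epsilon>) P'"
        "\<And>z e. z \<in> K \<Longrightarrow> reg_weight a \<epsilon> (msq l z) = 0 \<Longrightarrow> reg_weight' a \<epsilon> (msq l z) = 0 \<Longrightarrow> P' z e = 0"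
        "\<And>z. z \<in> K \<Longrightarrow> lin_trace (P' z) =
          2 * a * reg_weight a \<epsilon> (msq l z) * (D z \<bullet> (z - vertex l) + c * \<phi> z)\<^sup>2
          + msq l z * reg_weight a \<epsilon> (msq l z) * \<Gamma> * (V z * potential p (\<phi> z))
          + msq l z * reg_weight a \<epsilon> (msq l z) * (DV z \<bullet> (z - vertex l)) * potential p (\<phi> z)
          + 2 * (msq l z * reg_weight' a \<epsilon> (msq l z) - (a - 1) * reg_weight a \<epsilon> (msq l z)) * defect_form l z"
        using current_divergence[OF \<phi> D V symmetric_H reg_weight_has_derivative[OF a(1) \<epsilon>]
            continuous_reg_weight'[OF a(1) \<epsilon>] potential_has_derivative[OF p] continuous_potential'[OF p]
            potential'_mult[OF p] wave' c, of "vertex l"]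
        unfolding current_def[abs_def] msq_def[symmetric] \<Gamma>_def defect_form_def by blast
      have supp: "current l \<epsilon> z = 0" "P' z h = 0" if "z \<in> K" "norm z > R" for z h
        using Rsupp[OF that] rw(2,3) that P'(2) by (auto simp: current_def)
      have C_conv: "convex {z. cone_height \<sigma> (snd z) \<le> fst (z :: real \<times> 'b)}"
        using convex_late_cone[OF \<sigma>] by (simp add: late_cone_def)
      note div = divergence_theorem_epigraph[OF cone_height_lipschitz[OF \<sigma>] C_conv cone_normal_measurable[OF \<sigma>]
          cone_normal_bound[OF \<sigma>] cone_height_derivative[OF \<sigma>], folded late_cone_def open_late_cone_def,
          OF P'(1) supp]
      have lower: "Fe \<epsilon> z \<le> lin_trace (P' z) + G \<epsilon> z" if z: "z \<in> K" for z
      proof -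
        have N: "potential p (\<phi> z) \<ge> 0" by (rule potential_nonneg[OF p])
        have "Fe \<epsilon> z \<le> msq l z * reg_weight a \<epsilon> (msq l z) * potential p (\<phi> z) * (\<Gamma> * V z + DV z \<bullet> (z - vertex l))"
        proof (cases "msq l z > 0")
          case True
          have "(msq l z * reg_weight a \<epsilon> (msq l z) * potential p (\<phi> z)) * \<gamma>
            \<le> (msq l z * reg_weight a \<epsilon> (msq l z) * potential p (\<phi> z)) * (\<Gamma> * V z + DV z \<bullet> (z - vertex l))"
            by (intro mult_left_mono V_lower[OF z True] mult_nonneg_nonneg[OF rw(4) N])
          then show ?thesis by (simp add: Fe_def mult_ac)
        qed (use rw(2) in \<open>simp add: Fe_def\<close>)
        moreover have "2 * a * reg_weight a \<epsilon> (msq l z) * (D z \<bullet> (z - vertex l) + c * \<phi> z)\<^sup>2 \<ge> 0"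
          using a rw(1) by simp
        moreover have "- G \<epsilon> z \<le> 2 * (2 * reg_weight a \<epsilon> (msq l z) * (\<epsilon> / ((msq l z)\<^sup>2 + \<epsilon>))) * defect_form l z"
        proof -
          have "4 * (reg_weight a \<epsilon> (msq l z) * (\<epsilon> / ((msq l z)\<^sup>2 + \<epsilon>))) * (- \<bar>defect_form l z\<bar>)
             \<le> 4 * (reg_weight a \<epsilon> (msq l z) * (\<epsilon> / ((msq l z)\<^sup>2 + \<epsilon>))) * defect_form l z"
            using rw(1) \<epsilon> by (intro mult_left_mono mult_nonneg_nonneg divide_nonneg_nonneg) auto
          then show ?thesis unfolding G_def by (simp add: mult.assoc)
        qed
        ultimately show ?thesis unfolding P'(3)[OF z] reg_weight_defect[OF a(1) \<epsilon>]
          by (simp add: algebra_simps)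
      qed
      have flux: "current l \<epsilon> (cone_height \<sigma> x, x) \<bullet> (- 1, cone_normal \<sigma> x)
          \<le> C1 * (1 + 1 / \<sigma>) * l * lateral (flux_density l) x" for x
      proof (cases "norm x > \<sigma>")
        case True
        then have h: "cone_height \<sigma> x = norm x / \<sigma>" using \<sigma> by (simp add: cone_height_def max_def field_simps)
        have z: "(cone_height \<sigma> x, x) \<in> K" by (simp add: late_cone_def)
        have "current l \<epsilon> (cone_height \<sigma> x, x) \<bullet> (- 1, cone_normal \<sigma> x)
           \<le> norm (current l \<epsilon> (cone_height \<sigma> x, x)) * norm (- 1 :: real, cone_normal \<sigma> x)"
          using Cauchy_Schwarz_ineq2 abs_le_D1 by blast
        also have "\<dots> \<le> (C1 * l * flux_density l (cone_height \<sigma> x, x)) * (1 + 1 / \<sigma>)"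
        proof (rule mult_mono[OF C1(2)[OF l \<epsilon> z]])
          show "norm (- 1 :: real, cone_normal \<sigma> x) \<le> 1 + 1 / \<sigma>"
            using norm_Pair_le[of "- 1 :: real" "cone_normal \<sigma> x"] cone_normal_bound[OF \<sigma>, of x] by simp
          show "0 \<le> C1 * l * flux_density l (cone_height \<sigma> x, x)"
            using C1(1) l by (simp add: flux_density_def energy_def)
        qed simp
        finally show ?thesis using True by (simp add: h mult_ac lateral_def)
      next
        case False
        then have h: "cone_height \<sigma> x = 1" using \<sigma> by (simp add: cone_height_def max_def field_simps)
        \<comment> \<open>Over the base disc t = 1 lies below the support of the weight, so the
          current vanishes.\<close>
        have "msq l (1, x) \<le> 0"
        proof (rule ccontr)
          assume "\<not> msq l (1, x) \<le> 0"
          moreover have "(1, x) \<in> K" using h by (simp add: late_cone_def)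
          ultimately show False using tsupp[of "(1, x)"] by auto
        qed
        then show ?thesis using False rw(2) by (simp add: h current_def lateral_def)
      qed
      have "(\<integral>z. indicator \<Omega> z *\<^sub>R Fe \<epsilon> z \<partial>lborel)
         \<le> (\<integral>z. indicator \<Omega> z *\<^sub>R lin_trace (P' z) + indicator \<Omega> z *\<^sub>R G \<epsilon> z \<partial>lborel)"
        using lower open_late_cone_subset[OF \<sigma>]
        by (intro integral_mono Fe_int[OF \<epsilon>] Bochner_Integration.integrable_add div(1) G_int[OF \<epsilon>])
           (auto simp: indicator_def)
      also have "\<dots> = (\<integral>z. indicator \<Omega> z *\<^sub>R lin_trace (P' z) \<partial>lborel) + (\<integral>z. indicator \<Omega> z *\<^sub>R G \<epsilon> z \<partial>lborel)"
        by (rule Bochner_Integration.integral_add[OF div(1) G_int[OF \<epsilon>]])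
      finally have "ennreal (\<integral>z. indicator \<Omega> z *\<^sub>R Fe \<epsilon> z \<partial>lborel)
         \<le> ennreal ((\<integral>z. indicator \<Omega> z *\<^sub>R lin_trace (P' z) \<partial>lborel) + (\<integral>z. indicator \<Omega> z *\<^sub>R G \<epsilon> z \<partial>lborel))"
        by (rule ennreal_leI)
      also have "\<dots> \<le> ennreal (\<integral>z. indicator \<Omega> z *\<^sub>R lin_trace (P' z) \<partial>lborel) + ennreal (\<integral>z. indicator \<Omega> z *\<^sub>R G \<epsilon> z \<partial>lborel)"
        by (rule ennreal_add_le)
      also have "ennreal (\<integral>z. indicator \<Omega> z *\<^sub>R lin_trace (P' z) \<partial>lborel) \<le> J"
      proof -
        have "ennreal (\<integral>z. indicator \<Omega> z *\<^sub>R lin_trace (P' z) \<partial>lborel)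
          = ennreal (\<integral>x. current l \<epsilon> (cone_height \<sigma> x, x) \<bullet> (- 1, cone_normal \<sigma> x) \<partial>lborel)"
          by (rule arg_cong[OF div(2)])
        also have "\<dots> \<le> J" unfolding J_def
          by (rule order_trans[OF ennreal_integral_le_nn_integral]) (intro nn_integral_mono ennreal_leI flux)
        finally show ?thesis .
      qed
      finally show ?thesis by (simp add: add_right_mono)
    qed
    define \<epsilon> where "\<epsilon> k = inverse (real (Suc k))" for k
    have \<epsilon>: "\<epsilon> k > 0" for k by (simp add: \<epsilon>_def)
    have \<epsilon>0: "filterlim \<epsilon> (at 0) sequentially"
      unfolding filterlim_at \<epsilon>_def using LIMSEQ_inverse_real_of_nat by auto
    have lim_F: "(\<lambda>k. \<integral>z. indicator \<Omega> z *\<^sub>R Fe (\<epsilon> k) z \<partial>lborel) \<longlonglongrightarrow> (\<integral>z. indicator \<Omega> z *\<^sub>R F z \<partial>lborel)"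
    proof (rule integral_dominated_convergence[OF _ _ F_int])
      show "AE z in lborel. (\<lambda>k. indicator \<Omega> z *\<^sub>R Fe (\<epsilon> k) z) \<longlonglongrightarrow> indicator \<Omega> z *\<^sub>R F z"
      proof (intro AE_I2 tendsto_scaleR tendsto_const)
        fix z show "(\<lambda>k. Fe (\<epsilon> k) z) \<longlonglongrightarrow> F z"
        proof (cases "msq l z > 0")
          case True
          show ?thesis unfolding Fe_def F_def
            by (intro tendsto_intros filterlim_compose[OF reg_weight_limit(1)[OF a(1) True] \<epsilon>0])
        qed (use reg_weight_nonpos(1)[OF a(1) \<epsilon>] in \<open>simp add: Fe_def F_def\<close>)
      qed
      show "AE z in lborel. norm (indicator \<Omega> z *\<^sub>R Fe (\<epsilon> k) z) \<le> indicator \<Omega> z *\<^sub>R F z" for k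
      proof (intro AE_I2)
        fix z
        have N: "potential p (\<phi> z) \<ge> 0" by (rule potential_nonneg[OF p])
        have "0 \<le> Fe (\<epsilon> k) z" unfolding Fe_def
          by (rule mult_nonneg_nonneg[OF less_imp_le[OF \<gamma>] mult_nonneg_nonneg[OF mult_reg_weight_nonneg[OF a(1) \<epsilon>] N]])
        moreover have "Fe (\<epsilon> k) z \<le> F z" unfolding Fe_def F_def
          by (rule mult_left_mono[OF mult_right_mono[OF mult_reg_weight_le[OF a(1) \<epsilon>] N] less_imp_le[OF \<gamma>]])
        ultimately
        show "norm (indicator \<Omega> z *\<^sub>R Fe (\<epsilon> k) z) \<le> indicator \<Omega> z *\<^sub>R F z"
          by (simp add: indicator_def)
      qed
    qed (use F_int Fe_int[OF \<epsilon>] in auto)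
    have "bounded (defect_form l ` (K \<inter> cball 0 R))"
      using closed_late_cone[OF \<sigma>]
      by (intro compact_imp_bounded compact_continuous_image continuous_on_subset[OF cont_Q]) (auto simp: closed_Int_compact)
    then obtain M where M: "\<And>z. z \<in> K \<Longrightarrow> norm z \<le> R \<Longrightarrow> \<bar>defect_form l z\<bar> \<le> M"
      unfolding bounded_iff by (metis IntI image_eqI mem_cball_0 real_norm_def)
    \<comment> \<open>\<open>defect_form l\<close> is bounded on the compact part of the cone that
      supports the weight, so a multiple of the singular weight itself is an integrable
      majorant.\<close>
    have lim_G: "(\<lambda>k. \<integral>z. indicator \<Omega> z *\<^sub>R G (\<epsilon> k) z \<partial>lborel) \<longlonglongrightarrow> (\<integral>z. 0 \<partial>(lborel :: (real \<times> 'b) measure))"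
    proof (rule integral_dominated_convergence[where w = "\<lambda>z. (4 * \<bar>M\<bar>) * (indicator \<Omega> z *\<^sub>R pos_powr (a - 1) (msq l z))"])
      show "integrable lborel (\<lambda>z. (4 * \<bar>M\<bar>) * (indicator \<Omega> z *\<^sub>R pos_powr (a - 1) (msq l z)))"
        by (intro integrable_mult_right integrable_singular_weight l)
      show "AE z in lborel. (\<lambda>k. indicator \<Omega> z *\<^sub>R G (\<epsilon> k) z) \<longlonglongrightarrow> 0"
      proof (intro AE_I2)
        fix z
        have "(\<lambda>k. G (\<epsilon> k) z) \<longlonglongrightarrow> 4 * 0 * \<bar>defect_form l z\<bar>"
        proof (cases "msq l z > 0")
          case True
          show ?thesis unfolding G_def
            by (intro tendsto_intros filterlim_compose[OF reg_weight_limit(2)[OF a(1) True] \<epsilon>0])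
        qed (use reg_weight_nonpos(1)[OF a(1) \<epsilon>] in \<open>simp add: G_def\<close>)
        then have "(\<lambda>k. indicator \<Omega> z *\<^sub>R G (\<epsilon> k) z) \<longlonglongrightarrow> indicator \<Omega> z *\<^sub>R (4 * 0 * \<bar>defect_form l z\<bar>)"
          by (intro tendsto_scaleR tendsto_const)
        then show "(\<lambda>k. indicator \<Omega> z *\<^sub>R G (\<epsilon> k) z) \<longlonglongrightarrow> 0" by simp
      qed
      show "AE z in lborel. norm (indicator \<Omega> z *\<^sub>R G (\<epsilon> k) z) \<le> (4 * \<bar>M\<bar>) * (indicator \<Omega> z *\<^sub>R pos_powr (a - 1) (msq l z))" for k
      proof (intro AE_I2)
        fix z
        show "norm (indicator \<Omega> z *\<^sub>R G (\<epsilon> k) z) \<le> (4 * \<bar>M\<bar>) * (indicator \<Omega> z *\<^sub>R pos_powr (a - 1) (msq l z))"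
        proof (cases "z \<in> \<Omega> \<and> msq l z > 0")
          case True
          then have z: "z \<in> K" using open_late_cone_subset[OF \<sigma>] by auto
          have "norm z \<le> R" using Rsupp[OF z] True by force
          then have Mz: "\<bar>defect_form l z\<bar> \<le> \<bar>M\<bar>" using M[OF z] by linarith
          have r: "0 \<le> \<epsilon> k / ((msq l z)\<^sup>2 + \<epsilon> k)" "\<epsilon> k / ((msq l z)\<^sup>2 + \<epsilon> k) \<le> 1"
            using \<epsilon>[of k] reg_den[OF a(1) \<epsilon>[of k], of "msq l z"] by (auto simp: divide_le_eq)
          have "reg_weight a (\<epsilon> k) (msq l z) * (\<epsilon> k / ((msq l z)\<^sup>2 + \<epsilon> k)) \<le> pos_powr (a - 1) (msq l z) * 1"
            using r reg_weight_le[OF a(1) \<epsilon>[of k]] by (intro mult_mono) auto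
          then have "G (\<epsilon> k) z \<le> 4 * (pos_powr (a - 1) (msq l z)) * \<bar>M\<bar>"
            unfolding G_def using Mz mult_nonneg_nonneg[OF reg_weight_nonneg[OF a(1) \<epsilon>[of k], of "msq l z"] r(1)]
            by (intro mult_mono) auto
          moreover have "G (\<epsilon> k) z \<ge> 0" unfolding G_def
            using mult_nonneg_nonneg[OF reg_weight_nonneg[OF a(1) \<epsilon>[of k], of "msq l z"] r(1)]
            by (intro mult_nonneg_nonneg[of "4 * _"] mult_nonneg_nonneg[of 4]) auto
          ultimately show ?thesis using True by (simp add: mult_ac)
        next
          case False
          then show ?thesis using reg_weight_nonpos(1)[OF a(1) \<epsilon>[of k], of "msq l z"] by (auto simp: G_def indicator_def)
        qed
      qed
    qed (use G_int[OF \<epsilon>] in auto)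
    \<comment> \<open>An infinite \<open>J\<close> is trivial; a finite one allows the inequality
      \<open>main\<close> to be read in the reals, where the limit is taken.\<close>
    have FJ: "ennreal (\<integral>z. indicator \<Omega> z *\<^sub>R F z \<partial>lborel) \<le> J"
    proof (cases J)
      case (real j)
      have G0: "(\<integral>z. indicator \<Omega> z *\<^sub>R G (\<epsilon> k) z \<partial>lborel) \<ge> 0" for k
        unfolding G_def using \<epsilon>[of k] reg_weight_nonneg[OF a(1) \<epsilon>[of k]]
        by (intro Bochner_Integration.integral_nonneg) (simp add: add_nonneg_nonneg)
      have "(\<integral>z. indicator \<Omega> z *\<^sub>R Fe (\<epsilon> k) z \<partial>lborel) \<le> j + (\<integral>z. indicator \<Omega> z *\<^sub>R G (\<epsilon> k) z \<partial>lborel)" for k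
        using main[OF \<epsilon>[of k]] real G0[of k] by (simp flip: ennreal_plus)
      then have "(\<integral>z. indicator \<Omega> z *\<^sub>R F z \<partial>lborel) \<le> j + 0"
        using lim_G by (intro LIMSEQ_le[OF lim_F tendsto_add[OF tendsto_const]]) auto
      then show ?thesis using real by (simp add: ennreal_leI)
    qed simp
    have pos: "F z \<ge> 0" for z using \<gamma> potential_nonneg[OF p] by (simp add: F_def)
    have "(\<integral>\<^sup>+z. ennreal (indicator \<Omega> z * (pos_powr a (msq l z) * \<bar>\<phi> z\<bar> powr (p + 1))) \<partial>lborel)
       = (\<integral>\<^sup>+z. ennreal ((p + 1) / \<gamma>) * ennreal (indicator \<Omega> z *\<^sub>R F z) \<partial>lborel)"
      using p \<gamma> pos by (intro nn_integral_cong) (simp add: F_def potential_eq flip: ennreal_mult)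
    also have "\<dots> = ennreal ((p + 1) / \<gamma>) * ennreal (\<integral>z. indicator \<Omega> z *\<^sub>R F z \<partial>lborel)"
      using F_int pos by (subst nn_integral_cmult) (auto simp: nn_integral_eq_integral)
    also have "\<dots> \<le> ennreal ((p + 1) / \<gamma>) * J" by (intro mult_left_mono FJ) simp
    also have "\<dots> = (\<integral>\<^sup>+x. ennreal ((p + 1) / \<gamma>) * ennreal (C1 * (1 + 1 / \<sigma>) * l * lateral (flux_density l) x) \<partial>lborel)"
    proof -
      have [measurable]: "(\<lambda>x. msq l (norm x / \<sigma>, x)) \<in> borel_measurable borel" unfolding msq_eq by measurable
      show ?thesis unfolding J_def lateral_flux_density by (subst nn_integral_cmult) auto
    qed
    also have "\<dots> = (\<integral>\<^sup>+x. ennreal (C * l * lateral (flux_density l) x) \<partial>lborel)"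
      using p \<gamma> C1 \<sigma> l lateral_nonneg(3) by (intro nn_integral_cong) (simp add: C_def mult.assoc flip: ennreal_mult)
    finally show "(\<integral>\<^sup>+z. ennreal (indicator \<Omega> z * (pos_powr a (msq l z) * \<bar>\<phi> z\<bar> powr (p + 1))) \<partial>lborel)
       \<le> (\<integral>\<^sup>+x. ennreal (C * l * lateral (flux_density l) x) \<partial>lborel)" .
  qed
qed

end

section \<open>Averaging over the vertex\<close>

lemma nn_integral_powr_tail:
  assumes r: "r > 0" and b: "b < - 1"
  shows "(\<integral>\<^sup>+s. ennreal (s powr b) * indicator {r..} s \<partial>lborel) = ennreal (r powr (b + 1) / (- (b + 1)))"
proof -
  have "(\<integral>\<^sup>+s. ennreal (s powr b) * indicator {r..} s \<partial>lborel) = ennreal (0 - r powr (b + 1) / (b + 1))"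
  proof (rule nn_integral_FTC_atLeast)
    fix s assume "r \<le> s"
    then have "s > 0" using r by linarith
    then show "DERIV (\<lambda>s. s powr (b + 1) / (b + 1)) s :> s powr b"
      using b by (auto intro!: derivative_eq_intros)
    show "0 \<le> s powr b" by simp
  next
    have "((\<lambda>s. s powr (b + 1) / (b + 1)) \<longlongrightarrow> 0 / (b + 1)) at_top"
      using b by (intro tendsto_divide tendsto_neg_powr filterlim_ident tendsto_const) auto
    then show "((\<lambda>s. s powr (b + 1) / (b + 1)) \<longlongrightarrow> 0) at_top" by simp
  qed simp
  then show ?thesis by (simp only: diff_0 minus_divide_right)
qed

text \<open>In place of polar coordinates, |x|^(-q) is written as the integral of q s^(-q - 1) over
  s >= |x|. After Tonelli the inner integral is at most q s^(-q - 1) times the volume of a ball of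
  radius s, which leaves a convergent power because q exceeds the dimension.\<close>

lemma nn_integral_norm_powr_tail_finite:
  assumes r: "r > 0" and q: "q > real DIM('b::euclidean_space)"
  shows "(\<integral>\<^sup>+x. ennreal (indicator {x. norm x > r} x * norm x powr (- q)) \<partial>(lborel :: 'b measure)) < \<infinity>"
proof -
  define n where "n = real DIM('b)"
  have q0: "q > 0" using q by (metis of_nat_0_le_iff order_le_less_trans)
  define f where "f x s = indicator {y. r < y} (norm x) * indicator {y. norm x \<le> y} s * (q * s powr (- q - 1))" for x :: 'b and s :: real
  have f0: "f x s \<ge> 0" for x s using q0 by (simp add: f_def)
  have "open {z::'b \<times> real. r < norm (fst z)}" "closed {z::'b \<times> real. norm (fst z) \<le> snd z}"
    by (intro open_Collect_less closed_Collect_le continuous_intros)+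
  then have [measurable]: "{z::'b \<times> real. r < norm (fst z)} \<in> sets borel" "{z::'b \<times> real. norm (fst z) \<le> snd z} \<in> sets borel"
    by (auto intro: borel_open borel_closed)
  have eqf: "(\<lambda>z. f (fst z) (snd z)) = (\<lambda>z. indicator {z. r < norm (fst z)} z * indicator {z. norm (fst z) \<le> snd z} z
      * (q * snd z powr (- q - 1)))"
    by (auto simp: f_def indicator_def fun_eq_iff)
  have [measurable]: "(\<lambda>z::'b \<times> real. snd z) \<in> borel_measurable borel"
    unfolding borel_prod[symmetric] by measurable
  have fm: "(\<lambda>z. f (fst z) (snd z)) \<in> borel_measurable borel" unfolding eqf by measurable
  have [measurable]: "(\<lambda>s. f x s) \<in> borel_measurable borel" for x unfolding f_def by measurable
  have 1: "ennreal (indicator {x. norm x > r} x * norm x powr (- q)) = (\<integral>\<^sup>+s. ennreal (f x s) \<partial>lborel)" for x :: 'b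
  proof (cases "norm x > r")
    case True
    then have x: "norm x > 0" using r by linarith
    have "(\<integral>\<^sup>+s. ennreal (f x s) \<partial>lborel) = (\<integral>\<^sup>+s. ennreal q * (ennreal (s powr (- q - 1)) * indicator {norm x..} s) \<partial>lborel)"
      using True q0 by (intro nn_integral_cong) (auto simp: f_def indicator_def ennreal_mult)
    also have "\<dots> = ennreal q * ennreal (norm x powr (- q - 1 + 1) / (- (- q - 1 + 1)))"
      using q0 x by (subst nn_integral_cmult, simp, subst nn_integral_powr_tail) auto
    also have "\<dots> = ennreal (norm x powr (- q))" using q0 by (simp flip: ennreal_mult)
    finally show ?thesis using True by simp
  qed (simp add: f_def)
  have "(\<integral>\<^sup>+x. ennreal (indicator {x. norm x > r} x * norm x powr (- q)) \<partial>(lborel :: 'b measure))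
      = (\<integral>\<^sup>+x. \<integral>\<^sup>+s. ennreal (f x s) \<partial>lborel \<partial>lborel)"
    unfolding 1 ..
  also have "\<dots> = (\<integral>\<^sup>+s. \<integral>\<^sup>+x. ennreal (f x s) \<partial>lborel \<partial>lborel)"
    using nn_integral_lborel_fst_snd[of "\<lambda>z. ennreal (f (fst z) (snd z))"] fm by simp
  also have "\<dots> \<le> (\<integral>\<^sup>+s. ennreal (q * unit_ball_vol n) * (ennreal (s powr (n - q - 1)) * indicator {r..} s) \<partial>lborel)"
  proof (rule nn_integral_mono)
    fix s :: real
    show "(\<integral>\<^sup>+x. ennreal (f x s) \<partial>lborel) \<le> ennreal (q * unit_ball_vol n) * (ennreal (s powr (n - q - 1)) * indicator {r..} s)"
    proof (cases "s \<ge> r")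
      case True
      then have s: "s > 0" using r by linarith
      have "(\<integral>\<^sup>+x. ennreal (f x s) \<partial>lborel) \<le> (\<integral>\<^sup>+x. ennreal (q * s powr (- q - 1)) * indicator (cball (0::'b) s) x \<partial>lborel)"
        using q0 by (intro nn_integral_mono) (auto simp: f_def indicator_def)
      also have "\<dots> = ennreal (q * s powr (- q - 1)) * emeasure lborel (cball (0::'b) s)"
        by (rule nn_integral_cmult_indicator) (simp add: borel_closed)
      also have "\<dots> = ennreal (q * s powr (- q - 1) * (unit_ball_vol n * s ^ DIM('b)))"
        using s q0 by (simp add: emeasure_cball n_def flip: ennreal_mult)
      also have "q * s powr (- q - 1) * (unit_ball_vol n * s ^ DIM('b)) = q * unit_ball_vol n * (s powr (- q - 1) * s powr n)"
        using s by (simp add: n_def powr_realpow)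
      also have "s powr (- q - 1) * s powr n = s powr (n - q - 1)"
          unfolding powr_add[symmetric] by (simp add: algebra_simps)
      finally show ?thesis using True q0 by (simp add: n_def ennreal_mult)
    next
      case False
      then have "f x s = 0" for x by (auto simp: f_def indicator_def)
      then show ?thesis by simp
    qed
  qed
  also have "\<dots> = ennreal (q * unit_ball_vol n) * ennreal (r powr (n - q - 1 + 1) / (- (n - q - 1 + 1)))"
    using q r by (subst nn_integral_cmult, simp, subst nn_integral_powr_tail) (auto simp: n_def)
  also have "\<dots> < \<infinity>" by (simp add: ennreal_mult_less_top)
  finally show ?thesis .
qed

context subconformal_wave
begin

text \<open>Only the vertices with t <= l <= (1 + d) t are kept. By \<open>msq_lower\<close> they
  contribute at least the order t^(-2a - 2) t^(2a) t = t^(-1).\<close>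

lemma vertex_average_lower:
  assumes L: "L > 0"
  obtains C where "C > 0" "\<And>z. z \<in> K \<Longrightarrow> L \<le> fst z \<Longrightarrow>
    ennreal (C * inverse (fst z)) \<le> (\<integral>\<^sup>+l. ennreal (indicator {L..} l * (l powr (- 2 * a - 2) * pos_powr a (msq l z))) \<partial>lborel)"
proof -
  define d where "d = (\<kappa> - \<sigma>) / 2"
  have d: "d > 0" using \<sigma>\<kappa> by (simp add: d_def)
  define C where "C = d * (1 + d) powr (- 2 * a - 2) * (3 * d\<^sup>2) powr a"
  show ?thesis
  proof (rule that)
    show "C > 0" using d by (simp add: C_def)
    fix z assume z: "z \<in> K" "L \<le> fst z"
    then have t: "fst z > 0" using L by linarith
    let ?c = "((1 + d) * fst z) powr (- 2 * a - 2) * (3 * d\<^sup>2 * (fst z)\<^sup>2) powr a"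
    have "C * inverse (fst z) = ?c * (d * fst z)"
    proof -
      have "?c * (d * fst z) = C * (fst z powr (- 2 * a - 2) * (fst z)\<^sup>2 powr a * fst z)"
        using d t by (simp add: C_def powr_mult)
      also have "(fst z)\<^sup>2 powr a = fst z powr (2 * a)" using t by (simp add: powr_powr flip: powr_numeral)
      also have "fst z powr (- 2 * a - 2) * fst z powr (2 * a) * fst z = fst z powr (- 2 * a - 2) * fst z powr (2 * a) * fst z powr 1"
        using t by simp
      also have "\<dots> = fst z powr (- 1)" unfolding powr_add[symmetric] by simp
      finally show ?thesis using t by (simp add: powr_minus)
    qed
    then have "ennreal (C * inverse (fst z)) = ennreal ?c * emeasure lborel {fst z..(1 + d) * fst z}"
      using d t by (simp add: algebra_simps flip: ennreal_mult)
    also have "\<dots> = (\<integral>\<^sup>+l. ennreal ?c * indicator {fst z..(1 + d) * fst z} l \<partial>lborel)"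
      by (rule nn_integral_cmult_indicator[symmetric]) simp
    also have "\<dots> \<le> (\<integral>\<^sup>+l. ennreal (indicator {L..} l * (l powr (- 2 * a - 2) * pos_powr a (msq l z))) \<partial>lborel)"
    proof (rule nn_integral_mono)
      fix l
      show "ennreal ?c * indicator {fst z..(1 + d) * fst z} l \<le> ennreal (indicator {L..} l * (l powr (- 2 * a - 2) * pos_powr a (msq l z)))"
      proof (cases "l \<in> {fst z..(1 + d) * fst z}")
        case True
        then have l: "fst z \<le> l" "l \<le> (1 + d) * fst z" by auto
        have m: "3 * d\<^sup>2 * (fst z)\<^sup>2 \<le> msq l z"
          using msq_lower[OF in_cone(1)[OF z(1)] l(1) l(2)[unfolded d_def] t] by (simp add: d_def)
        have "0 < 3 * d\<^sup>2 * (fst z)\<^sup>2" using d t by simp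
        then have "(3 * d\<^sup>2 * (fst z)\<^sup>2) powr a \<le> pos_powr a (msq l z)"
          unfolding pos_powr_def using m a by (intro powr_mono2) auto
        moreover have "((1 + d) * fst z) powr (- 2 * a - 2) \<le> l powr (- 2 * a - 2)"
          using l t a by (intro powr_mono2') auto
        ultimately have "?c \<le> l powr (- 2 * a - 2) * pos_powr a (msq l z)" by (intro mult_mono) auto
        then show ?thesis using True z(2) by (simp add: ennreal_leI)
      qed simp
    qed
    finally show "ennreal (C * inverse (fst z)) \<le> (\<integral>\<^sup>+l. ennreal (indicator {L..} l * (l powr (- 2 * a - 2) * pos_powr a (msq l z))) \<partial>lborel)" .
  qed
qed

text \<open>The power of l is one higher than in \<open>vertex_average_lower\<close> because the
  flux carries a factor \<open>l\<close>. On the support l and t are comparable, so the first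
  integral has order at most t^(-2a - 1) t^(2a) t = 1, and by \<open>nn_integral_msq_vertex\<close>
  the second at most t^(-2a - 1) t^(2a - 1) = t^(-2).\<close>

lemma vertex_average_upper:
  assumes L: "L > 0"
  obtains C where "C > 0"
    "\<And>z. z \<in> K \<Longrightarrow> (\<integral>\<^sup>+l. ennreal (indicator {L..} l * (l powr (- 2 * a - 1) * pos_powr a (msq l z))) \<partial>lborel) \<le> ennreal C"
    "\<And>z. z \<in> K \<Longrightarrow> (\<integral>\<^sup>+l. ennreal (indicator {L..} l * (l powr (- 2 * a - 1) * pos_powr (a - 1) (msq l z))) \<partial>lborel)
        \<le> ennreal (C * inverse ((fst z)\<^sup>2))"
proof -
  obtain C0 where C0: "C0 > 0" "\<And>z. norm (snd z) \<le> \<sigma> * fst z \<Longrightarrow> fst z > 0 \<Longrightarrow>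
    (\<integral>\<^sup>+l. ennreal (pos_powr (a - 1) (msq l z)) \<partial>lborel) \<le> ennreal (C0 * fst z powr (2 * a - 1))"
    using nn_integral_msq_vertex[OF a] by blast
  have lpow: "l powr (- 2 * a - 1) \<le> (c1 * fst z) powr (- 2 * a - 1)"
    if z: "z \<in> K" and l: "l \<ge> L" and v: "msq l z > 0" for l z
  proof -
    have "l > 0" using l L by linarith
    from support[OF in_cone(1)[OF z] this v] show ?thesis using a c12 by (intro powr_mono2') auto
  qed
  define C3 where "C3 = c2 * (c1 powr (- 2 * a - 1) * ((1 + c2)\<^sup>2) powr a)"
  define C4 where "C4 = c1 powr (- 2 * a - 1) * C0"
  have C34: "C3 > 0" "C4 > 0" using c12 C0 by (auto simp: C3_def C4_def)
  have A: "(\<integral>\<^sup>+l. ennreal (indicator {L..} l * (l powr (- 2 * a - 1) * pos_powr a (msq l z))) \<partial>lborel) \<le> ennreal C3"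
    if z: "z \<in> K" for z
  proof -
    have t: "fst z > 0" using in_cone(2)[OF z] by linarith
    let ?c = "(c1 * fst z) powr (- 2 * a - 1) * ((1 + c2)\<^sup>2 * (fst z)\<^sup>2) powr a"
    have "(\<integral>\<^sup>+l. ennreal (indicator {L..} l * (l powr (- 2 * a - 1) * pos_powr a (msq l z))) \<partial>lborel)
       \<le> (\<integral>\<^sup>+l. ennreal ?c * indicator {0..c2 * fst z} l \<partial>lborel)"
    proof (rule nn_integral_mono)
      fix l
      show "ennreal (indicator {L..} l * (l powr (- 2 * a - 1) * pos_powr a (msq l z))) \<le> ennreal ?c * indicator {0..c2 * fst z} l"
      proof (cases "L \<le> l \<and> msq l z > 0")
        case True
        then have l: "l > 0" using L by linarith
        have "pos_powr a (msq l z) \<le> ((1 + c2)\<^sup>2 * (fst z)\<^sup>2) powr a"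
          unfolding pos_powr_def using support(5)[OF in_cone(1)[OF z] l] True a by (intro powr_mono2) auto
        then have "l powr (- 2 * a - 1) * pos_powr a (msq l z) \<le> ?c"
          using lpow[OF z] True by (intro mult_mono) auto
        then show ?thesis using True support(2)[OF in_cone(1)[OF z] l] l by (simp add: ennreal_leI)
      next
        case False
        then have 0: "indicator {L..} l * (l powr (- 2 * a - 1) * pos_powr a (msq l z)) = (0::real)"
          by (auto simp: indicator_def)
        show ?thesis unfolding 0 by simp
      qed
    qed
    also have "\<dots> = ennreal ?c * ennreal (c2 * fst z)"
      using c12 t by (subst nn_integral_cmult_indicator) auto
    also have "\<dots> = ennreal C3"
    proof -
      have "?c * (c2 * fst z) = C3 * (fst z powr (- 2 * a - 1) * (fst z)\<^sup>2 powr a * fst z)"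
        using c12 t by (simp add: C3_def powr_mult)
      also have "(fst z)\<^sup>2 powr a = fst z powr (2 * a)" using t by (simp add: powr_powr flip: powr_numeral)
      also have "fst z powr (- 2 * a - 1) * fst z powr (2 * a) * fst z = fst z powr (- 2 * a - 1) * fst z powr (2 * a) * fst z powr 1"
        using t by simp
      also have "\<dots> = 1" unfolding powr_add[symmetric] using t by simp
      finally show ?thesis using c12 t by (simp flip: ennreal_mult)
    qed
    finally show ?thesis .
  qed
  have B: "(\<integral>\<^sup>+l. ennreal (indicator {L..} l * (l powr (- 2 * a - 1) * pos_powr (a - 1) (msq l z))) \<partial>lborel)
      \<le> ennreal (C4 * inverse ((fst z)\<^sup>2))" if z: "z \<in> K" for z
  proof -
    have t: "fst z > 0" using in_cone(2)[OF z] by linarith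
    have [measurable]: "(\<lambda>l. msq l z) \<in> borel_measurable borel" unfolding msq_eq by measurable
    have "(\<integral>\<^sup>+l. ennreal (indicator {L..} l * (l powr (- 2 * a - 1) * pos_powr (a - 1) (msq l z))) \<partial>lborel)
       \<le> (\<integral>\<^sup>+l. ennreal ((c1 * fst z) powr (- 2 * a - 1)) * ennreal (pos_powr (a - 1) (msq l z)) \<partial>lborel)"
    proof (rule nn_integral_mono)
      fix l
      show "ennreal (indicator {L..} l * (l powr (- 2 * a - 1) * pos_powr (a - 1) (msq l z)))
          \<le> ennreal ((c1 * fst z) powr (- 2 * a - 1)) * ennreal (pos_powr (a - 1) (msq l z))"
      proof (cases "L \<le> l \<and> msq l z > 0")
        case True
        then show ?thesis using mult_right_mono[OF lpow[OF z], of l "pos_powr (a - 1) (msq l z)"]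
          by (simp add: ennreal_leI flip: ennreal_mult)
      next
        case False
        then have 0: "indicator {L..} l * (l powr (- 2 * a - 1) * pos_powr (a - 1) (msq l z)) = (0::real)"
          by (auto simp: indicator_def)
        show ?thesis unfolding 0 by simp
      qed
    qed
    also have "\<dots> = ennreal ((c1 * fst z) powr (- 2 * a - 1)) * (\<integral>\<^sup>+l. ennreal (pos_powr (a - 1) (msq l z)) \<partial>lborel)"
      by (rule nn_integral_cmult) simp
    also have "\<dots> \<le> ennreal ((c1 * fst z) powr (- 2 * a - 1)) * ennreal (C0 * fst z powr (2 * a - 1))"
      by (intro mult_left_mono C0(2) in_cone(1)[OF z] t) simp
    also have "\<dots> = ennreal (C4 * inverse ((fst z)\<^sup>2))"
    proof -
      have "(c1 * fst z) powr (- 2 * a - 1) * (C0 * fst z powr (2 * a - 1)) = C4 * (fst z powr (- 2 * a - 1) * fst z powr (2 * a - 1))"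
        using c12 t by (simp add: C4_def powr_mult)
      also have "fst z powr (- 2 * a - 1) * fst z powr (2 * a - 1) = inverse ((fst z)\<^sup>2)"
        using t by (simp add: powr_minus flip: powr_add)
      finally show ?thesis using C0 by (simp flip: ennreal_mult)
    qed
    finally show ?thesis .
  qed
  show ?thesis
  proof (rule that[of "C3 + C4"])
    show "C3 + C4 > 0" using C34 by simp
    fix z assume z: "z \<in> K"
    show "(\<integral>\<^sup>+l. ennreal (indicator {L..} l * (l powr (- 2 * a - 1) * pos_powr a (msq l z))) \<partial>lborel) \<le> ennreal (C3 + C4)"
      using A[OF z] by (rule order_trans) (use C34 in \<open>intro ennreal_leI; simp\<close>)
    show "(\<integral>\<^sup>+l. ennreal (indicator {L..} l * (l powr (- 2 * a - 1) * pos_powr (a - 1) (msq l z))) \<partial>lborel)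
        \<le> ennreal ((C3 + C4) * inverse ((fst z)\<^sup>2))"
      using B[OF z] by (rule order_trans) (use C34 in \<open>intro ennreal_leI mult_right_mono; simp\<close>)
  qed
qed


lemma borel_measurable_msq_pair:
  "(\<lambda>y. msq (fst y) (snd y)) \<in> borel_measurable borel"
  "(\<lambda>y. msq (fst y) (norm (snd y) / \<sigma>, snd y)) \<in> borel_measurable borel"
  unfolding msq_eq using \<sigma> by (intro borel_measurable_continuous_onI continuous_intros; simp)+

text \<open>Twice the quantity in \<open>gap\<close> is 4 - (n - 1) (p - 1) - 2 a (p - 1) with n =
  \<open>DIM('b)\<close>, and a (p - 1) is nonnegative.\<close>

lemma subcritical: "(real DIM('b) - 1) * (p - 1) < 4"
proof -
  have "a * (p - 1) \<ge> 0" using a p by simp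
  then have pos: "0 < 2 * (real DIM('b) + 1 + 2 * a - c * (p + 1)) + 2 * (a * (p - 1))"
    using gap by (intro add_pos_nonneg) auto
  have "4 - (real DIM('b) - 1) * (p - 1) = 2 * (real DIM('b) + 1 + 2 * a - c * (p + 1)) + 2 * (a * (p - 1))"
    unfolding c by (simp add: field_simps)
  with pos have "0 < 4 - (real DIM('b) - 1) * (p - 1)" by (simp only:)
  then show ?thesis by (simp only: diff_gt_0_iff_gt)
qed

text \<open>This is how the energy controls t^(-2) \<phi>^2 on the lateral boundary. For p > 1,
  either |u|^(p - 1) >= t^(-2), and the first term on the right suffices, or |u| < t^(-2 / (p - 1)),
  and the left side is below t^(-2 - 4 / (p - 1)). By \<open>subcritical\<close> this exponent is
  large enough for integrability over space. For p = 1 the bound t >= 1 is enough.\<close>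

lemma lower_order_bound:
  obtains q where "q > real DIM('b)" "\<And>t u. t \<ge> 1 \<Longrightarrow> u\<^sup>2 * inverse (t\<^sup>2) \<le> \<bar>u\<bar> powr (p + 1) + t powr (- q)"
proof (cases "p = 1")
  case True
  show ?thesis
  proof (rule that[of "real DIM('b) + 1"])
    fix t u :: real assume "t \<ge> 1"
    then have "u\<^sup>2 * inverse (t\<^sup>2) \<le> u\<^sup>2 * 1" by (intro mult_left_mono) (auto simp: inverse_le_1_iff)
    also have "u\<^sup>2 * 1 = \<bar>u\<bar> powr (p + 1)" using True by (cases "u = 0") simp_all
    finally show "u\<^sup>2 * inverse (t\<^sup>2) \<le> \<bar>u\<bar> powr (p + 1) + t powr (- (real DIM('b) + 1))"
      by (simp add: add_increasing2)
  qed simp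
next
  case False
  then have p1: "p > 1" using p by simp
  show ?thesis
  proof (rule that[of "2 + 4 / (p - 1)"])
    show "real DIM('b) < 2 + 4 / (p - 1)" using subcritical p1 by (simp add: field_simps)
    fix t u :: real assume t: "t \<ge> 1"
    have t2: "inverse (t\<^sup>2) = t powr (- 2)" using t by (simp add: powr_minus)
    show "u\<^sup>2 * inverse (t\<^sup>2) \<le> \<bar>u\<bar> powr (p + 1) + t powr (- (2 + 4 / (p - 1)))"
    proof (cases "t powr (- 2 / (p - 1)) \<le> \<bar>u\<bar>")
      case True
      have "t powr (- 2 / (p - 1)) > 0" using t by simp
      then have u: "\<bar>u\<bar> > 0" using True by linarith
      have "(t powr (- 2 / (p - 1))) powr (p - 1) \<le> \<bar>u\<bar> powr (p - 1)"
        using True p1 by (intro powr_mono2) auto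
      moreover have "- 2 / (p - 1) * (p - 1) = - 2" using p1 by (intro nonzero_eq_divide_eq[THEN iffD1]) auto
      ultimately have "t powr (- 2) \<le> \<bar>u\<bar> powr (p - 1)" unfolding powr_powr by simp
      then have "u\<^sup>2 * inverse (t\<^sup>2) \<le> \<bar>u\<bar> powr 2 * \<bar>u\<bar> powr (p - 1)"
        unfolding t2 using u by (intro mult_mono) auto
      also have "\<dots> = \<bar>u\<bar> powr (p + 1)" unfolding powr_add[symmetric] by (simp add: add.commute)
      finally show ?thesis by (simp add: add_increasing2)
    next
      case False
      have "u\<^sup>2 = \<bar>u\<bar>\<^sup>2" by simp
      also have "\<dots> \<le> (t powr (- 2 / (p - 1)))\<^sup>2" using False by (intro power_mono) auto
      also have "\<dots> = t powr (- 4 / (p - 1))" using t by (simp add: powr_power)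
      finally have "u\<^sup>2 * inverse (t\<^sup>2) \<le> t powr (- 4 / (p - 1)) * t powr (- 2)"
        unfolding t2 by (intro mult_right_mono) auto
      also have "\<dots> = t powr (- (2 + 4 / (p - 1)))"
        unfolding powr_add[symmetric] by (rule arg_cong) simp
      finally show ?thesis by (simp add: add_increasing)
    qed
  qed
qed

text \<open>\<open>vertex_estimate\<close> is multiplied by l^(-2a - 2) and integrated over l >= L.
  Tonelli moves the integral over \<open>l\<close> inside on both sides, where
  \<open>vertex_average_lower\<close> and \<open>vertex_average_upper\<close> evaluate it. The part
  of the cone with t < L is bounded, and there continuity suffices.\<close>

theorem weighted_potential_finite:
  assumes fin: "(\<integral>\<^sup>+x. ennreal (lateral energy x) \<partial>lborel) < \<infinity>"
  shows "(\<integral>\<^sup>+z. ennreal (indicator \<Omega> z * (inverse (fst z) * \<bar>\<phi> z\<bar> powr (p + 1))) \<partial>lborel) < \<infinity>"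
proof -
  obtain C L where C: "C > 0" and L: "L > 0" and vertex: "\<And>l. L \<le> l \<Longrightarrow>
    (\<integral>\<^sup>+z. ennreal (indicator \<Omega> z * (pos_powr a (msq l z) * \<bar>\<phi> z\<bar> powr (p + 1))) \<partial>lborel)
    \<le> (\<integral>\<^sup>+x. ennreal (C * l * lateral (flux_density l) x) \<partial>lborel)"
    using vertex_estimate by blast
  obtain C5 where C5: "C5 > 0" "\<And>z. z \<in> K \<Longrightarrow> L \<le> fst z \<Longrightarrow>
    ennreal (C5 * inverse (fst z)) \<le> (\<integral>\<^sup>+l. ennreal (indicator {L..} l * (l powr (- 2 * a - 2) * pos_powr a (msq l z))) \<partial>lborel)"
    using vertex_average_lower[OF L] by blast
  obtain C6 where C6: "C6 > 0"
    "\<And>z. z \<in> K \<Longrightarrow> (\<integral>\<^sup>+l. ennreal (indicator {L..} l * (l powr (- 2 * a - 1) * pos_powr a (msq l z))) \<partial>lborel) \<le> ennreal C6"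
    "\<And>z. z \<in> K \<Longrightarrow> (\<integral>\<^sup>+l. ennreal (indicator {L..} l * (l powr (- 2 * a - 1) * pos_powr (a - 1) (msq l z))) \<partial>lborel)
        \<le> ennreal (C6 * inverse ((fst z)\<^sup>2))"
    using vertex_average_upper[OF L] by blast
  obtain q where q: "q > real DIM('b)" "\<And>t u. t \<ge> 1 \<Longrightarrow> u\<^sup>2 * inverse (t\<^sup>2) \<le> \<bar>u\<bar> powr (p + 1) + t powr (- q)"
    using lower_order_bound by blast
  note [measurable] = borel_measurable_msq_pair
  have [measurable]: "fst \<in> borel_measurable (borel :: (real \<times> 'c::euclidean_space) measure)"
    "snd \<in> borel_measurable (borel :: (real \<times> 'c::euclidean_space) measure)"
    by (intro borel_measurable_continuous_onI continuous_intros)+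
  have [measurable]: "\<Omega> \<in> sets borel" using open_open_late_cone[OF \<sigma>] by (rule borel_open)
  have lat: "(norm x / \<sigma>, x) \<in> K" if "norm x > \<sigma>" for x
    using that \<sigma> by (simp add: late_cone_iff[OF \<sigma>] field_simps)
  \<comment> \<open>\<phi> is constrained only on the late cone; the cutoff by
    \<open>\<Omega>\<close> makes the integrand Borel on all of spacetime.\<close>
  define g where "g z = indicator \<Omega> z * \<bar>\<phi> z\<bar> powr (p + 1)" for z
  have g0: "g z \<ge> 0" for z by (simp add: g_def)
  have [measurable]: "g \<in> borel_measurable borel"
    using borel_measurable_continuous_on_indicator[OF _ continuous_on_subset[OF cont_data(6) open_late_cone_subset[OF \<sigma>]]]
    by (simp add: g_def[abs_def])
  define w where "w b l = indicator {L..} l * l powr b" for b l :: real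
  have w0: "w b l \<ge> 0" for b l by (simp add: w_def)
  have [measurable]: "w b \<in> borel_measurable borel" for b unfolding w_def by measurable
  have [measurable]: "(\<lambda>l. msq l z) \<in> borel_measurable borel" "msq l \<in> borel_measurable borel"
    "(\<lambda>x. msq l (norm x / \<sigma>, x)) \<in> borel_measurable borel" for z l
    unfolding msq_eq[abs_def] by measurable
  \<comment> \<open>Inside this proof \<open>late\<close> means t >= L and shadows the constant of
    the same name, which means t > 1.\<close>
  define late where "late = {z :: real \<times> 'b. L \<le> fst z}"
  have "closed late" unfolding late_def by (intro closed_Collect_le continuous_intros)
  then have [measurable]: "late \<in> sets borel" by (rule borel_closed)
  have late_part: "(\<integral>\<^sup>+z. ennreal (indicator late z * (inverse (fst z) * g z)) \<partial>lborel) < \<infinity>"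
  proof -
    have "ennreal C5 * (\<integral>\<^sup>+z. ennreal (indicator late z * (inverse (fst z) * g z)) \<partial>lborel)
       = (\<integral>\<^sup>+z. ennreal C5 * ennreal (indicator late z * (inverse (fst z) * g z)) \<partial>lborel)"
      by (rule nn_integral_cmult[symmetric]) measurable
    also have "\<dots> \<le> (\<integral>\<^sup>+z. \<integral>\<^sup>+l. ennreal (w (- 2 * a - 2) l * pos_powr a (msq l z) * g z) \<partial>lborel \<partial>lborel)"
    proof (rule nn_integral_mono)
      fix z
      show "ennreal C5 * ennreal (indicator late z * (inverse (fst z) * g z))
        \<le> (\<integral>\<^sup>+l. ennreal (w (- 2 * a - 2) l * pos_powr a (msq l z) * g z) \<partial>lborel)"
      proof (cases "z \<in> \<Omega> \<and> z \<in> late")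
        case True
        then have z: "z \<in> K" "L \<le> fst z" using open_late_cone_subset[OF \<sigma>] by (auto simp: late_def)
        have "ennreal C5 * ennreal (indicator late z * (inverse (fst z) * g z)) = ennreal (C5 * inverse (fst z)) * ennreal (g z)"
          using True C5(1) in_cone(2)[OF z(1)] g0[of z] by (simp flip: ennreal_mult add: mult.assoc)
        also have "\<dots> \<le> (\<integral>\<^sup>+l. ennreal (w (- 2 * a - 2) l * pos_powr a (msq l z)) \<partial>lborel) * ennreal (g z)"
          using C5(2)[OF z] by (intro mult_right_mono) (simp_all add: w_def mult.assoc)
        also have "\<dots> = (\<integral>\<^sup>+l. ennreal (w (- 2 * a - 2) l * pos_powr a (msq l z)) * ennreal (g z) \<partial>lborel)"
          by (rule nn_integral_multc[symmetric]) measurable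
        also have "\<dots> = (\<integral>\<^sup>+l. ennreal (w (- 2 * a - 2) l * pos_powr a (msq l z) * g z) \<partial>lborel)"
          using w0 g0 by (simp flip: ennreal_mult)
        finally show ?thesis .
      qed (auto simp: g_def)
    qed
    also have "\<dots> = (\<integral>\<^sup>+l. \<integral>\<^sup>+z. ennreal (w (- 2 * a - 2) l * pos_powr a (msq l z) * g z) \<partial>lborel \<partial>lborel)"
      using nn_integral_lborel_fst_snd[of "\<lambda>y. ennreal (w (- 2 * a - 2) (fst y) * pos_powr a (msq (fst y) (snd y)) * g (snd y))"]
      by simp
    also have "\<dots> \<le> (\<integral>\<^sup>+l. \<integral>\<^sup>+x. ennreal (C * (w (- 2 * a - 1) l * lateral (flux_density l) x)) \<partial>lborel \<partial>lborel)"
    proof (rule nn_integral_mono)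
      fix l
      show "(\<integral>\<^sup>+z. ennreal (w (- 2 * a - 2) l * pos_powr a (msq l z) * g z) \<partial>lborel)
        \<le> (\<integral>\<^sup>+x. ennreal (C * (w (- 2 * a - 1) l * lateral (flux_density l) x)) \<partial>lborel)"
      proof (cases "L \<le> l")
        case True
        then have l: "l > 0" using L by linarith
        have wl: "w (- 2 * a - 2) l * l = w (- 2 * a - 1) l"
        proof -
          have "- 2 * a - 1 = (- 2 * a - 2) + 1" by simp
          then have "l powr (- 2 * a - 1) = l powr ((- 2 * a - 2) + 1)" by (simp only:)
          also have "\<dots> = l powr (- 2 * a - 2) * l" unfolding powr_add using l by simp
          finally show ?thesis using True by (simp add: w_def)
        qed
        have "(\<integral>\<^sup>+z. ennreal (w (- 2 * a - 2) l * pos_powr a (msq l z) * g z) \<partial>lborel)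
          = (\<integral>\<^sup>+z. ennreal (w (- 2 * a - 2) l) * ennreal (pos_powr a (msq l z) * g z) \<partial>lborel)"
          using w0 g0 by (simp add: mult.assoc flip: ennreal_mult)
        also have "\<dots> = ennreal (w (- 2 * a - 2) l) * (\<integral>\<^sup>+z. ennreal (pos_powr a (msq l z) * g z) \<partial>lborel)"
          by (rule nn_integral_cmult) measurable
        also have "\<dots> \<le> ennreal (w (- 2 * a - 2) l) * (\<integral>\<^sup>+x. ennreal (C * l * lateral (flux_density l) x) \<partial>lborel)"
          using vertex[OF True] by (intro mult_left_mono) (simp_all add: g_def mult_ac)
        also have "\<dots> = (\<integral>\<^sup>+x. ennreal (w (- 2 * a - 2) l) * ennreal (C * l * lateral (flux_density l) x) \<partial>lborel)"
          unfolding lateral_flux_density by (rule nn_integral_cmult[symmetric]) measurable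
        also have "\<dots> = (\<integral>\<^sup>+x. ennreal (C * ((w (- 2 * a - 2) l * l) * lateral (flux_density l) x)) \<partial>lborel)"
          using w0[of "- 2 * a - 2" l] C l lateral_nonneg(3) by (simp add: mult_ac flip: ennreal_mult)
        finally show ?thesis unfolding wl .
      qed (simp add: w_def)
    qed
    also have "\<dots> = (\<integral>\<^sup>+x. \<integral>\<^sup>+l. ennreal (C * (w (- 2 * a - 1) l * lateral (flux_density l) x)) \<partial>lborel \<partial>lborel)"
      unfolding lateral_flux_density
      using nn_integral_lborel_fst_snd[of "\<lambda>y. ennreal (C * (w (- 2 * a - 1) (fst y) *
        (pos_powr a (msq (fst y) (norm (snd y) / \<sigma>, snd y)) * lateral energy (snd y)
        + pos_powr (a - 1) (msq (fst y) (norm (snd y) / \<sigma>, snd y)) * lateral (\<lambda>z. (\<phi> z)\<^sup>2) (snd y))))"]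
      by simp
    \<comment> \<open>The energy appears twice, once from the term with \<open>pos_powr a\<close>
      and once from \<open>lower_order_bound\<close>, which is applied to the term with
      \<open>(\<phi> z)\<^sup>2\<close>.\<close>
    also have "\<dots> \<le> (\<integral>\<^sup>+x. ennreal (C * C6) * (2 * ennreal (lateral energy x)
        + ennreal (indicator {x. norm x > \<sigma>} x * (norm x / \<sigma>) powr (- q))) \<partial>lborel)"
    proof (rule nn_integral_mono)
      fix x
      show "(\<integral>\<^sup>+l. ennreal (C * (w (- 2 * a - 1) l * lateral (flux_density l) x)) \<partial>lborel)
        \<le> ennreal (C * C6) * (2 * ennreal (lateral energy x) + ennreal (indicator {x. norm x > \<sigma>} x * (norm x / \<sigma>) powr (- q)))"
      proof (cases "norm x > \<sigma>")
        case True
        define z where "z = (norm x / \<sigma>, x)"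
        have z: "z \<in> K" using lat[OF True] by (simp add: z_def)
        define E where "E = lateral energy x"
        define F where "F = lateral (\<lambda>z. (\<phi> z)\<^sup>2) x"
        have EF: "E \<ge> 0" "F \<ge> 0" using lateral_nonneg by (auto simp: E_def F_def)
        have "(\<integral>\<^sup>+l. ennreal (C * (w (- 2 * a - 1) l * lateral (flux_density l) x)) \<partial>lborel)
          = (\<integral>\<^sup>+l. ennreal (C * E) * ennreal (w (- 2 * a - 1) l * pos_powr a (msq l z))
              + ennreal (C * F) * ennreal (w (- 2 * a - 1) l * pos_powr (a - 1) (msq l z)) \<partial>lborel)"
          using C w0 EF unfolding lateral_flux_density z_def[symmetric] E_def[symmetric] F_def[symmetric]
          by (intro nn_integral_cong) (simp add: algebra_simps flip: ennreal_mult ennreal_plus)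
        also have "\<dots> = ennreal (C * E) * (\<integral>\<^sup>+l. ennreal (w (- 2 * a - 1) l * pos_powr a (msq l z)) \<partial>lborel)
          + ennreal (C * F) * (\<integral>\<^sup>+l. ennreal (w (- 2 * a - 1) l * pos_powr (a - 1) (msq l z)) \<partial>lborel)"
          by (subst nn_integral_add, measurable, subst (1 2) nn_integral_cmult, measurable)
        also have "\<dots> \<le> ennreal (C * E) * ennreal C6 + ennreal (C * F) * ennreal (C6 * inverse ((fst z)\<^sup>2))"
          using C6(2,3)[OF z] by (intro add_mono mult_left_mono) (simp_all add: w_def mult.assoc)
        also have "\<dots> = ennreal (C * C6) * (ennreal E + ennreal (F * inverse ((fst z)\<^sup>2)))"
          using C C6(1) EF by (simp add: algebra_simps flip: ennreal_mult ennreal_plus)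
        also have "\<dots> \<le> ennreal (C * C6) * (ennreal E + ennreal (E + (norm x / \<sigma>) powr (- q)))"
        proof (intro mult_left_mono add_left_mono ennreal_leI)
          have "(\<phi> z)\<^sup>2 * inverse ((fst z)\<^sup>2) \<le> \<bar>\<phi> z\<bar> powr (p + 1) + fst z powr (- q)"
            by (rule q(2)[OF in_cone(2)[OF z]])
          then show "F * inverse ((fst z)\<^sup>2) \<le> E + (norm x / \<sigma>) powr (- q)"
            using True by (simp add: E_def F_def lateral_def energy_def z_def add.assoc add_increasing)
        qed simp
        also have "\<dots> = ennreal (C * C6) * (2 * ennreal (lateral energy x) + ennreal (indicator {x. norm x > \<sigma>} x * (norm x / \<sigma>) powr (- q)))"
          using EF True by (simp add: E_def[symmetric] ennreal_plus mult_2 add.assoc)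
        finally show ?thesis .
      qed (simp add: lateral_def)
    qed
    also have "\<dots> = ennreal (C * C6) * (2 * (\<integral>\<^sup>+x. ennreal (lateral energy x) \<partial>lborel)
        + (\<integral>\<^sup>+x. ennreal (indicator {x. norm x > \<sigma>} x * (norm x / \<sigma>) powr (- q)) \<partial>(lborel :: 'b measure)))"
    proof -
      have "open {x::'b. norm x > \<sigma>}" by (intro open_Collect_less continuous_intros)
      then have [measurable]: "{x::'b. norm x > \<sigma>} \<in> sets borel" by (rule borel_open)
      show ?thesis by (subst nn_integral_cmult, measurable, subst nn_integral_add, measurable, subst nn_integral_cmult, measurable)
    qed
    also have "\<dots> < \<infinity>"
    proof -
      have "(\<integral>\<^sup>+x. ennreal (indicator {x. norm x > \<sigma>} x * (norm x / \<sigma>) powr (- q)) \<partial>(lborel :: 'b measure))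
        = (\<integral>\<^sup>+x. ennreal (\<sigma> powr q) * ennreal (indicator {x. norm x > \<sigma>} x * norm x powr (- q)) \<partial>(lborel :: 'b measure))"
        using \<sigma> by (intro nn_integral_cong) (simp add: powr_divide powr_minus field_simps flip: ennreal_mult)
      also have "\<dots> = ennreal (\<sigma> powr q) * (\<integral>\<^sup>+x. ennreal (indicator {x. norm x > \<sigma>} x * norm x powr (- q)) \<partial>(lborel :: 'b measure))"
        by (rule nn_integral_cmult) measurable
      also have "\<dots> < \<infinity>"
        using nn_integral_norm_powr_tail_finite[where 'b = 'b, OF \<sigma> q(1)] by (simp add: ennreal_mult_less_top)
      finally have "(\<integral>\<^sup>+x. ennreal (indicator {x. norm x > \<sigma>} x * (norm x / \<sigma>) powr (- q)) \<partial>(lborel :: 'b measure)) < \<infinity>" .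
      with fin show ?thesis by (simp add: ennreal_mult_less_top)
    qed
    finally show ?thesis using C5(1) by (auto simp: ennreal_mult_less_top)
  qed
  have early_part: "(\<integral>\<^sup>+z. ennreal (indicator (- late) z * (inverse (fst z) * g z)) \<partial>lborel) < \<infinity>"
  proof -
    \<comment> \<open>In the cone |z| <= t + |x| <= (1 + \<sigma>) t, so t < L confines
      \<open>z\<close> to this ball.\<close>
    define B where "B = K \<inter> cball 0 ((1 + \<sigma>) * L)"
    have B: "compact B" unfolding B_def
      by (rule closed_Int_compact[OF closed_late_cone[OF \<sigma>] compact_cball])
    have ne: "fst z \<noteq> 0" if "z \<in> B" for z using in_cone(2)[of z] that by (auto simp: B_def)
    have int: "integrable lborel (\<lambda>z. indicator B z *\<^sub>R (inverse (fst z) * \<bar>\<phi> z\<bar> powr (p + 1)))"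
      using ne by (intro borel_integrable_compact B continuous_intros continuous_on_subset[OF cont_data(6)])
        (auto simp: B_def)
    have "(\<integral>\<^sup>+z. ennreal (indicator (- late) z * (inverse (fst z) * g z)) \<partial>lborel)
      \<le> (\<integral>\<^sup>+z. ennreal (norm (indicator B z *\<^sub>R (inverse (fst z) * \<bar>\<phi> z\<bar> powr (p + 1)))) \<partial>lborel)"
    proof (intro nn_integral_mono ennreal_leI)
      fix z
      show "indicator (- late) z * (inverse (fst z) * g z) \<le> norm (indicator B z *\<^sub>R (inverse (fst z) * \<bar>\<phi> z\<bar> powr (p + 1)))"
      proof (cases "z \<in> \<Omega> \<and> z \<notin> late")
        case True
        then have z: "z \<in> K" "fst z < L" using open_late_cone_subset[OF \<sigma>] by (auto simp: late_def)
        have "norm z \<le> norm (fst z) + norm (snd z)" using norm_Pair_le[of "fst z" "snd z"] by simp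
        also have "\<dots> \<le> fst z + \<sigma> * fst z" using in_cone[OF z(1)] by simp
        also have "\<dots> = (1 + \<sigma>) * fst z" by (simp add: algebra_simps)
        also have "\<dots> \<le> (1 + \<sigma>) * L" using z(2) \<sigma> by (intro mult_left_mono) auto
        finally have "z \<in> B" using z(1) by (simp add: B_def)
        then show ?thesis using True by (simp add: g_def)
      qed (auto simp: g_def)
    qed
    also have "\<dots> < \<infinity>" using int by (simp add: integrable_iff_bounded)
    finally show ?thesis .
  qed
  have "(\<integral>\<^sup>+z. ennreal (indicator \<Omega> z * (inverse (fst z) * \<bar>\<phi> z\<bar> powr (p + 1))) \<partial>lborel)
    = (\<integral>\<^sup>+z. ennreal (indicator late z * (inverse (fst z) * g z)) + ennreal (indicator (- late) z * (inverse (fst z) * g z)) \<partial>lborel)"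
    by (intro nn_integral_cong) (auto simp: g_def indicator_def)
  also have "\<dots> = (\<integral>\<^sup>+z. ennreal (indicator late z * (inverse (fst z) * g z)) \<partial>lborel)
    + (\<integral>\<^sup>+z. ennreal (indicator (- late) z * (inverse (fst z) * g z)) \<partial>lborel)"
    by (rule nn_integral_add) measurable
  also have "\<dots> < \<infinity>" using late_part early_part by simp
  finally show ?thesis .
qed

end

section \<open>The theorem\<close>

text \<open>The Euclidean gradient, with derivatives taken within \<open>S\<close>; the Lorentzian
  signs enter only through \<open>reflect\<close>.\<close>

definition gradient :: "'a set \<Rightarrow> ('a::euclidean_space \<Rightarrow> real) \<Rightarrow> 'a \<Rightarrow> 'a" where
  "gradient S f z = (\<Sum>b\<in>Basis. dir_deriv S b f z *\<^sub>R b)"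

lemma gradient_inner_Basis: "b \<in> Basis \<Longrightarrow> gradient S f z \<bullet> b = dir_deriv S b f z"
  by (simp add: gradient_def)

lemma C1_on_gradient:
  assumes "C_k_on 1 S f"
  shows "C1_on S f (\<lambda>z h. gradient S f z \<bullet> h)"
  unfolding C1_on_def
proof (intro conjI ballI allI)
  fix z assume "z \<in> S"
  then have D: "(f has_derivative frechet_derivative f (at z within S)) (at z within S)"
    using assms by (simp add: differentiable_on_def frechet_derivative_works)
  have "frechet_derivative f (at z within S) h = gradient S f z \<bullet> h" for h
  proof -
    have li: "linear (frechet_derivative f (at z within S))" using D by (rule has_derivative_linear)
    have "frechet_derivative f (at z within S) h = frechet_derivative f (at z within S) (\<Sum>b\<in>Basis. (h \<bullet> b) *\<^sub>R b)"
      by (simp add: euclidean_representation)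
    also have "\<dots> = (\<Sum>b\<in>Basis. (h \<bullet> b) * frechet_derivative f (at z within S) b)"
      by (simp add: linear_sum[OF li] linear_scale[OF li])
    also have "\<dots> = gradient S f z \<bullet> h"
      by (simp add: gradient_def dir_deriv_def inner_sum_left mult.commute inner_commute[of h])
    finally show ?thesis .
  qed
  then have "frechet_derivative f (at z within S) = (\<lambda>h. gradient S f z \<bullet> h)" by (rule ext)
  with D show "(f has_derivative (\<lambda>h. gradient S f z \<bullet> h)) (at z within S)" by (simp only:)
next
  fix e
  have "continuous_on S (dir_deriv S b f)" if "b \<in> Basis" for b using assms that by simp
  then show "continuous_on S (\<lambda>z. gradient S f z \<bullet> e)"
    unfolding gradient_def by (intro continuous_intros) auto
qed

lemma C_k_on_1_of_2: "C_k_on 2 S f \<Longrightarrow> C_k_on 1 S f"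
  by (simp add: numeral_2_eq_2 differentiable_imp_continuous_on)

text \<open>The derivative appears as the Hessian whose row \<open>b\<close> is the gradient of
  \<open>dir_deriv S b f\<close>. Its symmetry is not visible in this form and is supplied by
  \<open>symmetric_second_derivative\<close>.\<close>

lemma C1_on_gradient_2:
  assumes "C_k_on 2 S f"
  shows "C1_on S (gradient S f) (\<lambda>z h. \<Sum>b\<in>Basis. (gradient S (dir_deriv S b f) z \<bullet> h) *\<^sub>R b)"
proof -
  have 1: "C1_on S (dir_deriv S b f) (\<lambda>z h. gradient S (dir_deriv S b f) z \<bullet> h)" if "b \<in> Basis" for b
    using assms that by (intro C1_on_gradient) (simp add: numeral_2_eq_2)
  show ?thesis
    unfolding C1_on_def gradient_def[of S f, abs_def]
  proof (intro conjI ballI allI)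
    fix z assume z: "z \<in> S"
    show "((\<lambda>z. \<Sum>b\<in>Basis. dir_deriv S b f z *\<^sub>R b) has_derivative
        (\<lambda>h. \<Sum>b\<in>Basis. (gradient S (dir_deriv S b f) z \<bullet> h) *\<^sub>R b)) (at z within S)"
      by (intro has_derivative_sum has_derivative_scaleR_left C1_onD(1)[OF 1 z])
  next
    fix e show "continuous_on S (\<lambda>z. \<Sum>b\<in>Basis. (gradient S (dir_deriv S b f) z \<bullet> e) *\<^sub>R b)"
      by (intro continuous_on_sum continuous_on_scaleR continuous_on_const C1_onD(2)[OF 1])
  qed
qed

lemma sum_Basis_spacetime:
  "(\<Sum>b\<in>(Basis :: ('n::finite) spacetime set). F b) = F (1, 0) + (\<Sum>i\<in>UNIV. F (0, axis i 1))"
proof -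
  have "(\<Sum>b\<in>(Basis :: 'n spacetime set). F b) = F (1, 0) + (\<Sum>v\<in>(Basis :: (real ^ 'n) set). F (0, v))"
    unfolding Basis_prod_def by (subst sum.union_disjoint) (auto simp: sum.reindex inj_on_def)
  also have "(Basis :: (real ^ 'n) set) = range (\<lambda>i. axis i 1)" by (auto simp: Basis_vec_def)
  also have "(\<Sum>v\<in>range (\<lambda>i. axis i 1). F (0, v)) = (\<Sum>i\<in>(UNIV :: 'n set). F (0, axis i 1))"
    by (subst sum.reindex) (auto simp: inj_on_def axis_eq_axis)
  finally show ?thesis .
qed

lemma spacetime_Basis: "(1, 0) \<in> (Basis :: ('n::finite) spacetime set)" "(0, axis i 1) \<in> (Basis :: 'n spacetime set)"
  by (auto simp: Basis_prod_def axis_in_Basis_iff)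

lemma grad_sq_eq: "grad_sq S f z = (norm (gradient S f z))\<^sup>2"
proof -
  have "(norm (gradient S f z))\<^sup>2 = (\<Sum>b\<in>Basis. (gradient S f z \<bullet> b) * (gradient S f z \<bullet> b))"
    unfolding power2_norm_eq_inner by (rule euclidean_inner)
  then show ?thesis
    by (simp add: grad_sq_def dt_def dx_def sum_Basis_spacetime gradient_inner_Basis spacetime_Basis power2_eq_square)
qed

text \<open>\<open>reflect\<close> flips the sign of the time diagonal entry of the Hessian and
  keeps the spatial ones.\<close>

lemma wave_op_eq:
  fixes f :: "('n::finite) spacetime \<Rightarrow> real"
  shows "wave_op S f z = lin_trace (\<lambda>h. reflect (\<Sum>b\<in>Basis. (gradient S (dir_deriv S b f) z \<bullet> h) *\<^sub>R b))"
proof -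
  define G where "G h = (\<Sum>b\<in>Basis. (gradient S (dir_deriv S b f) z \<bullet> h) *\<^sub>R b)" for h
  have G: "G h \<bullet> d = gradient S (dir_deriv S d f) z \<bullet> h" if "d \<in> Basis" for h d
    using that by (simp add: G_def)
  have r: "reflect (1, 0) = - (1, 0 :: real ^ 'n)" "reflect (0, axis i 1) = (0, axis i 1 :: real ^ 'n)" for i
    by (auto simp: reflect_def)
  have "lin_trace (\<lambda>h. reflect (G h)) = - (G (1, 0) \<bullet> (1, 0)) + (\<Sum>i\<in>UNIV. G (0, axis i 1) \<bullet> (0, axis i 1))"
    unfolding lin_trace_def sum_Basis_spacetime reflect_inner r inner_minus_right ..
  then show ?thesis
    unfolding G_def[symmetric] by (simp add: G spacetime_Basis gradient_inner_Basis wave_op_def dt_def dx_def)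
qed

lemma time_cone_late_eq: "0 < \<sigma> \<Longrightarrow> time_cone \<sigma> \<inter> late = open_late_cone \<sigma>"
  by (auto simp: time_cone_def late_def open_late_cone_iff)

lemma truncated_cone_eq:
  assumes "0 < \<sigma>"
  shows "truncated_cone \<sigma> = late_cone \<sigma>"
  unfolding truncated_cone_def time_cone_late_eq[OF assms]
  using closure_minimal[OF open_late_cone_subset[OF assms] closed_late_cone[OF assms]]
    late_cone_subset_closure[OF assms] by blast

text \<open>In the chart the density is constant away from the vertex by
  \<open>det_induced_metric_cone\<close>, and t > 1 on the boundary means
  \<open>norm x > \<sigma>\<close>.\<close>

lemma nn_integral_cone_boundary:
  fixes f :: "('n::finite) spacetime \<Rightarrow> real"
  assumes \<sigma>: "0 < \<sigma>" and f: "continuous_on (late_cone \<sigma>) f" and f0: "\<And>z. f z \<ge> 0"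
  shows "(\<integral>\<^sup>+z\<in>cone_boundary \<sigma> \<inter> late. ennreal (f z) \<partial>cone_boundary_measure \<sigma>)
    = ennreal (sqrt \<bar>1 - 1 / \<sigma>\<^sup>2\<bar>) * (\<integral>\<^sup>+x. ennreal (indicator {x. norm x > \<sigma>} x * f (norm x / \<sigma>, x)) \<partial>lborel)"
proof -
  let ?S = "cone_boundary \<sigma> \<inter> late :: 'n spacetime set"
  let ?\<Phi> = "\<lambda>x :: real ^ 'n. (norm x / \<sigma>, x)"
  let ?d = "\<lambda>x. ennreal (sqrt \<bar>det (induced_metric ?\<Phi> x)\<bar>)"
  let ?c = "ennreal (sqrt \<bar>1 - 1 / \<sigma>\<^sup>2\<bar>)"
  have "closed (cone_boundary \<sigma> :: 'n spacetime set)" "open (late :: 'n spacetime set)"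
    unfolding cone_boundary_def late_def case_prod_beta
    by (intro closed_Collect_eq open_Collect_less continuous_intros)+
  then have S: "?S \<in> sets borel" by (auto intro: borel_closed borel_open)
  have SK: "?S \<subseteq> late_cone \<sigma>" by (auto simp: cone_boundary_def late_def late_cone_iff[OF \<sigma>])
  have "(\<lambda>z. indicator ?S z *\<^sub>R f z) \<in> borel_measurable borel"
    by (intro borel_measurable_continuous_on_indicator S continuous_on_subset[OF f SK])
  then have "(\<lambda>z. ennreal (indicator ?S z *\<^sub>R f z)) \<in> borel_measurable borel" by measurable
  also have "(\<lambda>z. ennreal (indicator ?S z *\<^sub>R f z)) = (\<lambda>z. ennreal (f z) * indicator ?S z)"
    by (auto simp: indicator_def)
  finally have fm: "(\<lambda>z. ennreal (f z) * indicator ?S z) \<in> borel_measurable borel" .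
  have \<Phi>[measurable]: "?\<Phi> \<in> borel_measurable borel"
    unfolding borel_prod[symmetric] by measurable
  \<comment> \<open>At x = 0 the chart is not differentiable and \<open>frechet_derivative\<close>
    is unspecified, so for measurability this single point is treated separately.\<close>
  have "?d = (\<lambda>x. if x \<in> {0} then ?d 0 else ?c)"
    using det_induced_metric_cone[where 'n = 'n] \<sigma> by (auto simp: fun_eq_iff)
  also have "\<dots> \<in> borel_measurable borel" by (intro measurable_If_set) auto
  finally have d: "?d \<in> borel_measurable borel" .
  have "(\<integral>\<^sup>+z\<in>?S. ennreal (f z) \<partial>cone_boundary_measure \<sigma>)
    = (\<integral>\<^sup>+x. ennreal (f (?\<Phi> x)) * indicator ?S (?\<Phi> x) \<partial>density lborel ?d)"
    unfolding cone_boundary_measure_def hypersurface_measure_def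
    by (rule nn_integral_distr) (use fm in simp_all)
  also have "\<dots> = (\<integral>\<^sup>+x. ?d x * (ennreal (f (?\<Phi> x)) * indicator ?S (?\<Phi> x)) \<partial>lborel)"
    using d measurable_compose[OF \<Phi> fm] by (intro nn_integral_density) simp_all
  also have "\<dots> = (\<integral>\<^sup>+x. ?c * ennreal (indicator {x. norm x > \<sigma>} x *\<^sub>R f (?\<Phi> x)) \<partial>lborel)"
  proof (rule nn_integral_cong)
    fix x :: "real ^ 'n"
    show "?d x * (ennreal (f (?\<Phi> x)) * indicator ?S (?\<Phi> x)) = ?c * ennreal (indicator {x. norm x > \<sigma>} x *\<^sub>R f (?\<Phi> x))"
    proof (cases "norm x > \<sigma>")
      case True
      then have "x \<noteq> 0" "?\<Phi> x \<in> ?S" using \<sigma> by (auto simp: cone_boundary_def late_def)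
      then show ?thesis using True det_induced_metric_cone[of x \<sigma>] \<sigma> by simp
    next
      case False
      then have "?\<Phi> x \<notin> ?S" using \<sigma> by (auto simp: late_def)
      then show ?thesis using False by simp
    qed
  qed
  also have "\<dots> = ?c * (\<integral>\<^sup>+x. ennreal (indicator {x. norm x > \<sigma>} x *\<^sub>R f (?\<Phi> x)) \<partial>lborel)"
  proof (rule nn_integral_cmult)
    have "open {x :: real ^ 'n. norm x > \<sigma>}" by (intro open_Collect_less continuous_intros)
    moreover have "continuous_on {x :: real ^ 'n. norm x > \<sigma>} (\<lambda>x. f (?\<Phi> x))"
      using \<sigma> by (intro continuous_on_compose2[OF f] continuous_intros) (auto simp: late_cone_iff[OF \<sigma>] field_simps)
    ultimately have "(\<lambda>x. indicator {x. norm x > \<sigma>} x *\<^sub>R f (?\<Phi> x)) \<in> borel_measurable borel"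
      by (intro borel_measurable_continuous_on_indicator) (auto intro: borel_open)
    then show "(\<lambda>x. ennreal (indicator {x. norm x > \<sigma>} x *\<^sub>R f (?\<Phi> x))) \<in> borel_measurable lborel" by simp
  qed
  finally show ?thesis by simp
qed

text \<open>For n >= 3 the left side is below 4 n (n - 1) / (n^2 + n - 4), and n (n - 1) <= n^2 + n
  - 4 holds as soon as n >= 2. For n = 2 the bound is the claim, and for n = 1 the left side is
  0.\<close>

lemma exponent_bound_imp:
  assumes n: "n \<ge> 1" and p: "1 \<le> p" "ereal p < exponent_bound n"
  shows "(real n - 1) * (p - 1) < 4"
proof -
  consider "n = 1" | "n = 2" | "n \<ge> 3" using n by linarith
  then show ?thesis
  proof cases
    case 3
    define m where "m = real n"
    have m: "m \<ge> 3" using 3 by (simp add: m_def)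
    have "3 * 3 \<le> m * m" using m by (intro mult_mono) auto
    then have den: "m\<^sup>2 + m - 4 > 0" using m by (simp add: power2_eq_square)
    have "p - 1 < 4 * m / (m\<^sup>2 + m - 4)" using p(2) 3 by (simp add: exponent_bound_def m_def)
    then have "(m - 1) * (p - 1) < (m - 1) * (4 * m / (m\<^sup>2 + m - 4))" using m by (intro mult_strict_left_mono) auto
    also have "\<dots> \<le> 4" using den m by (simp add: field_simps power2_eq_square)
    finally show ?thesis by (simp add: m_def)
  qed (use p(2) in \<open>simp_all add: exponent_bound_def\<close>)
qed

theorem theorem1p7:
  fixes \<sigma> p :: real
    and V \<phi> :: "('n::finite) spacetime \<Rightarrow> real"
  assumes "0 < \<sigma>" and "\<sigma> < 1"
    and "1 \<le> p" and "ereal p < exponent_bound CARD('n)"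
    and "C_k_on 1 (truncated_cone \<sigma>) V"
    and "\<exists>C>1. \<forall>z\<in>truncated_cone \<sigma>. inverse C \<le> V z \<and> V z \<le> C"
    and "\<forall>\<epsilon>>0. \<exists>T. \<forall>(t, x)\<in>truncated_cone \<sigma>. t \<ge> T \<longrightarrow>
           sqrt (grad_sq (truncated_cone \<sigma>) V (t, x)) \<le> \<epsilon> * inverse t"
    and "C_k_on 2 (truncated_cone \<sigma>) \<phi>"
    and "\<forall>z\<in>truncated_cone \<sigma>.
           wave_op (truncated_cone \<sigma>) \<phi> z + V z * (\<bar>\<phi> z\<bar> powr (p - 1) * \<phi> z) = 0"
    and "(\<integral>\<^sup>+z\<in>cone_boundary \<sigma> \<inter> late.
           ennreal (grad_sq (truncated_cone \<sigma>) \<phi> z + \<bar>\<phi> z\<bar> powr (p + 1))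
           \<partial>cone_boundary_measure \<sigma>) < \<infinity>"
  shows "(\<integral>\<^sup>+z\<in>time_cone \<sigma> \<inter> late.
           ennreal (inverse (fst z) * \<bar>\<phi> z\<bar> powr (p + 1)) \<partial>lborel) < \<infinity>"
proof -
  note \<sigma> = assms(1,2) and p = assms(3)
  note asm = assms(5-10)[unfolded truncated_cone_eq[OF \<sigma>(1)]]
  obtain CV where CV: "CV > 1" "\<And>z. z \<in> late_cone \<sigma> \<Longrightarrow> inverse CV \<le> V z \<and> V z \<le> CV"
    using asm(2) by blast
  define n where "n = real CARD('n)"
  \<comment> \<open>The value of the \<open>gap\<close> quantity at a = 0; a positive
    \<open>a\<close> lowers it by a (p - 1).\<close>
  define \<delta> where "\<delta> = n + 1 - (n - 1) * (p + 1) / 2"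
  have "(n - 1) * (p - 1) < 4"
    using exponent_bound_imp[of "CARD('n)" p] assms(3,4) by (simp add: n_def Suc_leI)
  moreover have "2 * \<delta> = 4 - (n - 1) * (p - 1)" by (simp add: \<delta>_def field_simps)
  ultimately have \<delta>: "\<delta> > 0" by simp
  \<comment> \<open>This gives a (p - 1) <= a p <= \<delta> / 2, so half of \<delta>
    survives.\<close>
  define a where "a = min 1 (\<delta> / (2 * p))"
  have a: "0 < a" "a \<le> 1" using \<delta> p by (auto simp: a_def)
  define c where "c = (n - 1) / 2 + a"
  have "a * (p - 1) < \<delta>"
  proof -
    have "a * (p - 1) \<le> a * p" using a by (intro mult_left_mono) auto
    also have "a * p \<le> \<delta> / (2 * p) * p" using p by (intro mult_right_mono) (auto simp: a_def)
    also have "\<dots> < \<delta>" using p \<delta> by simp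
    finally show ?thesis .
  qed
  then have gap: "0 < n + 1 + 2 * a - c * (p + 1)" by (simp add: c_def \<delta>_def field_simps)
  define H where "H = (\<lambda>z h. \<Sum>b\<in>Basis. (gradient (late_cone \<sigma>) (dir_deriv (late_cone \<sigma>) b \<phi>) z \<bullet> h) *\<^sub>R b)"
  \<comment> \<open>Any unit direction and any slope strictly between \<sigma> and 1 would serve for
    the ray of vertices; a coordinate axis and the midpoint are taken.\<close>
  fix k :: 'n
  interpret subconformal_wave \<sigma> "(1 + \<sigma>) / 2" "axis k 1 :: real ^ 'n" p a c CV V \<phi>
    "gradient (late_cone \<sigma>) \<phi>" "gradient (late_cone \<sigma>) V" H
  proof unfold_locales
    show "0 < \<sigma>" "\<sigma> < (1 + \<sigma>) / 2" "(1 + \<sigma>) / 2 < 1" using \<sigma> by auto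
    show "norm (axis k 1 :: real ^ 'n) = 1" by (simp add: norm_axis_1)
    show "1 \<le> p" "0 < a" "a \<le> 1" by (fact p a)+
    show "c = (real DIM(real ^ 'n) - 1) / 2 + a" by (simp add: c_def n_def)
    show "0 < real DIM(real ^ 'n) + 1 + 2 * a - c * (p + 1)" using gap by (simp add: n_def)
    show "C1_on (late_cone \<sigma>) \<phi> (\<lambda>z h. gradient (late_cone \<sigma>) \<phi> z \<bullet> h)"
      by (rule C1_on_gradient[OF C_k_on_1_of_2[OF asm(4)]])
    show "C1_on (late_cone \<sigma>) (gradient (late_cone \<sigma>) \<phi>) H" unfolding H_def by (rule C1_on_gradient_2[OF asm(4)])
    show "C1_on (late_cone \<sigma>) V (\<lambda>z h. gradient (late_cone \<sigma>) V z \<bullet> h)" by (rule C1_on_gradient[OF asm(1)])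
    show "0 < CV" using CV by simp
    show "inverse CV \<le> V z" "V z \<le> CV" if "z \<in> late_cone \<sigma>" for z using CV(2)[OF that] by auto
    show "\<exists>T. \<forall>z\<in>late_cone \<sigma>. T \<le> fst z \<longrightarrow> norm (gradient (late_cone \<sigma>) V z) \<le> \<epsilon> * inverse (fst z)" if "\<epsilon> > 0" for \<epsilon>
      using asm(3)[rule_format, OF that] by (fastforce simp: grad_sq_eq)
    show "lin_trace (\<lambda>h. reflect (H z h)) + V z * (\<bar>\<phi> z\<bar> powr (p - 1) * \<phi> z) = 0" if "z \<in> late_cone \<sigma>" for z
      using asm(5) that unfolding wave_op_eq H_def by blast
  qed
  have cont: "continuous_on (late_cone \<sigma>) energy"
    unfolding energy_def[abs_def] by (intro continuous_intros cont_data)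
  have "ennreal (sqrt \<bar>1 - 1 / \<sigma>\<^sup>2\<bar>) * (\<integral>\<^sup>+x. ennreal (lateral energy x) \<partial>lborel) < \<infinity>"
    using asm(6) nn_integral_cone_boundary[OF \<sigma>(1) cont] unfolding grad_sq_eq energy_def[symmetric] lateral_def
    by (simp add: energy_def)
  \<comment> \<open>As \<sigma> < 1, the lateral boundary is timelike and not null, so the density
    constant is nonzero and finiteness passes to the integral over \<open>x\<close>.\<close>
  moreover have "sqrt \<bar>1 - 1 / \<sigma>\<^sup>2\<bar> > 0"
  proof -
    have "\<sigma> \<noteq> 1" using assms(2) by simp
    then show ?thesis using assms(1) by (simp add: field_simps power2_eq_1_iff)
  qed
  ultimately have "(\<integral>\<^sup>+x. ennreal (lateral energy x) \<partial>lborel) < \<infinity>"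
    by (auto simp: ennreal_mult_less_top)
  from weighted_potential_finite[OF this] show ?thesis
    unfolding time_cone_late_eq[OF \<sigma>(1)]
    by (simp add: mult.commute ennreal_mult' flip: ennreal_indicator)
qed

end
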